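(* There is an absolute constant $c>0$ such that for every $n\ge 1$ and every planar graph $G$ with $n$ vertices the following hold, where $t(G)$ denotes the number of spanning trees of $G$: (i) $t(G)\le c\cdot 5.28515^n$; (ii) if $G$ is $3$-connected and contains no triangle, then $t(G)\le c\cdot 3.41619^n$; (iii) if $G$ is $3$-connected and contains neither a triangle nor a quadrilateral, then $t(G)\le c\cdot 2.71567^n$.
   Context: A triangle is a cycle of length $3$ and a quadrilateral is a cycle of length $4$. $t(G)$ is the number of (labeled) spanning trees of $G$. *)

theory Defs
  imports "HOL-Analysis.Analysis"
begin

definition simple_graph :: "'a set \<Rightarrow> 'a set set \<Rightarrow> bool" where
  "simple_graph V E \<longleftrightarrow> finite V \<and> (\<forall>e\<in>E. e \<subseteq> V \<and> card e = 2)"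

definition adjacency :: "'a set set \<Rightarrow> ('a \<times> 'a) set" where
  "adjacency E = {(u, v). {u, v} \<in> E}"

definition graph_connected :: "'a set \<Rightarrow> 'a set set \<Rightarrow> bool" where
  "graph_connected V E \<longleftrightarrow> V \<noteq> {} \<and> (\<forall>u\<in>V. \<forall>v\<in>V. (u, v) \<in> (adjacency E)\<^sup>*)"

text \<open>
  A cycle is given by the list of its vertices in cyclic order. The lower bound on the length
  excludes traversing a single edge back and forth.
\<close>

definition graph_cycle :: "'a set set \<Rightarrow> 'a list \<Rightarrow> bool" where
  "graph_cycle E vs \<longleftrightarrow> 3 \<le> length vs \<and> distinct vs \<and>
     (\<forall>i<length vs. {vs ! i, vs ! (Suc i mod length vs)} \<in> E)"

definition has_triangle :: "'a set set \<Rightarrow> bool" where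
  "has_triangle E \<longleftrightarrow> (\<exists>vs. graph_cycle E vs \<and> length vs = 3)"

definition has_quadrilateral :: "'a set set \<Rightarrow> bool" where
  "has_quadrilateral E \<longleftrightarrow> (\<exists>vs. graph_cycle E vs \<and> length vs = 4)"

definition graph_tree :: "'a set \<Rightarrow> 'a set set \<Rightarrow> bool" where
  "graph_tree V T \<longleftrightarrow> graph_connected V T \<and> (\<nexists>vs. graph_cycle T vs)"

text \<open>
  A spanning tree contains all vertices, so it is determined by its edge set. The vertices are
  distinguishable; isomorphic spanning trees with different edge sets are counted separately.
\<close>

definition spanning_trees :: "'a set \<Rightarrow> 'a set set \<Rightarrow> 'a set set set" where
  "spanning_trees V E = {T. T \<subseteq> E \<and> graph_tree V T}"

definition num_spanning_trees :: "'a set \<Rightarrow> 'a set set \<Rightarrow> nat" where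
  "num_spanning_trees V E = card (spanning_trees V E)"

definition delete_vertices_edges :: "'a set \<Rightarrow> 'a set set \<Rightarrow> 'a set set" where
  "delete_vertices_edges S E = {e \<in> E. e \<inter> S = {}}"

definition k_connected :: "nat \<Rightarrow> 'a set \<Rightarrow> 'a set set \<Rightarrow> bool" where
  "k_connected k V E \<longleftrightarrow> k < card V \<and>
     (\<forall>S\<subseteq>V. card S < k \<longrightarrow> graph_connected (V - S) (delete_vertices_edges S E))"

text \<open>
  A drawing in the plane, here the type of complex numbers, without crossings: vertices are
  distinct points, each edge is a Jordan arc joining its end vertices and passing through no
  other vertex, and two different edges meet at most in common end vertices.
\<close>

definition plane_drawing ::
    "'a set \<Rightarrow> 'a set set \<Rightarrow> ('a \<Rightarrow> complex) \<Rightarrow> ('a set \<Rightarrow> real \<Rightarrow> complex) \<Rightarrow> bool" where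
  "plane_drawing V E p \<gamma> \<longleftrightarrow>
     inj_on p V \<and>
     (\<forall>e\<in>E. arc (\<gamma> e) \<and> {pathstart (\<gamma> e), pathfinish (\<gamma> e)} = p ` e \<and>
             path_image (\<gamma> e) \<inter> p ` V = p ` e) \<and>
     (\<forall>e\<in>E. \<forall>f\<in>E. e \<noteq> f \<longrightarrow> path_image (\<gamma> e) \<inter> path_image (\<gamma> f) = p ` (e \<inter> f))"

definition planar_graph :: "'a set \<Rightarrow> 'a set set \<Rightarrow> bool" where
  "planar_graph V E \<longleftrightarrow> simple_graph V E \<and> (\<exists>p \<gamma>. plane_drawing V E p \<gamma>)"

end

theory Submission
  imports Defs "Jordan_Normal_Form.Schur_Decomposition"
begin

text \<open>
  Orienting a spanning tree towards a root and expanding a determinant over all functions that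
  send a vertex to a neighbour (or declare it a root) shows that
  \<open>\<epsilon> t(G) \<le> det ((1 + \<epsilon>) D - A)\<close>, with degree matrix \<open>D\<close> and adjacency matrix \<open>A\<close>. The right-hand
  side is \<open>\<Prod> d\<^sub>v\<close> times \<open>\<Prod> (1 + \<epsilon> - \<mu>)\<close> over the eigenvalues \<open>\<mu> \<in> [-1, 1]\<close> of the random walk
  matrix \<open>P\<close>. A polynomial of degree five above the logarithm bounds \<open>\<Sum> ln (1 + \<epsilon> - \<mu>)\<close> by a
  combination of the traces of \<open>P\<^sup>k\<close>, \<open>k \<le> 5\<close>, which are sums over closed walks and only need to be
  bounded from below. Walks along an edge and back, and (for triangle-free graphs) all
  backtracking walks of length four, give sums over vertices of functions of the degree; in the
  general case the walks of length five around a triangular face with a detour along one edge are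
  used as well. Euler's formula bounds the sum of the degrees and provides the triangular faces,
  and concavity of the logarithm makes the regular case extremal up to a small loss.

  Euler's formula is obtained for arbitrary Jordan arcs: by Janiszewski's theorem an edge joining
  two components of the drawing separates nothing, and by the Jordan curve theorem an edge closing
  a cycle splits exactly one face into exactly two.
\<close>

section \<open>Paths and cycles\<close>

text \<open>At \<open>\<epsilon> = 0\<close> the determinant vanishes, because 1 is an eigenvalue of
  the walk. The shift \<open>\<epsilon> = 0.0001\<close> avoids cofactors and any estimate of a
  spectral gap: it costs at most 0.0001 per vertex in the exponent, and its reciprocal 10000 becomes
  the absolute constant. The polynomials have the form
  \<open>c 0 - c 1 * x - ... - c 5 * x ^ 5\<close> with nonnegative coefficients. As
  \<open>P\<close> has trace zero, the linear coefficient is free; the other traces are nonnegative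
  and subtracted, so each may be underestimated by any family of closed walks, or dropped. Euler's
  formula bounds the mean degree by 6, by 4 without triangles, and by 10/3 without triangles and
  quadrilaterals. It acts through a Lagrange multiplier: a term
  \<open>k * (real (deg i) - m)\<close>, whose sum over all vertices is at most zero, is split off,
  and each vertex is then bounded on its own. 3-connectedness enters through the minimum degree
  3.\<close>

fun path_edges :: "'a list \<Rightarrow> 'a set set" where
  "path_edges (x # y # zs) = insert {x, y} (path_edges (y # zs))"
| "path_edges _ = {}"

lemma path_edges_subset_set: "e \<in> path_edges vs \<Longrightarrow> e \<subseteq> set vs"
  by (induction vs rule: path_edges.induct) auto

lemma path_edges_nth: "path_edges vs = {{vs ! i, vs ! Suc i} |i. Suc i < length vs}"
proof (induction vs rule: path_edges.induct)
  case (1 x y zs)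
  have "{{(x # y # zs) ! i, (x # y # zs) ! Suc i} |i. Suc i < length (x # y # zs)} =
        insert {x, y} {{(y # zs) ! i, (y # zs) ! Suc i} |i. Suc i < length (y # zs)}" (is "?L = ?R")
  proof
    show "?L \<subseteq> ?R"
    proof
      fix e assume "e \<in> ?L"
      then obtain i where "e = {(x # y # zs) ! i, (x # y # zs) ! Suc i}" "Suc i < length (x # y # zs)"
        by blast
      then show "e \<in> ?R" by (cases i) auto
    qed
    have "{x, y} \<in> ?L" by (rule CollectI, rule exI[of _ 0]) simp
    moreover have "{(y # zs) ! i, (y # zs) ! Suc i} \<in> ?L" if "Suc i < length (y # zs)" for i
      using that by (intro CollectI exI[of _ "Suc i"]) simp
    ultimately show "?R \<subseteq> ?L" by blast
  qed
  with 1 show ?case by simp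
qed simp_all

lemma path_edges_drop: "path_edges (drop k vs) \<subseteq> path_edges vs"
proof
  fix e assume "e \<in> path_edges (drop k vs)"
  then obtain i where "e = {drop k vs ! i, drop k vs ! Suc i}" "Suc i < length (drop k vs)"
    unfolding path_edges_nth by blast
  then show "e \<in> path_edges vs"
    unfolding path_edges_nth by (intro CollectI exI[of _ "k + i"]) auto
qed

lemma rtrancl_adjacency_imp_path:
  assumes "(x, y) \<in> (adjacency E)\<^sup>*"
  shows "\<exists>vs. vs \<noteq> [] \<and> distinct vs \<and> hd vs = x \<and> last vs = y \<and> path_edges vs \<subseteq> E"
  using assms
proof (induction rule: converse_rtrancl_induct)
  case base
  show ?case by (rule exI[of _ "[y]"]) simp
next
  case (step x z)
  then obtain vs where vs: "vs \<noteq> []" "distinct vs" "hd vs = z" "last vs = y" "path_edges vs \<subseteq> E"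
    by blast
  show ?case
  proof (cases "x \<in> set vs")
    case True
    then obtain k where k: "k < length vs" "vs ! k = x" by (auto simp: in_set_conv_nth)
    then show ?thesis using vs path_edges_drop[of k vs]
      by (intro exI[of _ "drop k vs"]) (auto simp: hd_drop_conv_nth)
  next
    case False
    obtain ws where ws: "vs = z # ws" using vs by (cases vs) auto
    show ?thesis using vs False step(1) unfolding ws
      by (intro exI[of _ "x # z # ws"]) (auto simp: adjacency_def)
  qed
qed

text \<open>The closing edge has to be new: this excludes a path with two vertices, whose closure
  would only repeat its edge.\<close>

lemma graph_cycle_of_path:
  assumes vs: "distinct vs" "vs \<noteq> []" "path_edges vs \<subseteq> E" and e: "{hd vs, last vs} \<notin> E" "hd vs \<noteq> last vs"
  shows "graph_cycle (insert {hd vs, last vs} E) vs"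
proof -
  have len: "length vs \<ge> 3"
  proof (rule ccontr)
    assume "\<not> 3 \<le> length vs"
    with vs(2) obtain x y where "vs = [x] \<or> vs = [x, y]"
      by (cases vs rule: path_edges.cases) (auto simp: Suc_le_eq)
    then show False using vs e by auto
  qed
  have "{vs ! i, vs ! (Suc i mod length vs)} \<in> insert {hd vs, last vs} E" if i: "i < length vs" for i
  proof (cases "Suc i = length vs")
    case True
    then have "i = length vs - 1" by simp
    then have "vs ! i = last vs" "vs ! (Suc i mod length vs) = hd vs"
      using vs(2) by (simp_all add: last_conv_nth hd_conv_nth)
    then show ?thesis by (simp add: insert_commute)
  next
    case False
    with i have "Suc i < length vs" by simp
    then show ?thesis using vs(3) unfolding path_edges_nth by auto
  qed
  with len vs(1) show ?thesis unfolding graph_cycle_def by blast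
qed

lemma adjacency_sym: "sym (adjacency E)"
  unfolding adjacency_def sym_def by (simp add: insert_commute)

lemma acyclic_edge_is_bridge:
  assumes "\<nexists>vs. graph_cycle E vs" "{x, y} \<in> E" "x \<noteq> y"
  shows "(x, y) \<notin> (adjacency (E - {{x, y}}))\<^sup>*"
proof
  assume "(x, y) \<in> (adjacency (E - {{x, y}}))\<^sup>*"
  then obtain vs where vs: "vs \<noteq> []" "distinct vs" "hd vs = x" "last vs = y" "path_edges vs \<subseteq> E - {{x, y}}"
    by (auto dest!: rtrancl_adjacency_imp_path)
  then have "graph_cycle (insert {hd vs, last vs} (E - {{x, y}})) vs"
    using assms by (intro graph_cycle_of_path) auto
  then show False using assms vs by (simp add: insert_absorb)
qed

lemma graph_cycle_mono: "graph_cycle E vs \<Longrightarrow> E \<subseteq> E' \<Longrightarrow> graph_cycle E' vs"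
  unfolding graph_cycle_def by blast

text \<open>Two equal edges at different positions would have to be each other's successor in the
  cyclic order, which length at least 3 forbids.\<close>

lemma card_graph_cycle_edges:
  assumes "graph_cycle E vs"
  shows "card ((\<lambda>i. {vs ! i, vs ! (Suc i mod length vs)}) ` {..<length vs}) = length vs"
proof -
  let ?n = "length vs"
  have n: "?n \<ge> 3" and d: "distinct vs" using assms by (auto simp: graph_cycle_def)
  have "inj_on (\<lambda>i. {vs ! i, vs ! (Suc i mod ?n)}) {..<?n}"
  proof (rule inj_onI, rule ccontr)
    fix i j assume ij: "i \<in> {..<?n}" "j \<in> {..<?n}" "i \<noteq> j"
      and eq: "{vs ! i, vs ! (Suc i mod ?n)} = {vs ! j, vs ! (Suc j mod ?n)}"
    have l: "Suc i mod ?n < ?n" "Suc j mod ?n < ?n" using n by (auto intro!: mod_less_divisor)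
    have "vs ! i \<noteq> vs ! j" using ij d by (simp add: nth_eq_iff_index_eq)
    with eq have "vs ! i = vs ! (Suc j mod ?n)" "vs ! j = vs ! (Suc i mod ?n)"
      by (auto simp: doubleton_eq_iff)
    with ij d l have a: "i = Suc j mod ?n" "j = Suc i mod ?n"
      by (simp_all add: nth_eq_iff_index_eq)
    show False
    proof (cases "Suc j = ?n")
      case True
      with a have "i = 0" by simp
      with a n True show False by simp
    next
      case False
      with a(1) ij have "i = Suc j" by simp
      with a(2) ij n show False by (cases "Suc i = ?n") auto
    qed
  qed
  then show ?thesis by (simp add: card_image)
qed

section \<open>Faces of a plane drawing\<close>

locale plane_graph =
  fixes V :: "'a set" and E :: "'a set set" and p :: "'a \<Rightarrow> complex" and \<gamma> :: "'a set \<Rightarrow> real \<Rightarrow> complex"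
  assumes simple: "simple_graph V E" and drawing: "plane_drawing V E p \<gamma>"
begin

text \<open>Every subdrawing keeps all vertices, so that adding an edge adds nothing but its arc.
  The extra isolated points do not separate the plane.\<close>

definition drawn :: "'a set set \<Rightarrow> complex set" where
  "drawn F = p ` V \<union> (\<Union>e\<in>F. path_image (\<gamma> e))"

definition faces :: "'a set set \<Rightarrow> complex set set" where
  "faces F = components (- drawn F)"

definition edge_interior :: "'a set \<Rightarrow> complex set" where
  "edge_interior e = path_image (\<gamma> e) - p ` e"

text \<open>The boundary is recorded as a set: an edge with the same face on both sides is counted
  once, and double counting gives an inequality.\<close>

definition face_edges :: "complex set \<Rightarrow> 'a set set" where
  "face_edges K = {e \<in> E. frontier K \<inter> edge_interior e \<noteq> {}}"

lemma finite_V: "finite V" and edge_subset: "e \<in> E \<Longrightarrow> e \<subseteq> V" and card_edge: "e \<in> E \<Longrightarrow> card e = 2"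
  using simple by (auto simp: simple_graph_def)

lemma finite_E: "finite E"
proof (rule finite_subset)
  show "E \<subseteq> Pow V" using edge_subset by blast
qed (simp add: finite_V)

lemma inj_p: "inj_on p V"
  and arc_edge: "e \<in> E \<Longrightarrow> arc (\<gamma> e)"
  and ends_edge: "e \<in> E \<Longrightarrow> {pathstart (\<gamma> e), pathfinish (\<gamma> e)} = p ` e"
  and edge_Int_vertices: "e \<in> E \<Longrightarrow> path_image (\<gamma> e) \<inter> p ` V = p ` e"
  and edge_Int_edge: "e \<in> E \<Longrightarrow> f \<in> E \<Longrightarrow> e \<noteq> f \<Longrightarrow>
    path_image (\<gamma> e) \<inter> path_image (\<gamma> f) = p ` (e \<inter> f)"
  using drawing unfolding plane_drawing_def by blast+

lemma edgeE:
  assumes "e \<in> E"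
  obtains x y where "e = {x, y}" "x \<noteq> y" "x \<in> V" "y \<in> V"
  using card_edge[OF assms] edge_subset[OF assms] by (auto simp: card_2_iff)

lemma compact_edge: "e \<in> E \<Longrightarrow> compact (path_image (\<gamma> e))"
  using arc_edge arc_imp_path compact_path_image by blast

lemma drawn_insert: "drawn (insert e F) = path_image (\<gamma> e) \<union> drawn F"
  by (auto simp: drawn_def)

lemma drawn_mono: "F \<subseteq> F' \<Longrightarrow> drawn F \<subseteq> drawn F'"
  by (auto simp: drawn_def)

lemma compact_subdrawing:
  assumes "A \<subseteq> V" "F \<subseteq> E"
  shows "compact (p ` A \<union> (\<Union>e\<in>F. path_image (\<gamma> e)))"
proof (intro compact_Un compact_UN)
  show "compact (p ` A)" using assms finite_V by (simp add: finite_imp_compact finite_subset)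
  show "finite F" using assms finite_E finite_subset by blast
  show "compact (path_image (\<gamma> e))" if "e \<in> F" for e using that assms compact_edge by blast
qed

lemma compact_drawn: "F \<subseteq> E \<Longrightarrow> compact (drawn F)"
  unfolding drawn_def by (intro compact_subdrawing) auto

lemma closed_drawn: "F \<subseteq> E \<Longrightarrow> closed (drawn F)"
  by (simp add: compact_drawn compact_imp_closed)

lemma edge_Int_drawn:
  assumes "F \<subseteq> E" "e \<in> E" "e \<notin> F"
  shows "path_image (\<gamma> e) \<inter> drawn F = p ` e"
proof -
  have "path_image (\<gamma> e) \<inter> path_image (\<gamma> f) \<subseteq> p ` e" if "f \<in> F" for f
    using that assms edge_Int_edge[of e f] by blast
  then show ?thesis
    using edge_Int_vertices[OF assms(2)] unfolding drawn_def by blast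
qed

lemma edge_interior_Int_drawn:
  assumes "F \<subseteq> E" "e \<in> E" "e \<notin> F"
  shows "edge_interior e \<inter> drawn F = {}"
  using edge_Int_drawn[OF assms] unfolding edge_interior_def by blast

lemma edge_interior_eq:
  assumes "e \<in> E"
  shows "edge_interior e = \<gamma> e ` {0<..<1}"
proof -
  have inj: "inj_on (\<gamma> e) {0..1}" using arc_edge[OF assms] by (simp add: arc_def)
  have "{0..1} = {0<..<1::real} \<union> {0, 1}" by auto
  moreover have "p ` e = \<gamma> e ` {0, 1}"
    using ends_edge[OF assms] by (auto simp: pathstart_def pathfinish_def)
  ultimately show ?thesis using inj
    unfolding edge_interior_def path_image_def by (auto simp: inj_on_def)
qed

lemma connected_edge_interior:
  assumes "e \<in> E"
  shows "connected (edge_interior e)"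
proof -
  have "continuous_on {0..1} (\<gamma> e)"
    using arc_edge[OF assms] by (simp add: arc_def path_def)
  then have "continuous_on {0<..<1} (\<gamma> e)"
    by (rule continuous_on_subset) auto
  then show ?thesis
    unfolding edge_interior_eq[OF assms] by (rule connected_continuous_image) simp
qed

lemma edge_interior_nonempty: "e \<in> E \<Longrightarrow> edge_interior e \<noteq> {}"
  by (simp add: edge_interior_eq)

lemma drawn_subset_imp_subset:
  assumes "F \<subseteq> E" "F' \<subseteq> E" "drawn F \<subseteq> drawn F'"
  shows "F \<subseteq> F'"
proof
  fix e assume e: "e \<in> F"
  then have "edge_interior e \<subseteq> drawn F'"
    using assms(3) unfolding drawn_def edge_interior_def by blast
  then show "e \<in> F'"
    using edge_interior_Int_drawn[OF assms(2), of e] edge_interior_nonempty[of e] e assms(1) by blast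
qed

section \<open>Separation of the plane by one further edge\<close>

lemma arc_of_path:
  assumes "distinct vs" "length vs \<ge> 2" "path_edges vs \<subseteq> F" "F \<subseteq> E"
  shows "\<exists>g. arc g \<and> pathstart g = p (hd vs) \<and> pathfinish g = p (last vs) \<and>
             path_image g = (\<Union>e\<in>path_edges vs. path_image (\<gamma> e))"
  using assms(1-3)
proof (induction vs rule: path_edges.induct)
  case (1 x y zs)
  let ?e = "{x, y}"
  have e: "?e \<in> E" using 1 assms by auto
  obtain h where h: "arc h" "pathstart h = p x" "pathfinish h = p y" "path_image h = path_image (\<gamma> ?e)"
  proof (cases "pathstart (\<gamma> ?e) = p x")
    case True
    moreover have "pathfinish (\<gamma> ?e) = p y"
    proof -
      have "p x \<noteq> p y" using edge_subset[OF e] inj_p 1(2) by (auto simp: inj_on_def)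
      then show ?thesis using ends_edge[OF e] True by (auto simp: doubleton_eq_iff)
    qed
    ultimately show ?thesis using that[of "\<gamma> ?e"] arc_edge[OF e] by blast
  next
    case False
    then have "pathstart (\<gamma> ?e) = p y" "pathfinish (\<gamma> ?e) = p x"
      using ends_edge[OF e] by (auto simp: doubleton_eq_iff)
    then show ?thesis using that[of "reversepath (\<gamma> ?e)"] arc_edge[OF e] by (simp add: arc_reversepath)
  qed
  show ?case
  proof (cases zs)
    case Nil
    then show ?thesis using h by auto
  next
    case (Cons z zs')
    with 1 obtain g where g: "arc g" "pathstart g = p y" "pathfinish g = p (last (y # zs))"
      "path_image g = (\<Union>e\<in>path_edges (y # zs). path_image (\<gamma> e))" by auto
    have "path_image h \<inter> path_image g \<subseteq> {p y}"
    proof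
      fix q assume q: "q \<in> path_image h \<inter> path_image g"
      then obtain f where f: "f \<in> path_edges (y # zs)" "q \<in> path_image (\<gamma> f)" using g by auto
      have "f \<subseteq> set (y # zs)" using f path_edges_subset_set by blast
      then have "x \<notin> f" using 1(2) by auto
      moreover have "f \<in> E" using f 1(4) assms by auto
      ultimately have "q \<in> p ` ({x, y} \<inter> f)"
        using edge_Int_edge[OF e, of f] q f h by blast
      then show "q \<in> {p y}" using \<open>x \<notin> f\<close> by auto
    qed
    then have "arc (h +++ g)" using h g by (intro arc_join) auto
    moreover have "path_image (h +++ g) = (\<Union>e\<in>path_edges (x # y # zs). path_image (\<gamma> e))"
      using h g by (simp add: path_image_join)
    ultimately show ?thesis using h g by (intro exI[of _ "h +++ g"]) simp
  qed
qed auto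

text \<open>Janiszewski's theorem is applied twice. The arc of \<open>e\<close> meets the part
  \<open>G1\<close> around \<open>x\<close> only in \<open>p x\<close>, and the union of the two
  meets the rest \<open>G2\<close> only in \<open>p y\<close>. If two compact or closed sets each
  leave \<open>a\<close> and \<open>b\<close> together and intersect in a connected set, so does
  their union.\<close>

lemma bridge_not_separating:
  assumes F: "F \<subseteq> E" "e \<in> E" "e \<notin> F" and e: "e = {x, y}" "(x, y) \<notin> (adjacency F)\<^sup>*"
    and ab: "connected_component (- drawn F) a b" "a \<notin> path_image (\<gamma> e)" "b \<notin> path_image (\<gamma> e)"
  shows "connected_component (- drawn (insert e F)) a b"
proof -
  define V1 where "V1 = {v \<in> V. (x, v) \<in> (adjacency F)\<^sup>*}"
  define F1 where "F1 = {f \<in> F. f \<subseteq> V1}"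
  define G1 where "G1 = p ` V1 \<union> (\<Union>f\<in>F1. path_image (\<gamma> f))"
  define G2 where "G2 = p ` (V - V1) \<union> (\<Union>f\<in>F - F1. path_image (\<gamma> f))"
  have xy: "x \<in> V" "y \<in> V" using edge_subset[OF F(2)] e by auto
  have xV: "x \<in> V1" and yV: "y \<notin> V1" using xy e by (auto simp: V1_def)
  have V1V: "V1 \<subseteq> V" by (auto simp: V1_def)
  \<comment> \<open>\<open>V1\<close> is closed under adjacency, so an edge lies inside it or misses
    it.\<close>
  have F2: "f \<inter> V1 = {}" if f: "f \<in> F - F1" for f
  proof (rule ccontr)
    assume "f \<inter> V1 \<noteq> {}"
    then obtain u where u: "u \<in> f" "(x, u) \<in> (adjacency F)\<^sup>*" by (auto simp: V1_def)
    have fE: "f \<in> E" using f F by auto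
    have "f \<subseteq> V1"
    proof
      fix w assume w: "w \<in> f"
      have "(u, w) \<in> (adjacency F)\<^sup>*"
      proof (cases "u = w")
        case False
        with w u card_edge[OF fE] have "f = {u, w}" by (auto simp: card_2_iff)
        then have "(u, w) \<in> adjacency F" using f by (auto simp: adjacency_def)
        then show ?thesis by blast
      qed auto
      then show "w \<in> V1" using u w edge_subset[OF fE] by (auto simp: V1_def intro: rtrancl_trans)
    qed
    then show False using f by (auto simp: F1_def)
  qed
  have un: "G1 \<union> G2 = drawn F" unfolding G1_def G2_def drawn_def using V1V F1_def by auto
  have G1V: "G1 \<inter> p ` V \<subseteq> p ` V1"
  proof -
    have "path_image (\<gamma> f) \<inter> p ` V \<subseteq> p ` V1" if "f \<in> F1" for f
      using that F edge_Int_vertices[of f] by (auto simp: F1_def)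
    moreover have "p ` V1 \<inter> p ` V \<subseteq> p ` V1" by blast
    ultimately show ?thesis unfolding G1_def by blast
  qed
  have disj_p: "p ` A \<inter> p ` B = {}" if "A \<subseteq> V" "B \<subseteq> V" "A \<inter> B = {}" for A B
    using inj_on_image_Int[OF inj_p, of A B] that by simp
  have G12: "G1 \<inter> G2 = {}"
  proof -
    have A1: "p ` V1 \<inter> p ` (V - V1) = {}" using V1V by (intro disj_p) auto
    have A2: "p ` V1 \<inter> path_image (\<gamma> f) = {}" if "f \<in> F - F1" for f
    proof -
      have fE: "f \<in> E" using that F by auto
      have "p ` V1 \<inter> path_image (\<gamma> f) \<subseteq> p ` f" using edge_Int_vertices[OF fE] V1V by blast
      moreover have "p ` V1 \<inter> p ` f = {}" using F2[OF that] edge_subset[OF fE] V1V by (intro disj_p) auto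
      ultimately show ?thesis by blast
    qed
    have A3: "path_image (\<gamma> f) \<inter> p ` (V - V1) = {}" if "f \<in> F1" for f
    proof -
      have fE: "f \<in> E" using that F by (auto simp: F1_def)
      have "path_image (\<gamma> f) \<inter> p ` (V - V1) \<subseteq> p ` f" using edge_Int_vertices[OF fE] by blast
      moreover have "p ` f \<inter> p ` (V - V1) = {}"
        using that edge_subset[OF fE] by (intro disj_p) (auto simp: F1_def)
      ultimately show ?thesis by blast
    qed
    have A4: "path_image (\<gamma> f) \<inter> path_image (\<gamma> f') = {}" if "f \<in> F1" "f' \<in> F - F1" for f f'
    proof -
      have "f \<inter> f' = {}" using F2[OF that(2)] that(1) by (auto simp: F1_def)
      moreover have "path_image (\<gamma> f) \<inter> path_image (\<gamma> f') = p ` (f \<inter> f')"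
        using that F by (intro edge_Int_edge) (auto simp: F1_def)
      ultimately show ?thesis by simp
    qed
    have "p ` V1 \<inter> G2 = {}" unfolding G2_def Int_Un_distrib Int_UN_distrib using A1 A2 by simp
    moreover have "path_image (\<gamma> f) \<inter> G2 = {}" if "f \<in> F1" for f
      unfolding G2_def Int_Un_distrib Int_UN_distrib using A3[OF that] A4[OF that] by simp
    ultimately have "z \<notin> G2" if "z \<in> G1" for z using that unfolding G1_def by auto
    then show ?thesis by blast
  qed
  have eint: "path_image (\<gamma> e) \<inter> drawn F = {p x, p y}" using edge_Int_drawn[OF F] e by simp
  have px: "p x \<in> G1" using xV by (auto simp: G1_def)
  have py: "p y \<in> G2" using xy yV by (auto simp: G2_def)
  have n: "p x \<notin> G2" "p y \<notin> G1" using G12 px py by auto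
  have ends: "z = p x \<or> z = p y" if "z \<in> path_image (\<gamma> e)" "z \<in> G1 \<or> z \<in> G2" for z
  proof -
    have "z \<in> path_image (\<gamma> e) \<inter> drawn F" using that un by auto
    then show ?thesis using eint by auto
  qed
  have m: "p x \<in> path_image (\<gamma> e)" "p y \<in> path_image (\<gamma> e)" using eint by auto
  have i1: "path_image (\<gamma> e) \<inter> G1 = {p x}" using ends n m px by fast
  have i2: "path_image (\<gamma> e) \<inter> G2 = {p y}" using ends n m py by fast
  have c1: "compact G1" unfolding G1_def
    using V1V F by (intro compact_subdrawing) (auto simp: F1_def)
  have c2: "compact G2" unfolding G2_def
    using F by (intro compact_subdrawing) auto
  have "connected_component (- path_image (\<gamma> e)) a b"
    using connected_arc_complement[OF arc_edge[OF F(2)]] ab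
    by (auto simp: connected_iff_connected_component)
  moreover have ab1: "connected_component (- G1) a b" "connected_component (- G2) a b"
    using ab(1) un by (auto intro: connected_component_of_subset)
  ultimately have "connected_component (- (path_image (\<gamma> e) \<union> G1)) a b"
    using c1 i1 by (intro Janiszewski compact_edge F compact_imp_closed) auto
  moreover have "(path_image (\<gamma> e) \<union> G1) \<inter> G2 = {p y}" using i2 G12 by auto
  ultimately have "connected_component (- ((path_image (\<gamma> e) \<union> G1) \<union> G2)) a b"
    using ab1 c1 c2 compact_edge[OF F(2)] by (intro Janiszewski[OF compact_Un]) (auto intro: compact_imp_closed)
  then show ?thesis using un by (simp add: drawn_insert Un_assoc)
qed


text \<open>\<open>I\<close> stands for one side of the new edge. The first part will limit the
  splitting of a face to two pieces, the second will produce two pieces. If \<open>F\<close> joins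
  the ends of \<open>e\<close>, the witness is the inside of the Jordan curve made of
  \<open>e\<close> and a path in \<open>F\<close>; for a bridge any set will do, since nothing is
  separated.\<close>

lemma ex_side:
  assumes F: "F \<subseteq> E" "e \<in> E" "e \<notin> F"
  shows "\<exists>I. \<forall>a b. connected_component (- drawn F) a b \<and> a \<notin> path_image (\<gamma> e) \<and> b \<notin> path_image (\<gamma> e) \<and>
    (a \<in> I \<longleftrightarrow> b \<in> I) \<longrightarrow> connected_component (- drawn (insert e F)) a b"
    and ex_two_sides: "graph_connected V F \<Longrightarrow>
      \<exists>I Q. open I \<and> open Q \<and> I \<inter> Q = {} \<and> - drawn (insert e F) \<subseteq> I \<union> Q \<and>
        edge_interior e \<subseteq> closure I \<and> edge_interior e \<subseteq> closure Q"
proof -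
  obtain x y where e: "e = {x, y}" "x \<noteq> y" "x \<in> V" "y \<in> V" using edgeE[OF F(2)] .
  have loop: "\<exists>c. simple_path c \<and> pathfinish c = pathstart c \<and> path_image (\<gamma> e) \<subseteq> path_image c \<and>
      path_image c \<subseteq> drawn (insert e F) \<and> connected (path_image c \<inter> drawn F)"
    if xy: "(x, y) \<in> (adjacency F)\<^sup>*"
  proof -
    obtain vs where vs: "vs \<noteq> []" "distinct vs" "hd vs = x" "last vs = y" "path_edges vs \<subseteq> F"
      using rtrancl_adjacency_imp_path[OF xy] by blast
    have "length vs \<ge> 2" using vs e by (cases vs rule: path_edges.cases) auto
    then obtain g where g: "arc g" "pathstart g = p x" "pathfinish g = p y"
        "path_image g = (\<Union>e\<in>path_edges vs. path_image (\<gamma> e))"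
      using arc_of_path[OF vs(2) _ vs(5) F(1)] vs by auto
    have gF: "path_image g \<subseteq> drawn F" using g vs by (auto simp: drawn_def)
    obtain h where h: "arc h" "pathstart h = p y" "pathfinish h = p x" "path_image h = path_image (\<gamma> e)"
    proof -
      have "path_edges [y, x] \<subseteq> {e}" using e by auto
      from arc_of_path[OF _ _ this] e F obtain h where "arc h \<and> pathstart h = p y \<and> pathfinish h = p x \<and>
          path_image h = (\<Union>e\<in>path_edges [y, x]. path_image (\<gamma> e))" by auto
      then show ?thesis using e by (intro that[of h]) (simp_all add: insert_commute)
    qed
    have hg: "path_image h \<inter> drawn F = {p x, p y}" using edge_Int_drawn[OF F] h e by auto
    have "simple_path (g +++ h)"
      using g h gF hg by (intro simple_path_join_loop) auto
    moreover have im: "path_image (g +++ h) = path_image g \<union> path_image h"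
      using g h by (simp add: path_image_join)
    moreover have "path_image (g +++ h) \<inter> drawn F = path_image g"
    proof -
      have "{p x, p y} \<subseteq> path_image g" using g pathstart_in_path_image[of g] pathfinish_in_path_image[of g] by auto
      then show ?thesis unfolding im using gF hg by blast
    qed
    moreover have "connected (path_image g)" using connected_path_image[OF arc_imp_path[OF g(1)]] .
    ultimately show ?thesis using g h gF
      by (intro exI[of _ "g +++ h"]) (auto simp: drawn_insert)
  qed
  show "\<exists>I. \<forall>a b. connected_component (- drawn F) a b \<and> a \<notin> path_image (\<gamma> e) \<and> b \<notin> path_image (\<gamma> e) \<and>
    (a \<in> I \<longleftrightarrow> b \<in> I) \<longrightarrow> connected_component (- drawn (insert e F)) a b"
  proof (cases "(x, y) \<in> (adjacency F)\<^sup>*")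
    case False
    then show ?thesis using bridge_not_separating[OF F e(1)] by blast
  next
    case True
    then obtain c where c: "simple_path c" "pathfinish c = pathstart c" "path_image (\<gamma> e) \<subseteq> path_image c"
      "path_image c \<subseteq> drawn (insert e F)" "connected (path_image c \<inter> drawn F)" using loop by blast
    have un: "path_image c \<union> drawn F = drawn (insert e F)" using c by (auto simp: drawn_insert)
    note J = Jordan_inside_outside[OF c(1,2)]
    show ?thesis
    proof (intro exI[of _ "inside (path_image c)"] allI impI)
      fix a b assume ab: "connected_component (- drawn F) a b \<and> a \<notin> path_image (\<gamma> e) \<and> b \<notin> path_image (\<gamma> e) \<and>
        (a \<in> inside (path_image c) \<longleftrightarrow> b \<in> inside (path_image c))"
      then have "a \<notin> drawn F" "b \<notin> drawn F" using connected_component_in by force+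
      then have "a \<notin> path_image c" "b \<notin> path_image c" using ab c(4) by (auto simp: drawn_insert)
      then have "a \<in> inside (path_image c) \<and> b \<in> inside (path_image c) \<or>
                 a \<in> outside (path_image c) \<and> b \<in> outside (path_image c)"
        using J ab by blast
      moreover have "inside (path_image c) \<subseteq> - path_image c" "outside (path_image c) \<subseteq> - path_image c"
        using J by blast+
      ultimately have "connected_component (- path_image c) a b"
        using J unfolding connected_component_def by metis
      \<comment> \<open>Janiszewski's theorem again: the curve meets \<open>drawn F\<close> exactly
        in the path that completes \<open>e\<close>, and this is connected.\<close>
      then have "connected_component (- (path_image c \<union> drawn F)) a b"
        using ab c(5) closed_drawn[OF F(1)] c(1)
        by (intro Janiszewski compact_path_image simple_path_imp_path) auto
      then show "connected_component (- drawn (insert e F)) a b" by (simp add: un)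
    qed
  qed
  show "\<exists>I Q. open I \<and> open Q \<and> I \<inter> Q = {} \<and> - drawn (insert e F) \<subseteq> I \<union> Q \<and>
        edge_interior e \<subseteq> closure I \<and> edge_interior e \<subseteq> closure Q" if "graph_connected V F"
  proof -
    have "(x, y) \<in> (adjacency F)\<^sup>*" using that e by (auto simp: graph_connected_def)
    then obtain c where c: "simple_path c" "pathfinish c = pathstart c" "path_image (\<gamma> e) \<subseteq> path_image c"
      "path_image c \<subseteq> drawn (insert e F)" using loop by blast
    note J = Jordan_inside_outside[OF c(1,2)]
    have "path_image c \<subseteq> closure (inside (path_image c))" "path_image c \<subseteq> closure (outside (path_image c))"
      using J frontier_def by blast+
    then show ?thesis using J c(3,4)
      by (intro exI[of _ "inside (path_image c)"] exI[of _ "outside (path_image c)"])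
         (auto simp: edge_interior_def)
  qed
qed

section \<open>How a new edge changes the faces\<close>

lemma face_of_edge:
  assumes F: "F \<subseteq> E" "e \<in> E" "e \<notin> F"
  obtains K where "K \<in> faces F" "edge_interior e \<subseteq> K"
proof -
  have "edge_interior e \<subseteq> - drawn F" using edge_interior_Int_drawn[OF F] by blast
  then show ?thesis
    using that exists_component_superset[of "edge_interior e" "- drawn F"]
      connected_edge_interior edge_interior_nonempty F unfolding faces_def by blast
qed

lemma open_face: "F \<subseteq> E \<Longrightarrow> K \<in> faces F \<Longrightarrow> open K"
  unfolding faces_def by (metis closed_drawn open_Compl open_components)

lemma face_subset_Compl: "K \<in> faces F \<Longrightarrow> K \<subseteq> - drawn F"
  and face_nonempty: "K \<in> faces F \<Longrightarrow> K \<noteq> {}"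
  and connected_face: "K \<in> faces F \<Longrightarrow> connected K"
  unfolding faces_def by (auto simp: in_components_maximal)

lemma subset_face:
  "K \<in> faces F \<Longrightarrow> connected T \<Longrightarrow> T \<inter> drawn F = {} \<Longrightarrow> T \<inter> K \<noteq> {} \<Longrightarrow> T \<subseteq> K"
  unfolding faces_def by (rule components_maximal) auto

lemma face_eqI:
  "K \<in> faces F \<Longrightarrow> K' \<in> faces F \<Longrightarrow> K \<inter> K' \<noteq> {} \<Longrightarrow> K = K'"
  unfolding faces_def by (simp add: components_eq)

text \<open>A new face inside \<open>K\<close> is determined by the side on which a chosen point of
  it lies. This is an injection into \<open>bool\<close>.\<close>

lemma card_faces_within:
  assumes F: "F \<subseteq> E" "e \<in> E" "e \<notin> F" and K: "K \<in> faces F"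
  shows "finite {L \<in> faces (insert e F). L \<subseteq> K} \<and> card {L \<in> faces (insert e F). L \<subseteq> K} \<le> 2"
proof -
  obtain I where I: "\<And>a b. connected_component (- drawn F) a b \<Longrightarrow> a \<notin> path_image (\<gamma> e) \<Longrightarrow>
      b \<notin> path_image (\<gamma> e) \<Longrightarrow> (a \<in> I \<longleftrightarrow> b \<in> I) \<Longrightarrow> connected_component (- drawn (insert e F)) a b"
    using ex_side[OF F] by metis
  let ?S = "{L \<in> faces (insert e F). L \<subseteq> K}"
  define a where "a L = (SOME z. z \<in> L)" for L :: "complex set"
  have a: "a L \<in> L" if "L \<in> faces G" for L G
    using face_nonempty[OF that] unfolding a_def by (simp add: some_in_eq)
  have "inj_on (\<lambda>L. a L \<in> I) ?S"
  proof (rule inj_onI)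
    fix L M assume LM: "L \<in> ?S" "M \<in> ?S" "(a L \<in> I) = (a M \<in> I)"
    have "a L \<in> K" "a M \<in> K" using a LM by blast+
    then have "connected_component (- drawn F) (a L) (a M)"
      using connected_face[OF K] face_subset_Compl[OF K] unfolding connected_component_def by blast
    moreover have "a L \<notin> path_image (\<gamma> e)" "a M \<notin> path_image (\<gamma> e)"
      using a LM face_subset_Compl[of _ "insert e F"] by (auto simp: drawn_insert)
    ultimately have "connected_component (- drawn (insert e F)) (a L) (a M)" using I LM(3) by blast
    then obtain T where T: "connected T" "T \<subseteq> - drawn (insert e F)" "a L \<in> T" "a M \<in> T"
      unfolding connected_component_def by blast
    then have "T \<subseteq> L" using LM a by (intro subset_face[of L "insert e F"]) auto
    then show "L = M" using T LM a by (intro face_eqI[of L "insert e F"]) auto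
  qed
  then show ?thesis
    using inj_on_finite[of _ ?S "UNIV :: bool set"] card_inj_on_le[of _ ?S "UNIV :: bool set"] by auto
qed

lemma face_insert_within:
  assumes L: "L \<in> faces (insert e F)"
  obtains K where "K \<in> faces F" "L \<subseteq> K"
  using exists_component_superset[of L "- drawn F"] face_subset_Compl[OF L] connected_face[OF L]
    face_nonempty[OF L] that unfolding faces_def drawn_insert by blast

lemma faces_empty: "faces {} = {- drawn {}}"
proof -
  have "connected (UNIV - p ` V)" using finite_V
    by (intro connected_open_delete_finite) auto
  moreover have "- p ` V \<noteq> {}" using finite_V infinite_UNIV_char_0 by (metis Compl_eq_Diff_UNIV Diff_eq_empty_iff finite_imageI finite_subset)
  ultimately show ?thesis unfolding faces_def drawn_def
    by (simp add: components_eq_sing_iff Compl_eq_Diff_UNIV)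
qed

lemma finite_faces:
  assumes "F \<subseteq> E"
  shows "finite (faces F)"
proof -
  have "finite F" using assms finite_E finite_subset by blast
  then show ?thesis using assms
  proof (induction F rule: finite_induct)
    case empty
    then show ?case by (simp add: faces_empty)
  next
    case (insert e F)
    have "faces (insert e F) \<subseteq> (\<Union>K\<in>faces F. {L \<in> faces (insert e F). L \<subseteq> K})"
    proof
      fix L assume "L \<in> faces (insert e F)"
      moreover from this obtain K where "K \<in> faces F" "L \<subseteq> K" by (rule face_insert_within)
      ultimately show "L \<in> (\<Union>K\<in>faces F. {L \<in> faces (insert e F). L \<subseteq> K})" by blast
    qed
    moreover have "finite (\<Union>K\<in>faces F. {L \<in> faces (insert e F). L \<subseteq> K})"
      using insert card_faces_within by auto
    ultimately show ?case by (rule finite_subset)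
  qed
qed

text \<open>Each edge of a forest is a bridge, so drawing the edges one at a time never separates
  two points.\<close>

lemma forest_one_face:
  assumes "F \<subseteq> E" "\<nexists>vs. graph_cycle F vs"
  shows "connected (- drawn F)"
proof -
  have "finite F" using assms finite_E finite_subset by blast
  then show ?thesis using assms
  proof (induction F rule: finite_induct)
    case empty
    have "- drawn {} \<in> faces {}" by (simp add: faces_empty)
    then show ?case by (rule connected_face)
  next
    case (insert e F)
    have "e \<in> E" using insert.prems by simp
    then obtain x y where e: "e = {x, y}" "x \<noteq> y" "x \<in> V" "y \<in> V" by (rule edgeE)
    have "insert e F - {e} = F" using insert by auto
    then have xy: "(x, y) \<notin> (adjacency F)\<^sup>*"
      using acyclic_edge_is_bridge[OF insert.prems(2), of x y] e by simp
    have "\<not> graph_cycle F vs" for vs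
      using insert.prems(2) graph_cycle_mono[of F vs "insert e F"] by blast
    then have con: "connected (- drawn F)" using insert by auto
    show ?case
      unfolding connected_iff_connected_component
    proof (intro ballI)
      fix a b assume "a \<in> - drawn (insert e F)" "b \<in> - drawn (insert e F)"
      then show "connected_component (- drawn (insert e F)) a b"
        using con insert e xy
        by (intro bridge_not_separating[of F e x y]) (auto simp: connected_iff_connected_component drawn_insert)
    qed
  qed
qed

lemma face_other_edge:
  assumes F: "F \<subseteq> E" "e \<in> E" "e \<notin> F" and K: "K \<in> faces F" "edge_interior e \<subseteq> K"
    and L: "L \<in> faces F" "L \<noteq> K"
  shows "L \<in> faces (insert e F)"
proof -
  have "L \<inter> K = {}" using face_eqI[OF L(1) K(1)] L(2) by blast
  moreover have "path_image (\<gamma> e) \<subseteq> edge_interior e \<union> drawn F"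
    using edge_Int_drawn[OF F] by (auto simp: edge_interior_def)
  ultimately have "L \<subseteq> - drawn (insert e F)"
    using K(2) face_subset_Compl[OF L(1)] unfolding drawn_insert by blast
  moreover have "- drawn (insert e F) \<subseteq> - drawn F" by (auto simp: drawn_insert)
  ultimately show ?thesis using L(1) components_intermediate_subset[of L "- drawn F" "- drawn (insert e F)"]
    unfolding faces_def by simp
qed

text \<open>The open face \<open>K\<close> through which the edge runs meets both sides of a Jordan
  curve, as the edge lies in the closure of both. So \<open>K\<close> is replaced by at least two
  faces, while all other faces persist.\<close>

lemma card_faces_insert:
  assumes F: "F \<subseteq> E" "e \<in> E" "e \<notin> F" and con: "graph_connected V F"
  shows "card (faces F) + 1 \<le> card (faces (insert e F))"
proof -
  obtain K where K: "K \<in> faces F" "edge_interior e \<subseteq> K" using face_of_edge[OF F] .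
  obtain I Q where IQ: "open I" "open Q" "I \<inter> Q = {}" "- drawn (insert e F) \<subseteq> I \<union> Q"
    "edge_interior e \<subseteq> closure I" "edge_interior e \<subseteq> closure Q"
    using ex_two_sides[OF F con] by blast
  obtain m where m: "m \<in> edge_interior e" using edge_interior_nonempty[OF F(2)] by blast
  have G: "insert e F \<subseteq> E" using F by simp
  have nowhere: "\<exists>L\<in>faces (insert e F). L \<subseteq> K \<and> L \<subseteq> S"
    if S: "open S" "edge_interior e \<subseteq> closure S" "open S'" "S \<inter> S' = {}" "- drawn (insert e F) \<subseteq> S \<union> S'"
      "edge_interior e \<subseteq> closure S'" for S S'
  proof -
    have "K \<inter> S \<noteq> {}"
      using open_face[OF F(1) K(1)] m K(2) S(2) open_Int_closure_eq_empty[of K S] by blast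
    then obtain a where a: "a \<in> K" "a \<in> S" by blast
    \<comment> \<open>The open set \<open>S\<close> is disjoint from \<open>S'\<close>, hence from
      its closure, which contains the edge. So \<open>a\<close> lies off the enlarged
      drawing.\<close>
    have "edge_interior e \<inter> S = {}"
      using S open_Int_closure_eq_empty[of S S'] by blast
    then have "a \<notin> drawn (insert e F)"
      using a face_subset_Compl[OF K(1)] edge_Int_drawn[OF F]
      by (auto simp: drawn_insert edge_interior_def)
    then obtain L where L: "L \<in> faces (insert e F)" "a \<in> L"
      unfolding faces_def using Union_components[of "- drawn (insert e F)"] by blast
    have "L \<subseteq> K"
      using a L face_subset_Compl[OF L(1)] connected_face[OF L(1)]
      by (intro subset_face[OF K(1)]) (auto simp: drawn_insert)
    moreover have "L \<subseteq> S"
    proof (rule ccontr)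
      assume "\<not> L \<subseteq> S"
      then have "L \<inter> S' \<noteq> {}" using face_subset_Compl[OF L(1)] S by blast
      then show False
        using connectedD[OF connected_face[OF L(1)] S(1,3)] S face_subset_Compl[OF L(1)] L a by blast
    qed
    ultimately show ?thesis using L by blast
  qed
  obtain L M where LM: "L \<in> faces (insert e F)" "L \<subseteq> K" "L \<subseteq> I" "M \<in> faces (insert e F)" "M \<subseteq> K" "M \<subseteq> Q"
    using nowhere[OF IQ(1,5,2,3,4,6)] nowhere[OF IQ(2,6,1) _ _ IQ(5)] IQ(3,4) by (metis Int_commute Un_commute)
  have ne: "L \<noteq> M" using LM IQ(3) face_nonempty by blast
  have out: "L \<notin> faces F - {K}" "M \<notin> faces F - {K}"
    using LM(2,5) K(1) face_eqI[of L F K] face_eqI[of M F K] face_nonempty[OF LM(1)] face_nonempty[OF LM(4)]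
    by auto
  have "insert L (insert M (faces F - {K})) \<subseteq> faces (insert e F)"
    using LM face_other_edge[OF F K] by blast
  then have "card (insert L (insert M (faces F - {K}))) \<le> card (faces (insert e F))"
    by (intro card_mono finite_faces G)
  moreover have "card (insert L (insert M (faces F - {K}))) = card (faces F - {K}) + 2"
    using ne out finite_faces[OF F(1)] by simp
  moreover have "card (faces F) \<le> card (faces F - {K}) + 1"
    using K(1) finite_faces[OF F(1)] by (simp add: card_Diff_singleton)
  ultimately show ?thesis by linarith
qed

text \<open>\<open>T\<close> alone leaves at least one face because the plane is not compact. Every
  further edge joins vertices that are already connected and therefore adds a face.\<close>

lemma card_faces_ge:
  assumes T: "T \<subseteq> E" "graph_connected V T"
  shows "card E + 1 \<le> card (faces E) + card T"
proof -
  have "finite F \<Longrightarrow> F \<subseteq> E - T \<Longrightarrow> card F + 1 \<le> card (faces (F \<union> T))" for F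
  proof (induction F rule: finite_induct)
    case empty
    have "faces T \<noteq> {}"
    proof
      assume "faces T = {}"
      then have "drawn T = UNIV" by (auto simp: faces_def)
      then show False using compact_drawn[OF T(1)] not_compact_UNIV by metis
    qed
    then show ?case using finite_faces[OF T(1)] by (simp add: Suc_le_eq card_gt_0_iff)
  next
    case (insert e F)
    have "(adjacency T)\<^sup>* \<subseteq> (adjacency (F \<union> T))\<^sup>*"
      by (rule rtrancl_mono) (auto simp: adjacency_def)
    then have "graph_connected V (F \<union> T)" using T(2) by (auto simp: graph_connected_def)
    then have "card (faces (F \<union> T)) + 1 \<le> card (faces (insert e (F \<union> T)))"
      using insert T by (intro card_faces_insert) auto
    then show ?case using insert by auto
  qed
  from this[of "E - T"] have "card (E - T) + 1 \<le> card (faces E)"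
    using finite_E T(1) by (simp add: Un_absorb2)
  moreover have "card (E - T) = card E - card T" "card T \<le> card E"
    using T(1) finite_E by (auto simp: card_Diff_subset finite_subset card_mono)
  ultimately show ?thesis by linarith
qed

section \<open>Faces and their boundary edges\<close>

lemma card_faces_of_edge:
  assumes e: "e \<in> E"
  shows "card {K \<in> faces E. e \<in> face_edges K} \<le> 2"
proof -
  let ?F = "E - {e}"
  have F: "?F \<subseteq> E" "e \<in> E" "e \<notin> ?F" and ins: "insert e ?F = E" using e by auto
  obtain K where K: "K \<in> faces ?F" "edge_interior e \<subseteq> K" using face_of_edge[OF F] .
  have "{L \<in> faces E. e \<in> face_edges L} \<subseteq> {L \<in> faces E. L \<subseteq> K}"
  proof (safe)
    fix L z assume L: "L \<in> faces E" "e \<in> face_edges L" and z: "z \<in> L"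
    then obtain q where "q \<in> closure L" "q \<in> K" using K by (auto simp: face_edges_def frontier_def)
    then have "L \<inter> K \<noteq> {}"
      using open_Int_closure_eq_empty[OF open_face[OF F(1) K(1)], of L] by blast
    then have "L \<subseteq> K"
      using L(1) face_subset_Compl[OF L(1)] connected_face[OF L(1)] drawn_mono[of ?F E]
      by (intro subset_face[OF K(1)]) auto
    then show "z \<in> K" using z by blast
  qed
  moreover have "finite {L \<in> faces E. L \<subseteq> K}" "card {L \<in> faces E. L \<subseteq> K} \<le> 2"
    using card_faces_within[OF F K(1)] unfolding ins by auto
  ultimately show ?thesis by (meson card_mono order_trans)
qed

text \<open>The frontier of \<open>K\<close> is covered by its boundary edges and the vertices.
  Erasing the other edges cannot enlarge \<open>K\<close>, since a larger connected set would meet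
  the frontier.\<close>

lemma face_of_face_edges:
  assumes K: "K \<in> faces E"
  shows "K \<in> faces (face_edges K)"
proof -
  have sub: "face_edges K \<subseteq> E" by (auto simp: face_edges_def)
  have "frontier K \<subseteq> drawn E" using K closed_drawn[of E] unfolding faces_def
    by (intro frontier_of_components_closed_complement) auto
  then have fr: "frontier K \<subseteq> drawn (face_edges K)"
  proof (intro subsetI)
    fix q assume q: "q \<in> frontier K" "frontier K \<subseteq> drawn E"
    show "q \<in> drawn (face_edges K)"
    proof (cases "q \<in> p ` V")
      case False
      then obtain e where e: "e \<in> E" "q \<in> path_image (\<gamma> e)" using q by (auto simp: drawn_def)
      then have "q \<notin> p ` e" using False edge_subset[of e] by blast
      then have "e \<in> face_edges K" using e q by (auto simp: face_edges_def edge_interior_def)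
      then show ?thesis using e by (auto simp: drawn_def)
    qed (auto simp: drawn_def)
  qed
  have K': "K \<subseteq> - drawn (face_edges K)" using face_subset_Compl[OF K] drawn_mono[OF sub] by blast
  have "D = K" if D: "K \<subseteq> D" "D \<subseteq> - drawn (face_edges K)" "connected D" for D
  proof (rule ccontr)
    assume "D \<noteq> K"
    then have "D \<inter> frontier K \<noteq> {}"
      using D face_nonempty[OF K] by (intro connected_Int_frontier) auto
    then show False using fr D by blast
  qed
  then show ?thesis unfolding faces_def in_components_maximal
    using K' face_nonempty[OF K] connected_face[OF K] by auto
qed

text \<open>Otherwise the boundary is a forest with connected complement, and \<open>K\<close> is
  all of that complement. Then nothing else is drawn, and \<open>E\<close> itself is the
  forest.\<close>

lemma face_edges_contains_cycle:
  assumes K: "K \<in> faces E" and cyc: "graph_cycle E us"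
  shows "\<exists>vs. graph_cycle (face_edges K) vs"
proof (rule ccontr)
  assume no: "\<nexists>vs. graph_cycle (face_edges K) vs"
  have sub: "face_edges K \<subseteq> E" by (auto simp: face_edges_def)
  have "K = - drawn (face_edges K)"
    using face_of_face_edges[OF K] forest_one_face[OF sub no]
    unfolding faces_def connected_eq_components_subset_sing by auto
  then have "drawn E \<subseteq> drawn (face_edges K)" using face_subset_Compl[OF K] by blast
  then have "E \<subseteq> face_edges K" using drawn_subset_imp_subset[of E "face_edges K"] sub by simp
  then have "graph_cycle (face_edges K) us" using cyc by (rule graph_cycle_mono[rotated])
  then show False using no by blast
qed

end

section \<open>Spanning trees, Euler's formula and facial triangles\<close>

text \<open>\<open>f\<close> makes one step of a shortest path to \<open>r\<close>, and
  \<open>h\<close> is the distance. A decreasing rank is the form in which acyclicity reaches the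
  determinants.\<close>

lemma connected_parent_function:
  assumes con: "graph_connected V E" and r: "r \<in> V"
  shows "\<exists>f (h :: 'a \<Rightarrow> nat). f r = r \<and> (\<forall>v\<in>V - {r}. {v, f v} \<in> E \<and> h (f v) < h v)"
proof -
  let ?A = "adjacency E"
  define h where "h v = (LEAST k. (v, r) \<in> ?A ^^ k)" for v
  have "\<exists>w. {v, w} \<in> E \<and> h w < h v" if v: "v \<in> V - {r}" for v
  proof -
    have "(v, r) \<in> ?A\<^sup>*" using con v r by (auto simp: graph_connected_def)
    then obtain k where "(v, r) \<in> ?A ^^ k" using rtrancl_power by blast
    then have hv: "(v, r) \<in> ?A ^^ h v" unfolding h_def by (rule LeastI)
    obtain k where k: "h v = Suc k"
    proof (cases "h v")
      case 0
      then show ?thesis using hv v by simp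
    qed (use that in blast)
    then have "(v, r) \<in> ?A O ?A ^^ k" using hv by (simp add: relpow_commute)
    then obtain w where w: "(v, w) \<in> ?A" "(w, r) \<in> ?A ^^ k" by blast
    have "h w \<le> k" unfolding h_def by (rule Least_le) (rule w)
    then show ?thesis using w k by (auto simp: adjacency_def)
  qed
  then obtain g where g: "\<And>v. v \<in> V - {r} \<Longrightarrow> {v, g v} \<in> E \<and> h (g v) < h v" by metis
  show ?thesis by (rule exI[of _ "g(r := r)"], rule exI[of _ h]) (use g in auto)
qed

lemma parent_function_connected:
  fixes h :: "'a \<Rightarrow> nat"
  assumes r: "r \<in> V" and f: "\<And>v. v \<in> V - {r} \<Longrightarrow> f v \<in> V \<and> h (f v) < h v"
  shows "graph_connected V ((\<lambda>v. {v, f v}) ` (V - {r}))"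
proof -
  let ?A = "adjacency ((\<lambda>v. {v, f v}) ` (V - {r}))"
  have root: "(v, r) \<in> ?A\<^sup>*" if "v \<in> V" for v
    using that
  proof (induction "h v" arbitrary: v rule: less_induct)
    case less
    show ?case
    proof (cases "v = r")
      case False
      then have "(v, f v) \<in> ?A" using less.prems by (auto simp: adjacency_def)
      moreover have "(f v, r) \<in> ?A\<^sup>*" using less f[of v] False by blast
      ultimately show ?thesis by (rule converse_rtrancl_into_rtrancl)
    qed simp
  qed
  have "(u, v) \<in> ?A\<^sup>*" if "u \<in> V" "v \<in> V" for u v
  proof -
    have "(r, v) \<in> ?A\<^sup>*" using root[OF that(2)] by (rule symD[OF sym_rtrancl[OF adjacency_sym]])
    with root[OF that(1)] show ?thesis by (rule rtrancl_trans)
  qed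
  then show ?thesis using r by (auto simp: graph_connected_def)
qed

text \<open>The parent edges already connect all vertices, so any further edge of \<open>T\<close>
  would close a cycle. A spanning tree is thereby encoded as a function.\<close>

lemma tree_parent_function:
  assumes T: "graph_tree V T" and edges: "\<And>e. e \<in> T \<Longrightarrow> e \<subseteq> V \<and> card e = 2" and r: "r \<in> V"
  shows "\<exists>f (h :: 'a \<Rightarrow> nat). f r = r \<and> (\<forall>v\<in>V - {r}. {v, f v} \<in> T \<and> h (f v) < h v) \<and>
    T = (\<lambda>v. {v, f v}) ` (V - {r})"
proof -
  obtain f and h :: "'a \<Rightarrow> nat" where f: "f r = r" "\<And>v. v \<in> V - {r} \<Longrightarrow> {v, f v} \<in> T \<and> h (f v) < h v"
    using connected_parent_function[of V T r] T r by (auto simp: graph_tree_def)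
  let ?T = "(\<lambda>v. {v, f v}) ` (V - {r})"
  have con: "graph_connected V ?T"
    using f edges by (intro parent_function_connected[OF r, of f h]) blast
  have sub: "?T \<subseteq> T" using f by blast
  have "e \<in> ?T" if e: "e \<in> T" for e
  proof (rule ccontr)
    assume "e \<notin> ?T"
    then have sub': "?T \<subseteq> T - {e}" using sub by blast
    obtain x y where xy: "e = {x, y}" "x \<noteq> y" "x \<in> V" "y \<in> V"
      using edges[OF e] by (auto simp: card_2_iff)
    have "(adjacency ?T)\<^sup>* \<subseteq> (adjacency (T - {e}))\<^sup>*"
      using sub' by (intro rtrancl_mono) (auto simp: adjacency_def)
    then have "(x, y) \<in> (adjacency (T - {{x, y}}))\<^sup>*" using con xy by (auto simp: graph_connected_def)
    then show False using acyclic_edge_is_bridge[of T x y] T xy e by (auto simp: graph_tree_def)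
  qed
  then have "T = ?T" using sub by blast
  then show ?thesis using f by blast
qed

lemma card_cycle_le:
  assumes "graph_cycle E vs" "finite E"
  shows "length vs \<le> card E"
proof -
  have "(\<lambda>i. {vs ! i, vs ! (Suc i mod length vs)}) ` {..<length vs} \<subseteq> E"
    using assms(1) by (auto simp: graph_cycle_def)
  then show ?thesis using card_graph_cycle_edges[OF assms(1)] card_mono[OF assms(2)] by metis
qed

context plane_graph
begin

lemma finite_face_edges: "finite (face_edges K)"
  using finite_E by (simp add: face_edges_def)

text \<open>The parent edges form a connected spanning subgraph with at most
  \<open>card V - 1\<close> edges, to which \<open>card_faces_ge\<close> applies. Counting the faces
  from below is the direction that bounds the number of edges.\<close>

lemma Euler_inequality:
  assumes con: "graph_connected V E"
  shows "card E + 2 \<le> card (faces E) + card V"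
proof -
  obtain r where r: "r \<in> V" using con by (auto simp: graph_connected_def)
  obtain f and h :: "'a \<Rightarrow> nat" where f: "f r = r" "\<And>v. v \<in> V - {r} \<Longrightarrow> {v, f v} \<in> E \<and> h (f v) < h v"
    using connected_parent_function[OF con r] by blast
  let ?T = "(\<lambda>v. {v, f v}) ` (V - {r})"
  have "graph_connected V ?T"
    using f edge_subset by (intro parent_function_connected[OF r, of f h]) blast
  then have "card E + 1 \<le> card (faces E) + card ?T"
    using f by (intro card_faces_ge) auto
  moreover have "card ?T \<le> card (V - {r})" using finite_V by (intro card_image_le) auto
  moreover have "card (V - {r}) + 1 = card V" using r finite_V by (simp add: card_Diff_singleton Suc_le_eq card_gt_0_iff)
    (metis Suc_pred card_gt_0_iff empty_iff)
  ultimately show ?thesis by linarith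
qed

lemma sum_card_face_edges: "(\<Sum>K\<in>faces E. card (face_edges K)) \<le> 2 * card E"
proof -
  have "(\<Sum>K\<in>faces E. card (face_edges K)) = (\<Sum>K\<in>faces E. \<Sum>e\<in>E. if e \<in> face_edges K then 1 else 0)"
    using finite_E by (intro sum.cong refl) (simp add: sum.If_cases face_edges_def Int_def)
  also have "\<dots> = (\<Sum>e\<in>E. \<Sum>K\<in>faces E. if e \<in> face_edges K then 1 else 0)"
    by (rule sum.swap)
  also have "\<dots> = (\<Sum>e\<in>E. card {K \<in> faces E. e \<in> face_edges K})"
    using finite_faces[of E] by (intro sum.cong refl) (simp add: sum.If_cases Int_def)
  also have "\<dots> \<le> (\<Sum>e\<in>E. 2)" by (intro sum_mono card_faces_of_edge)
  finally show ?thesis by simp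
qed

lemma card_face_edges_ge:
  assumes "K \<in> faces E" "graph_cycle E us" and g: "\<And>vs. graph_cycle E vs \<Longrightarrow> g \<le> length vs"
  shows "g \<le> card (face_edges K)"
proof -
  obtain vs where vs: "graph_cycle (face_edges K) vs"
    using face_edges_contains_cycle[OF assms(1,2)] by blast
  have "graph_cycle E vs" using graph_cycle_mono[OF vs] by (auto simp: face_edges_def)
  then show ?thesis using g card_cycle_le[OF vs finite_face_edges] le_trans by blast
qed

lemma acyclic_card_edges:
  assumes con: "graph_connected V E" and no: "\<nexists>vs. graph_cycle E vs"
  shows "card E < card V"
proof -
  obtain r where r: "r \<in> V" using con by (auto simp: graph_connected_def)
  have "graph_tree V E" using con no by (simp add: graph_tree_def)
  then obtain f where "E = (\<lambda>v. {v, f v}) ` (V - {r})"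
    using tree_parent_function[of V E r] edge_subset card_edge r by blast
  then have "card E \<le> card (V - {r})" using finite_V by (auto intro: card_image_le)
  also have "\<dots> < card V" using r finite_V by (intro psubset_card_mono) auto
  finally show ?thesis .
qed

text \<open>Once there is a cycle, each face has at least \<open>g\<close> boundary edges while each
  edge bounds at most two faces. A forest, whose single face may have a short boundary, is the first
  alternative.\<close>

lemma girth_edge_bound:
  assumes con: "graph_connected V E" and g: "\<And>vs. graph_cycle E vs \<Longrightarrow> g \<le> length vs"
  shows "card E < card V \<or> g * (card E + 2) \<le> 2 * card E + g * card V"
proof (cases "\<exists>us. graph_cycle E us")
  case True
  then obtain us where us: "graph_cycle E us" by blast
  have "g * card (faces E) = (\<Sum>K\<in>faces E. g)" by simp
  also have "\<dots> \<le> (\<Sum>K\<in>faces E. card (face_edges K))"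
    by (intro sum_mono card_face_edges_ge[OF _ us g])
  also have "\<dots> \<le> 2 * card E" by (rule sum_card_face_edges)
  finally have "g * card (faces E) \<le> 2 * card E" .
  moreover have "g * (card E + 2) \<le> g * (card (faces E) + card V)"
    using Euler_inequality[OF con] by (intro mult_left_mono) auto
  ultimately show ?thesis by (simp add: algebra_simps)
next
  case False
  then show ?thesis using acyclic_card_edges[OF con] by blast
qed

lemma triangular_face:
  assumes K: "K \<in> faces E" "card (face_edges K) = 3" and cyc: "graph_cycle E us"
  shows "\<exists>t. card t = 3 \<and> face_edges K = {e. e \<subseteq> t \<and> card e = 2}"
proof -
  obtain vs where vs: "graph_cycle (face_edges K) vs"
    using face_edges_contains_cycle[OF K(1) cyc] by blast
  have len: "length vs = 3"
    using card_cycle_le[OF vs finite_face_edges] K(2) vs by (simp add: graph_cycle_def)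
  have d: "distinct vs" using vs by (simp add: graph_cycle_def)
  have card: "card (set vs) = 3" using d len by (simp add: distinct_card)
  have sub: "{e. e \<subseteq> set vs \<and> card e = 2} \<subseteq> face_edges K"
  proof safe
    fix e assume e: "e \<subseteq> set vs" "card e = 2"
    then obtain x y where xy: "e = {x, y}" "x \<noteq> y" "x \<in> set vs" "y \<in> set vs" by (auto simp: card_2_iff)
    then obtain i j where ij: "e = {vs ! i, vs ! j}" "i < 3" "j < 3" "i \<noteq> j"
      using len by (metis in_set_conv_nth)
    have "i = 0 \<or> i = 1 \<or> i = 2" "j = 0 \<or> j = 1 \<or> j = 2" using ij(2,3) by linarith+
    then have "j = Suc i mod 3 \<or> i = Suc j mod 3" using ij(4) by auto
    moreover have "{vs ! k, vs ! (Suc k mod 3)} \<in> face_edges K" if "k < 3" for k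
      using vs that unfolding graph_cycle_def len by blast
    ultimately show "e \<in> face_edges K"
      using ij by (metis insert_commute)
  qed
  have "card {e. e \<subseteq> set vs \<and> card e = 2} = 3"
    using n_subsets[of "set vs" 2] card by (simp add: numeral_eq_Suc)
  then have "face_edges K = {e. e \<subseteq> set vs \<and> card e = 2}"
    using card_subset_eq[OF finite_face_edges sub] K(2) by simp
  then show ?thesis using card by blast
qed

text \<open>The triangle alone has at most two faces, as it arises from a forest by one edge. So
  \<open>K\<close> and \<open>L\<close> are all of them and fill its complement, which leaves no
  room for another edge.\<close>

lemma face_determined_by_edges:
  assumes KL: "K \<in> faces E" "L \<in> faces E" "K \<noteq> L" "face_edges K = face_edges L"
    and 3: "card (face_edges K) = 3"
  shows "E = face_edges K"
proof -
  let ?D = "face_edges K"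
  have D: "?D \<subseteq> E" by (auto simp: face_edges_def)
  obtain e where e: "e \<in> ?D" using 3 by fastforce
  let ?F = "?D - {e}"
  have F: "?F \<subseteq> E" "e \<in> E" "e \<notin> ?F" "insert e ?F = ?D" using D e by auto
  have "\<not> graph_cycle ?F vs" for vs
  proof
    assume c: "graph_cycle ?F vs"
    have "card ?F = 2" using 3 e finite_face_edges by simp
    then show False using card_cycle_le[OF c] finite_face_edges c by (auto simp: graph_cycle_def)
  qed
  then have "connected (- drawn ?F)" by (intro forest_one_face F) auto
  moreover have "- drawn ?F \<noteq> {}"
    using face_subset_Compl[OF KL(1)] face_nonempty[OF KL(1)] drawn_mono[of ?F E] F by blast
  ultimately have "- drawn ?F \<in> faces ?F"
    by (simp add: faces_def components_eq_sing_iff[THEN iffD2])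
  from card_faces_within[OF F(1-3) this]
  have "finite {M \<in> faces ?D. M \<subseteq> - drawn ?F} \<and> card {M \<in> faces ?D. M \<subseteq> - drawn ?F} \<le> 2"
    unfolding F(4) .
  moreover have "{M \<in> faces ?D. M \<subseteq> - drawn ?F} = faces ?D"
    using face_subset_Compl[of _ ?D] drawn_mono[of ?F ?D] by blast
  ultimately have fin: "finite (faces ?D)" "card (faces ?D) \<le> 2" by simp_all
  moreover have "{K, L} \<subseteq> faces ?D"
    using face_of_face_edges[OF KL(1)] face_of_face_edges[OF KL(2)] KL(4) by simp
  ultimately have "{K, L} = faces ?D"
    using KL(3) by (intro card_seteq) auto
  then have "\<Union> (components (- drawn ?D)) = \<Union> {K, L}" by (simp add: faces_def)
  then have "K \<union> L = - drawn ?D" by simp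
  then have "drawn E \<subseteq> drawn ?D"
    using face_subset_Compl[OF KL(1)] face_subset_Compl[OF KL(2)] by blast
  then show ?thesis using drawn_subset_imp_subset[of E ?D] D by auto
qed

text \<open>Faces other than triangles have at least four boundary edges, so four times the number
  of faces is at most \<open>2 * card E\<close> plus the number of triangular faces; Euler's
  inequality does the rest. Triangular faces have different vertex sets unless the graph has just
  three edges. That case and forests satisfy the count with no triangles at all.\<close>

lemma ex_facial_triangles:
  assumes con: "graph_connected V E"
  shows "\<exists>TT. finite TT \<and> (\<forall>t\<in>TT. card t = 3 \<and> (\<forall>e. e \<subseteq> t \<and> card e = 2 \<longrightarrow> e \<in> E)) \<and>
    (\<forall>e\<in>E. card {t \<in> TT. e \<subseteq> t} \<le> 2) \<and> 2 * card E \<le> card TT + 4 * card V"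
proof (cases "(\<exists>us. graph_cycle E us) \<and> card E \<noteq> 3")
  case False
  have "2 * card E \<le> 4 * card V"
  proof (cases "\<exists>us. graph_cycle E us")
    case True
    with False have "card E = 3" by blast
    then obtain e where e: "e \<in> E" by fastforce
    then have "2 \<le> card V" using card_mono[OF finite_V edge_subset[OF e]] card_edge[OF e] by simp
    with \<open>card E = 3\<close> show ?thesis by simp
  next
    case False
    then show ?thesis using acyclic_card_edges[OF con] by simp
  qed
  then show ?thesis by (intro exI[of _ "{}"]) simp
next
  case True
  then obtain us where us: "graph_cycle E us" by blast
  define A where "A = {K \<in> faces E. card (face_edges K) = 3}"
  have finA: "finite A" using finite_faces[of E] by (simp add: A_def)
  obtain t where t: "\<And>K. K \<in> A \<Longrightarrow> card (t K) = 3 \<and> face_edges K = {e. e \<subseteq> t K \<and> card e = 2}"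
    using triangular_face[OF _ _ us] unfolding A_def mem_Collect_eq by metis
  have inj: "inj_on t A"
  proof (rule inj_onI, rule ccontr)
    fix K L assume KL: "K \<in> A" "L \<in> A" "t K = t L" "K \<noteq> L"
    then have "face_edges K = face_edges L" using t by simp
    then have "E = face_edges K" using KL by (intro face_determined_by_edges) (auto simp: A_def)
    then show False using KL(1) True by (simp add: A_def)
  qed
  have "4 * card (faces E) \<le> (\<Sum>K\<in>faces E. card (face_edges K) + (if K \<in> A then 1 else 0))"
  proof -
    have "4 \<le> card (face_edges K) + (if K \<in> A then 1 else 0)" if "K \<in> faces E" for K
      using card_face_edges_ge[OF that us, of 3] that by (auto simp: A_def graph_cycle_def)
    then have "(\<Sum>K\<in>faces E. 4) \<le> (\<Sum>K\<in>faces E. card (face_edges K) + (if K \<in> A then 1 else 0))"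
      by (intro sum_mono)
    then show ?thesis by simp
  qed
  also have "\<dots> = (\<Sum>K\<in>faces E. card (face_edges K)) + card A"
    using finite_faces[of E] by (simp add: sum.distrib sum.If_cases A_def Int_def)
  also have "\<dots> \<le> 2 * card E + card A" using sum_card_face_edges by simp
  finally have "2 * card E \<le> card A + 4 * card V" using Euler_inequality[OF con] by linarith
  then have count: "2 * card E \<le> card (t ` A) + 4 * card V" by (simp add: card_image[OF inj])
  have two: "card {s \<in> t ` A. e \<subseteq> s} \<le> 2" if e: "e \<in> E" for e
  proof -
    have "{s \<in> t ` A. e \<subseteq> s} \<subseteq> t ` {K \<in> faces E. e \<in> face_edges K}"
      using t card_edge[OF e] by (auto simp: A_def)
    then have "card {s \<in> t ` A. e \<subseteq> s} \<le> card (t ` {K \<in> faces E. e \<in> face_edges K})"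
      using finite_faces[of E] by (intro card_mono) auto
    also have "\<dots> \<le> card {K \<in> faces E. e \<in> face_edges K}"
      using finite_faces[of E] by (intro card_image_le) auto
    also have "\<dots> \<le> 2" by (rule card_faces_of_edge[OF e])
    finally show ?thesis .
  qed
  show ?thesis
  proof (intro exI[of _ "t ` A"] conjI ballI)
    fix s assume "s \<in> t ` A"
    then obtain K where K: "K \<in> A" "s = t K" by blast
    then show "card s = 3" using t by simp
    show "\<forall>e. e \<subseteq> s \<and> card e = 2 \<longrightarrow> e \<in> E"
      using t[OF K(1)] K(2) by (auto simp: face_edges_def)
  qed (use finA count two in auto)
qed

end

section \<open>Spanning trees, determinants and the random walk spectrum\<close>

text \<open>The Laplacian of the functional digraph of \<open>f\<close>, grounded at its fixed
  points: a fixed point gets a unit row and so acts as a root.\<close>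

definition function_laplacian :: "nat \<Rightarrow> (nat \<Rightarrow> nat) \<Rightarrow> real mat" where
  "function_laplacian n f =
     mat n n (\<lambda>(i, k). (if k = i then 1 else 0) - (if f i \<noteq> i \<and> k = f i then 1 else 0))"

lemma function_laplacian_carrier [simp]: "function_laplacian n f \<in> carrier_mat n n"
  by (simp add: function_laplacian_def)

text \<open>Only the identity contributes to the Leibniz sum. At a moved index of least rank a
  nonzero factor forces \<open>p i = f i\<close>; this has smaller rank and is therefore fixed by
  \<open>p\<close>, against injectivity.\<close>

lemma det_function_laplacian_acyclic:
  fixes h :: "nat \<Rightarrow> nat"
  assumes h: "\<And>i. i < n \<Longrightarrow> f i \<noteq> i \<Longrightarrow> h (f i) < h i"
  shows "det (function_laplacian n f) = 1"
proof -
  let ?A = "function_laplacian n f"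
  have zero: "(\<Prod>i = 0..<n. ?A $$ (i, p i)) = 0" if p: "p permutes {0..<n}" "p \<noteq> id" for p
  proof -
    have "\<exists>i. i < n \<and> p i \<noteq> i" using p by (metis atLeastLessThan_iff eq_id_iff permutes_not_in zero_le)
    then obtain i where i: "i < n" "p i \<noteq> i" and min: "\<And>j. j < n \<Longrightarrow> p j \<noteq> j \<Longrightarrow> h i \<le> h j"
      using ex_has_least_nat[of "\<lambda>i. i < n \<and> p i \<noteq> i" _ h] by blast
    have pi: "p i < n" using p i permutes_in_image[of p "{0..<n}" i] by simp
    have "?A $$ (i, p i) = 0"
    proof (rule ccontr)
      assume "?A $$ (i, p i) \<noteq> 0"
      then have fi: "f i \<noteq> i" "p i = f i"
        using i pi by (auto simp: function_laplacian_def split: if_splits)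
      then have "p (p i) = p i" using min[of "p i"] h[OF i(1)] pi by force
      then show False using i p(1) permutes_inj[of p] by (metis injD)
    qed
    then show ?thesis using i by (intro prod_zero) auto
  qed
  have "det ?A = (\<Sum>p\<in>{p. p permutes {0..<n}}. signof p * (\<Prod>i = 0..<n. ?A $$ (i, p i)))"
    by (rule det_def') simp
  also have "\<dots> = (\<Sum>p\<in>{id}. signof p * (\<Prod>i = 0..<n. ?A $$ (i, p i)))"
    using zero by (intro sum.mono_neutral_right) (auto simp: finite_permutations permutes_id)
  also have "\<dots> = 1" by (auto simp: function_laplacian_def intro!: prod.neutral)
  finally show ?thesis .
qed

text \<open>The determinant is 0 or 1. If some index never reaches a fixed point, the indicator of
  the set \<open>B\<close> of all such indices lies in the kernel; otherwise the number of steps to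
  a fixed point is a rank as in the acyclic case.\<close>

lemma det_function_laplacian_nonneg:
  assumes f: "\<And>i. i < n \<Longrightarrow> f i < n"
  shows "det (function_laplacian n f) \<ge> 0"
proof -
  let ?A = "function_laplacian n f"
  define B where "B = {i. i < n \<and> (\<forall>k. f ((f ^^ k) i) \<noteq> (f ^^ k) i)}"
  show ?thesis
  proof (cases "B = {}")
    case True
    define h where "h i = (LEAST k. f ((f ^^ k) i) = (f ^^ k) i)" for i
    have "h (f i) < h i" if i: "i < n" "f i \<noteq> i" for i
    proof -
      have "\<exists>k. f ((f ^^ k) i) = (f ^^ k) i" using True i by (auto simp: B_def)
      then have hi: "f ((f ^^ h i) i) = (f ^^ h i) i" unfolding h_def by (rule LeastI_ex)
      obtain k where k: "h i = Suc k" using hi i by (cases "h i") auto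
      have "f ((f ^^ k) (f i)) = (f ^^ k) (f i)" using hi unfolding k by (simp add: funpow_swap1)
      then have "h (f i) \<le> k" unfolding h_def by (rule Least_le)
      then show ?thesis using k by simp
    qed
    then show ?thesis using det_function_laplacian_acyclic[of n f h] by simp
  next
    case False
    define v where "v = vec n (\<lambda>i. if i \<in> B then 1 else (0::real))"
    obtain b where b: "b \<in> B" using False by blast
    have inv: "i \<in> B \<longleftrightarrow> f i \<in> B" if "i < n" "f i \<noteq> i" for i
    proof -
      have "(\<forall>k. f ((f ^^ k) i) \<noteq> (f ^^ k) i) \<longleftrightarrow> (\<forall>k. f ((f ^^ k) (f i)) \<noteq> (f ^^ k) (f i))"
      proof
        assume *: "\<forall>k. f ((f ^^ k) i) \<noteq> (f ^^ k) i"
        show "\<forall>k. f ((f ^^ k) (f i)) \<noteq> (f ^^ k) (f i)"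
          using *[rule_format, of "Suc _"] by (simp add: funpow_swap1)
      next
        assume *: "\<forall>k. f ((f ^^ k) (f i)) \<noteq> (f ^^ k) (f i)"
        show "\<forall>k. f ((f ^^ k) i) \<noteq> (f ^^ k) i"
        proof
          fix k show "f ((f ^^ k) i) \<noteq> (f ^^ k) i"
            using *[rule_format, of "k - 1"] that(2) by (cases k) (auto simp: funpow_swap1)
        qed
      qed
      then show ?thesis using that(1) f by (auto simp: B_def)
    qed
    have fixed: "i \<notin> B" if "f i = i" for i using that by (auto simp: B_def intro!: exI[of _ 0])
    have "?A *\<^sub>v v = 0\<^sub>v n"
    proof (rule eq_vecI)
      fix i assume "i < dim_vec (0\<^sub>v n)"
      then have i: "i < n" by simp
      have "(?A *\<^sub>v v) $ i = (\<Sum>k = 0..<n. ?A $$ (i, k) * v $ k)"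
        using i by (simp add: mult_mat_vec_def scalar_prod_def function_laplacian_def v_def)
      also have "\<dots> = (\<Sum>k = 0..<n. (if k = i then v $ k else 0) - (if k = f i then (if f i \<noteq> i then v $ k else 0) else 0))"
        using i by (intro sum.cong refl) (auto simp: function_laplacian_def)
      also have "\<dots> = v $ i - (if f i \<noteq> i then v $ f i else 0)"
        using i f[OF i] by (simp add: sum_subtractf)
      also have "\<dots> = 0" using i f[OF i] inv[OF i] fixed by (auto simp: v_def)
      finally show "(?A *\<^sub>v v) $ i = 0\<^sub>v n $ i" using i by simp
    qed (simp add: function_laplacian_def)
    moreover have "v \<in> carrier_vec n" by (simp add: v_def)
    moreover have "v \<noteq> 0\<^sub>v n"
    proof
      assume "v = 0\<^sub>v n"
      then have "v $ b = 0" using b by (simp add: B_def)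
      then show False using b by (simp add: v_def B_def)
    qed
    ultimately have "det ?A = 0"
      using det_0_iff_vec_prod_zero[OF function_laplacian_carrier] by blast
    then show ?thesis by simp
  qed
qed

section \<open>Traces of matrix powers\<close>

definition mat_trace :: "'b::comm_ring_1 mat \<Rightarrow> 'b" where
  "mat_trace A = (\<Sum>i = 0..<dim_row A. A $$ (i, i))"

lemma mat_trace_mult_commute:
  assumes "A \<in> carrier_mat n n" "B \<in> carrier_mat n n"
  shows "mat_trace (A * B) = mat_trace (B * A)"
proof -
  have "mat_trace (A * B) = (\<Sum>i = 0..<n. \<Sum>j = 0..<n. A $$ (i, j) * B $$ (j, i))"
    using assms by (auto simp: mat_trace_def scalar_prod_def intro!: sum.cong)
  also have "\<dots> = (\<Sum>j = 0..<n. \<Sum>i = 0..<n. B $$ (j, i) * A $$ (i, j))"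
    by (subst sum.swap) (simp add: mult.commute)
  also have "\<dots> = mat_trace (B * A)"
    using assms by (auto simp: mat_trace_def scalar_prod_def intro!: sum.cong)
  finally show ?thesis .
qed

lemma upper_triangular_mult:
  fixes A :: "'b::comm_ring_1 mat"
  assumes A: "A \<in> carrier_mat n n" "upper_triangular A" and B: "B \<in> carrier_mat n n" "upper_triangular B"
  shows "upper_triangular (A * B)" and "i < n \<Longrightarrow> (A * B) $$ (i, i) = A $$ (i, i) * B $$ (i, i)"
proof -
  have summand: "A $$ (i, k) * B $$ (k, j) = (if k = i \<and> i = j then A $$ (i, i) * B $$ (i, i) else 0)"
    if "i < n" "j \<le> i" "k < n" for i j k
  proof (cases "k < i")
    case True
    then show ?thesis using that A upper_triangularD[OF A(2), of k i] by auto
  next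
    case False
    then show ?thesis using that B upper_triangularD[OF B(2), of j k] by auto
  qed
  have entry: "(A * B) $$ (i, j) = (if i = j then A $$ (i, i) * B $$ (i, i) else 0)" if ij: "i < n" "j \<le> i" for i j
  proof -
    have "(A * B) $$ (i, j) = (\<Sum>k = 0..<n. A $$ (i, k) * B $$ (k, j))"
      using ij A B by (simp add: scalar_prod_def)
    also have "\<dots> = (\<Sum>k = 0..<n. if k = i \<and> i = j then A $$ (i, i) * B $$ (i, i) else 0)"
      using ij by (intro sum.cong refl summand) auto
    finally show ?thesis using ij by simp
  qed
  show "upper_triangular (A * B)"
    using entry A by (intro upper_triangularI) auto
  show "i < n \<Longrightarrow> (A * B) $$ (i, i) = A $$ (i, i) * B $$ (i, i)" using entry by simp
qed

lemma upper_triangular_pow: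
  fixes A :: "'b::comm_ring_1 mat"
  assumes A: "A \<in> carrier_mat n n" "upper_triangular A"
  shows "upper_triangular (A ^\<^sub>m k) \<and> (\<forall>i<n. (A ^\<^sub>m k) $$ (i, i) = (A $$ (i, i)) ^ k)"
proof (induction k)
  case 0
  then show ?case using A by simp
next
  case (Suc k)
  have "A ^\<^sub>m k \<in> carrier_mat n n" using A by simp
  then show ?case using Suc upper_triangular_mult[OF _ _ A, of "A ^\<^sub>m k"] by (auto simp: mult.commute)
qed

text \<open>By Schur triangularisation: the trace is invariant under similarity, and the diagonal of
  a power of a triangular matrix consists of powers.\<close>

lemma mat_trace_pow:
  fixes A :: "complex mat"
  assumes A: "A \<in> carrier_mat n n" and as: "char_poly A = (\<Prod>a\<leftarrow>as. [:- a, 1:])"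
  shows "mat_trace (A ^\<^sub>m k) = (\<Sum>a\<leftarrow>as. a ^ k)"
proof -
  obtain B P Q where dec: "schur_decomposition A as = (B, P, Q)" by (cases "schur_decomposition A as")
  have sim: "similar_mat_wit A B P Q" and ut: "upper_triangular B" and diag: "diag_mat B = as"
    using schur_decomposition[OF A as dec] by auto
  note w = similar_mat_witD2[OF A sim]
  note wk = similar_mat_witD2[OF pow_carrier_mat[OF A] similar_mat_wit_pow[OF sim, of k]]
  have "mat_trace (A ^\<^sub>m k) = mat_trace (Q * (P * B ^\<^sub>m k))"
    unfolding wk(3) using wk by (intro mat_trace_mult_commute[of _ n]) auto
  also have "Q * (P * B ^\<^sub>m k) = (Q * P) * B ^\<^sub>m k"
    using wk by (intro assoc_mult_mat[symmetric]) auto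
  also have "\<dots> = B ^\<^sub>m k" unfolding wk(2) by (rule left_mult_one_mat[OF wk(5)])
  finally have "mat_trace (A ^\<^sub>m k) = (\<Sum>i = 0..<n. (B $$ (i, i)) ^ k)"
    using upper_triangular_pow[OF w(5) ut, of k] w(5) by (simp add: mat_trace_def)
  also have "\<dots> = (\<Sum>a\<leftarrow>diag_mat B. a ^ k)"
    using w(5) by (simp add: diag_mat_def interv_sum_list_conv_sum_set_nat comp_def)
  finally show ?thesis by (simp add: diag)
qed

section \<open>The shifted Laplacian as a sum over functions\<close>

locale indexed_graph =
  fixes n :: nat and adj :: "nat \<Rightarrow> nat \<Rightarrow> bool"
  assumes adj_sym: "adj i j \<Longrightarrow> adj j i" and adj_irrefl: "\<not> adj i i"
    and adj_bound: "adj i j \<Longrightarrow> i < n" and no_isolated: "i < n \<Longrightarrow> \<exists>j. adj i j"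
begin

definition nbr :: "nat \<Rightarrow> nat set" where "nbr i = {j. adj i j}"

definition deg :: "nat \<Rightarrow> nat" where "deg i = card (nbr i)"

lemma nbr_subset: "nbr i \<subseteq> {0..<n}"
  using adj_bound[OF adj_sym] by (auto simp: nbr_def)

lemma finite_nbr [simp]: "finite (nbr i)"
  using nbr_subset finite_subset by blast

lemma deg_pos: "i < n \<Longrightarrow> deg i \<ge> 1"
  using no_isolated[of i] by (simp add: deg_def Suc_le_eq card_gt_0_iff) (auto simp: nbr_def)

definition shifted_laplacian :: "real \<Rightarrow> real mat" where
  "shifted_laplacian R = mat n n (\<lambda>(i, j). if i = j then R * deg i else if adj i j then -1 else 0)"

text \<open>
  Row \<open>i\<close> is the sum of \<open>\<epsilon> deg i\<close> times a unit vector and of one row of a function Laplacian for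
  each neighbour, so expanding all rows turns the determinant into a sum over functions; the ones
  without cycles (other than fixed points, which act as roots) are rooted forests.
\<close>

lemma det_shifted_laplacian_ge:
  fixes \<epsilon> :: real
  assumes e: "\<epsilon> \<ge> 0" and r: "r < n" and T: "T \<subseteq> PiE {0..<n} (\<lambda>i. insert i (nbr i))"
    and roots: "\<And>f i. f \<in> T \<Longrightarrow> i < n \<Longrightarrow> f i = i \<longleftrightarrow> i = r"
    and acyc: "\<And>f. f \<in> T \<Longrightarrow> \<exists>h :: nat \<Rightarrow> nat. \<forall>i<n. f i \<noteq> i \<longrightarrow> h (f i) < h i"
  shows "\<epsilon> * card T \<le> det (shifted_laplacian (1 + \<epsilon>))"
proof -
  let ?J = "\<lambda>i. insert i (nbr i)"
  let ?M = "shifted_laplacian (1 + \<epsilon>)"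
  define c where "c i j = (if j = i then \<epsilon> * deg i else 1)" for i j
  define row where "row i j k = (if k = i then 1 else 0) - (if j \<noteq> i \<and> k = j then 1 else (0::real))" for i j k :: nat
  have entry: "?M $$ (i, k) = (\<Sum>j\<in>?J i. c i j * row i j k)" if ik: "i < n" "k < n" for i k
  proof -
    have i: "i \<notin> nbr i" using adj_irrefl by (simp add: nbr_def)
    have "(\<Sum>j\<in>nbr i. c i j * row i j k) = (\<Sum>j\<in>nbr i. (if k = i then 1 else 0) - (if j = k then 1 else 0))"
      using i by (intro sum.cong refl) (auto simp: c_def row_def)
    also have "\<dots> = (if k = i then real (deg i) else 0) - (if adj i k then 1 else 0)"
    proof -
      have "(\<Sum>j\<in>nbr i. if j = k then 1 else (0::real)) = (if k \<in> nbr i then 1 else 0)"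
        by (simp add: sum.delta)
      moreover have "(\<Sum>j\<in>nbr i. if k = i then 1 else (0::real)) = (if k = i then real (deg i) else 0)"
        by (simp add: deg_def)
      ultimately show ?thesis unfolding sum_subtractf by (simp add: nbr_def)
    qed
    finally show ?thesis using ik i adj_irrefl
      by (auto simp: shifted_laplacian_def c_def row_def algebra_simps)
  qed
  have "det ?M = (\<Sum>p | p permutes {0..<n}. signof p * (\<Prod>i = 0..<n. ?M $$ (i, p i)))"
    by (rule det_def') (simp add: shifted_laplacian_def)
  also have "\<dots> = (\<Sum>p | p permutes {0..<n}. signof p * (\<Sum>f\<in>PiE {0..<n} ?J. \<Prod>i = 0..<n. c i (f i) * row i (f i) (p i)))"
  proof (intro sum.cong refl arg_cong2[where f = "(*)"])
    fix p assume "p \<in> {p. p permutes {0..<n}}"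
    then have "p i < n" if "i < n" for i using that permutes_in_image[of p "{0..<n}" i] by simp
    then have "(\<Prod>i = 0..<n. ?M $$ (i, p i)) = (\<Prod>i = 0..<n. \<Sum>j\<in>?J i. c i j * row i j (p i))"
      by (intro prod.cong refl entry) auto
    also have "\<dots> = (\<Sum>f\<in>PiE {0..<n} ?J. \<Prod>i = 0..<n. c i (f i) * row i (f i) (p i))"
      by (rule prod_sum_PiE) auto
    finally show "(\<Prod>i = 0..<n. ?M $$ (i, p i)) = \<dots>" .
  qed
  also have "\<dots> = (\<Sum>f\<in>PiE {0..<n} ?J. \<Sum>p | p permutes {0..<n}. signof p * (\<Prod>i = 0..<n. c i (f i) * row i (f i) (p i)))"
    unfolding sum_distrib_left by (rule sum.swap)
  also have "\<dots> = (\<Sum>f\<in>PiE {0..<n} ?J. (\<Prod>i = 0..<n. c i (f i)) * det (function_laplacian n f))"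
  proof (intro sum.cong refl)
    fix f assume f: "f \<in> PiE {0..<n} ?J"
    have "(\<Prod>i = 0..<n. row i (f i) (p i)) = (\<Prod>i = 0..<n. function_laplacian n f $$ (i, p i))"
      if "p permutes {0..<n}" for p
      using permutes_in_image[OF that] by (intro prod.cong refl) (auto simp: function_laplacian_def row_def)
    then show "(\<Sum>p | p permutes {0..<n}. signof p * (\<Prod>i = 0..<n. c i (f i) * row i (f i) (p i))) =
        (\<Prod>i = 0..<n. c i (f i)) * det (function_laplacian n f)"
      unfolding det_def'[OF function_laplacian_carrier] sum_distrib_left
      by (intro sum.cong refl) (auto simp: prod.distrib mult_ac)
  qed
  finally have expand: "det ?M = \<dots>" .
  have fin: "finite (PiE {0..<n} ?J)" by (intro finite_PiE) auto
  have cpos: "c i j \<ge> 0" for i j using e by (simp add: c_def)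
  have bound: "f i < n" if "f \<in> PiE {0..<n} ?J" "i < n" for f i
    using PiE_mem[OF that(1), of i] that(2) nbr_subset[of i] by auto
  have "\<epsilon> * card T = (\<Sum>f\<in>T. \<epsilon>)" by simp
  also have "\<dots> \<le> (\<Sum>f\<in>T. (\<Prod>i = 0..<n. c i (f i)) * det (function_laplacian n f))"
  proof (rule sum_mono)
    fix f assume f: "f \<in> T"
    obtain h :: "nat \<Rightarrow> nat" where "\<forall>i<n. f i \<noteq> i \<longrightarrow> h (f i) < h i" using acyc[OF f] by blast
    then have d: "det (function_laplacian n f) = 1"
      by (intro det_function_laplacian_acyclic[of n f h]) auto
    \<comment> \<open>The only root of \<open>f\<close> is \<open>r\<close>. The weight
      \<open>\<epsilon> * deg r\<close> is at least \<open>\<epsilon>\<close> because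
      \<open>r\<close> is not isolated.\<close>
    have "(\<Prod>i = 0..<n. c i (f i)) = (\<Prod>i = 0..<n. if i = r then \<epsilon> * deg r else 1)"
      using roots[OF f] by (intro prod.cong refl) (auto simp: c_def)
    also have "\<dots> = \<epsilon> * deg r" using r by (simp add: prod.delta)
    finally show "\<epsilon> \<le> (\<Prod>i = 0..<n. c i (f i)) * det (function_laplacian n f)"
      using d e deg_pos[OF r] mult_left_mono[of 1 "real (deg r)" \<epsilon>] by simp
  qed
  also have "\<dots> \<le> (\<Sum>f\<in>PiE {0..<n} ?J. (\<Prod>i = 0..<n. c i (f i)) * det (function_laplacian n f))"
    using T fin bound cpos
    by (intro sum_mono2) (auto intro!: mult_nonneg_nonneg prod_nonneg det_function_laplacian_nonneg)
  finally show ?thesis using expand by simp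
qed

section \<open>The spectrum of the random walk\<close>

definition step :: "nat \<Rightarrow> nat \<Rightarrow> real" where
  "step i j = (if adj i j then 1 / deg i else 0)"

primrec walk :: "nat \<Rightarrow> nat \<Rightarrow> nat \<Rightarrow> real" where
  "walk 0 i j = (if i = j then 1 else 0)"
| "walk (Suc k) i j = (\<Sum>l = 0..<n. walk k i l * step l j)"

definition return_sum :: "nat \<Rightarrow> real" where
  "return_sum k = (\<Sum>i = 0..<n. walk k i i)"

lemma step_nonneg: "step i j \<ge> 0" by (simp add: step_def)

lemma sum_step: "i < n \<Longrightarrow> (\<Sum>j = 0..<n. step i j) = 1"
proof -
  assume i: "i < n"
  have "(\<Sum>j = 0..<n. step i j) = (\<Sum>j\<in>nbr i. 1 / deg i)"
    using nbr_subset[of i] by (intro sum.mono_neutral_cong_right) (auto simp: step_def nbr_def)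
  also have "\<dots> = 1" using deg_pos[OF i] by (auto simp: deg_def)
  finally show ?thesis .
qed

lemma deg_step: "i < n \<Longrightarrow> deg i * step i j = (if adj i j then 1 else 0)"
  using deg_pos[of i] by (auto simp: step_def)

definition step_mat :: "complex mat" where
  "step_mat = mat n n (\<lambda>(i, j). complex_of_real (step i j))"

lemma step_mat_carrier [simp]: "step_mat \<in> carrier_mat n n"
  by (simp add: step_mat_def)

lemma step_mat_pow: "i < n \<Longrightarrow> j < n \<Longrightarrow> (step_mat ^\<^sub>m k) $$ (i, j) = complex_of_real (walk k i j)"
proof (induction k arbitrary: j)
  case 0
  then show ?case by (simp add: step_mat_def)
next
  case (Suc k)
  have "(step_mat ^\<^sub>m Suc k) $$ (i, j) = (\<Sum>l = 0..<n. (step_mat ^\<^sub>m k) $$ (i, l) * step_mat $$ (l, j))"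
    using Suc.prems carrier_matD[OF pow_carrier_mat[OF step_mat_carrier, of k]] carrier_matD[OF step_mat_carrier]
    by (simp add: scalar_prod_def)
  also have "\<dots> = (\<Sum>l = 0..<n. complex_of_real (walk k i l) * complex_of_real (step l j))"
    using Suc by (intro sum.cong refl) (auto simp: step_mat_def)
  finally show ?case by simp
qed

text \<open>The walk is self-adjoint for the inner product weighted by degrees: \<open>a * N\<close>
  is the value \<open>S\<close> of a Hermitian form, hence real. The bound on the modulus follows at
  an entry of \<open>v\<close> of largest modulus, since the rows sum to 1.\<close>

lemma eigenvalue_step_mat:
  assumes "eigenvalue step_mat a"
  shows "Im a = 0 \<and> \<bar>Re a\<bar> \<le> 1"
proof -
  obtain v where v: "v \<in> carrier_vec n" "v \<noteq> 0\<^sub>v n" "step_mat *\<^sub>v v = a \<cdot>\<^sub>v v"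
    using assms by (auto simp: eigenvalue_def eigenvector_def step_mat_def)
  have ev: "(\<Sum>j = 0..<n. complex_of_real (step i j) * v $ j) = a * v $ i" if i: "i < n" for i
  proof -
    have "(step_mat *\<^sub>v v) $ i = (\<Sum>j = 0..<n. complex_of_real (step i j) * v $ j)"
      using i v(1) by (simp add: step_mat_def scalar_prod_def)
    then show ?thesis using v i by simp
  qed
  obtain b where b: "b < n" "v $ b \<noteq> 0" using v(1,2) by (metis carrier_vecD eq_vecI index_zero_vec)
  define N where "N = (\<Sum>i = 0..<n. real (deg i) * (cmod (v $ i))\<^sup>2)"
  define S where "S = (\<Sum>i = 0..<n. \<Sum>j = 0..<n. if adj i j then cnj (v $ i) * v $ j else 0)"
  have N: "N > 0"
  proof -
    have "0 < real (deg b) * (cmod (v $ b))\<^sup>2" using b deg_pos[OF b(1)] by simp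
    also have "\<dots> \<le> N" unfolding N_def using b by (intro member_le_sum) auto
    finally show ?thesis .
  qed
  have "a * complex_of_real N = (\<Sum>i = 0..<n. complex_of_real (deg i) * cnj (v $ i) * (a * v $ i))"
    unfolding N_def of_real_sum sum_distrib_left
  proof (intro sum.cong refl)
    fix i
    have "complex_of_real ((cmod (v $ i))\<^sup>2) = v $ i * cnj (v $ i)" by (rule complex_norm_square)
    then show "a * complex_of_real (real (deg i) * (cmod (v $ i))\<^sup>2) =
        complex_of_real (real (deg i)) * cnj (v $ i) * (a * v $ i)"
      unfolding of_real_mult by (simp add: mult_ac)
  qed
  also have "\<dots> = (\<Sum>i = 0..<n. \<Sum>j = 0..<n. complex_of_real (deg i) * cnj (v $ i) * (complex_of_real (step i j) * v $ j))"
    using ev by (intro sum.cong refl) (simp add: sum_distrib_left[symmetric])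
  also have "\<dots> = S"
    unfolding S_def
  proof (intro sum.cong refl)
    fix i j assume "i \<in> {0..<n}" "j \<in> {0..<n}"
    then have "complex_of_real (deg i) * complex_of_real (step i j) = (if adj i j then 1 else 0)"
      unfolding of_real_mult[symmetric] using deg_step[of i j] by auto
    then show "complex_of_real (deg i) * cnj (v $ i) * (complex_of_real (step i j) * v $ j) =
        (if adj i j then cnj (v $ i) * v $ j else 0)"
      by (metis (no_types, opaque_lifting) mult.assoc mult.commute mult.left_neutral mult_zero_left)
  qed
  finally have aN: "a * complex_of_real N = S" .
  have "cnj S = (\<Sum>i = 0..<n. \<Sum>j = 0..<n. if adj i j then cnj (v $ j) * v $ i else 0)"
    unfolding S_def cnj_sum by (intro sum.cong refl) (auto simp: mult.commute)
  also have "\<dots> = (\<Sum>j = 0..<n. \<Sum>i = 0..<n. if adj i j then cnj (v $ j) * v $ i else 0)"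
    by (rule sum.swap)
  also have "\<dots> = S" unfolding S_def by (intro sum.cong refl) (auto dest: adj_sym)
  finally have "cnj a * complex_of_real N = a * complex_of_real N" using aN by (metis complex_cnj_complex_of_real complex_cnj_mult)
  then have "cnj a = a" using N by simp
  then have im: "Im a = 0" by (metis complex_cnj_cancel_iff Im_complex_of_real Reals_cnj_iff complex_is_Real_iff)
  obtain i where i: "i < n" "\<And>j. j < n \<Longrightarrow> cmod (v $ j) \<le> cmod (v $ i)"
  proof -
    let ?M = "(\<lambda>j. cmod (v $ j)) ` {0..<n}"
    have "Max ?M \<in> ?M" using b by (intro Max_in) auto
    then obtain i where "i < n" "cmod (v $ i) = Max ?M" by auto
    then show ?thesis using that[of i] by auto
  qed
  have vi: "cmod (v $ i) > 0" using i(2)[OF b(1)] b(2) by (meson less_le_trans zero_less_norm_iff)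
  have "cmod a * cmod (v $ i) = cmod (\<Sum>j = 0..<n. complex_of_real (step i j) * v $ j)"
    using ev[OF i(1)] by (simp add: norm_mult)
  also have "\<dots> \<le> (\<Sum>j = 0..<n. step i j * cmod (v $ j))"
    by (rule order_trans[OF norm_sum]) (simp add: norm_mult step_nonneg)
  also have "\<dots> \<le> (\<Sum>j = 0..<n. step i j * cmod (v $ i))"
    using i(2) by (intro sum_mono mult_left_mono) (auto simp: step_nonneg)
  also have "\<dots> = cmod (v $ i)" using sum_step[OF i(1)] by (simp flip: sum_distrib_right)
  finally have "cmod a \<le> 1" using vi by simp
  then show ?thesis using im abs_Re_le_cmod order_trans by blast
qed

text \<open>One list of real eigenvalues carries both the determinant and all traces, so that the
  two can be compared term by term.\<close>

lemma ex_spectrum: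
  "\<exists>ms :: real list. length ms = n \<and> (\<forall>m\<in>set ms. \<bar>m\<bar> \<le> 1) \<and>
     (\<forall>R. det (mat n n (\<lambda>(i, j). (if i = j then R else 0) - step i j)) = (\<Prod>m\<leftarrow>ms. R - m)) \<and>
     (\<forall>k. return_sum k = (\<Sum>m\<leftarrow>ms. m ^ k))"
proof -
  obtain as where as: "char_poly step_mat = (\<Prod>a\<leftarrow>as. [:- a, 1:])" "length as = n"
    using char_poly_factorized[OF step_mat_carrier] by blast
  have ev: "Im a = 0 \<and> \<bar>Re a\<bar> \<le> 1" if "a \<in> set as" for a
  proof (rule eigenvalue_step_mat)
    have "poly (char_poly step_mat) a = 0" unfolding as(1) poly_prod_list
      using that by (auto simp: prod_list_zero_iff)
    then show "eigenvalue step_mat a" using eigenvalue_root_char_poly[OF step_mat_carrier] by blast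
  qed
  then have re: "complex_of_real (Re a) = a" if "a \<in> set as" for a
    using that by (simp add: complex_eq_iff)
  have det: "det (mat n n (\<lambda>(i, j). (if i = j then R else 0) - step i j)) = (\<Prod>a\<leftarrow>as. R - Re a)" for R
  proof -
    let ?A = "mat n n (\<lambda>(i, j). (if i = j then R else 0) - step i j)"
    have "complex_of_real (det ?A) = det (map_mat complex_of_real ?A)" by simp
    also have "\<dots> = poly (char_poly step_mat) (complex_of_real R)"
      unfolding char_poly_def
      by (rule poly_det_cong[symmetric, of _ n]) (auto simp: char_poly_matrix_def step_mat_def)
    also have "\<dots> = (\<Prod>a\<leftarrow>as. complex_of_real R - a)"
      unfolding as(1) poly_prod_list by (simp add: comp_def)
    also have "\<dots> = (\<Prod>a\<leftarrow>as. complex_of_real (R - Re a))"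
      using re by (intro arg_cong[of _ _ prod_list] map_cong) auto
    also have "\<dots> = complex_of_real (\<Prod>a\<leftarrow>as. R - Re a)"
      by (induction as) auto
    finally show ?thesis using of_real_eq_iff by blast
  qed
  have tr: "return_sum k = (\<Sum>a\<leftarrow>as. Re a ^ k)" for k
  proof -
    have "complex_of_real (return_sum k) = mat_trace (step_mat ^\<^sub>m k)"
      using step_mat_pow carrier_matD[OF pow_carrier_mat[OF step_mat_carrier, of k]]
      unfolding mat_trace_def return_sum_def of_real_sum by (intro sum.cong) auto
    also have "\<dots> = (\<Sum>a\<leftarrow>as. a ^ k)" by (rule mat_trace_pow[OF step_mat_carrier as(1)])
    also have "\<dots> = (\<Sum>a\<leftarrow>as. complex_of_real (Re a ^ k))"
      using re by (intro arg_cong[of _ _ sum_list] map_cong) auto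
    also have "\<dots> = complex_of_real (\<Sum>a\<leftarrow>as. Re a ^ k)"
      by (induction as) auto
    finally show ?thesis using of_real_eq_iff by blast
  qed
  show ?thesis using as(2) ev det tr by (intro exI[of _ "map Re as"]) (auto simp: comp_def)
qed

text \<open>The matrix is the degree matrix times \<open>R - P\<close>. The polynomial bound is
  applied to each eigenvalue of \<open>P\<close>, and the resulting power sums are the
  traces.\<close>

lemma det_shifted_laplacian_le:
  fixes c :: "nat \<Rightarrow> real"
  assumes R: "R > 1"
    and p: "\<And>x. \<bar>x\<bar> \<le> 1 \<Longrightarrow> ln (R - x) \<le> c 0 - c 1 * x - c 2 * x ^ 2 - c 3 * x ^ 3 - c 4 * x ^ 4 - c 5 * x ^ 5"
  shows "det (shifted_laplacian R) \<le> exp ((\<Sum>i = 0..<n. ln (deg i)) + c 0 * n -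
    c 1 * return_sum 1 - c 2 * return_sum 2 - c 3 * return_sum 3 - c 4 * return_sum 4 - c 5 * return_sum 5)"
proof -
  obtain ms :: "real list" where ms: "length ms = n" "\<And>m. m \<in> set ms \<Longrightarrow> \<bar>m\<bar> \<le> 1"
    "\<And>R. det (mat n n (\<lambda>(i, j). (if i = j then R else 0) - step i j)) = (\<Prod>m\<leftarrow>ms. R - m)"
    "\<And>k. return_sum k = (\<Sum>m\<leftarrow>ms. m ^ k)" using ex_spectrum by blast
  let ?B = "mat n n (\<lambda>(i, j). (if i = j then R else 0) - step i j)"
  have "det (shifted_laplacian R) = (\<Prod>i = 0..<n. real (deg i)) * det ?B"
  proof -
    have factor: "(\<Prod>i = 0..<n. shifted_laplacian R $$ (i, p i)) =
        (\<Prod>i = 0..<n. real (deg i)) * (\<Prod>i = 0..<n. ?B $$ (i, p i))" if "p permutes {0..<n}" for p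
      unfolding prod.distrib[symmetric]
    proof (intro prod.cong refl)
      fix i assume "i \<in> {0..<n}"
      then have i: "i < n" "p i < n" using permutes_in_image[OF that, of i] by auto
      then show "shifted_laplacian R $$ (i, p i) = real (deg i) * ?B $$ (i, p i)"
        using deg_step[OF i(1), of "p i"] adj_irrefl
        by (auto simp: shifted_laplacian_def algebra_simps step_def)
    qed
    have carrier: "shifted_laplacian R \<in> carrier_mat n n" "?B \<in> carrier_mat n n"
      by (simp_all add: shifted_laplacian_def)
    show ?thesis
      unfolding det_def'[OF carrier(1)] det_def'[OF carrier(2)] sum_distrib_left
      by (intro sum.cong refl) (simp only: mem_Collect_eq factor mult.left_commute)
  qed
  also have "(\<Prod>i = 0..<n. real (deg i)) = exp (\<Sum>i = 0..<n. ln (deg i))"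
    unfolding exp_sum[OF finite_atLeastLessThan]
  proof (intro prod.cong refl)
    fix i assume "i \<in> {0..<n}"
    then show "real (deg i) = exp (ln (real (deg i)))" using deg_pos[of i] by simp
  qed
  finally have fac: "det (shifted_laplacian R) = exp (\<Sum>i = 0..<n. ln (deg i)) * det ?B" .
  have "det ?B \<le> exp (\<Sum>m\<leftarrow>ms. c 0 - c 1 * m - c 2 * m ^ 2 - c 3 * m ^ 3 - c 4 * m ^ 4 - c 5 * m ^ 5)"
  proof -
    have "(\<Prod>m\<leftarrow>ms'. R - m) \<le> exp (\<Sum>m\<leftarrow>ms'. c 0 - c 1 * m - c 2 * m ^ 2 - c 3 * m ^ 3 - c 4 * m ^ 4 - c 5 * m ^ 5) \<and>
        (\<Prod>m\<leftarrow>ms'. R - m) > 0" if "set ms' \<subseteq> set ms" for ms'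
      using that
    proof (induction ms')
      case (Cons m ms')
      then have m: "\<bar>m\<bar> \<le> 1" using ms(2) by auto
      then have pos: "R - m > 0" using R by linarith
      have "R - m \<le> exp (c 0 - c 1 * m - c 2 * m ^ 2 - c 3 * m ^ 3 - c 4 * m ^ 4 - c 5 * m ^ 5)"
        using p[OF m] pos by (metis exp_le_cancel_iff exp_ln)
      then show ?case using Cons pos by (auto simp: exp_add intro!: mult_mono)
    qed simp
    then show ?thesis unfolding ms(3) by blast
  qed
  also have "(\<Sum>m\<leftarrow>ms. c 0 - c 1 * m - c 2 * m ^ 2 - c 3 * m ^ 3 - c 4 * m ^ 4 - c 5 * m ^ 5) =
      c 0 * n - c 1 * return_sum 1 - c 2 * return_sum 2 - c 3 * return_sum 3 - c 4 * return_sum 4 - c 5 * return_sum 5"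
  proof -
    have "(\<Sum>m\<leftarrow>xs. c 0 - c 1 * m - c 2 * m ^ 2 - c 3 * m ^ 3 - c 4 * m ^ 4 - c 5 * m ^ 5) =
      c 0 * length xs - c 1 * (\<Sum>m\<leftarrow>xs. m ^ 1) - c 2 * (\<Sum>m\<leftarrow>xs. m ^ 2) - c 3 * (\<Sum>m\<leftarrow>xs. m ^ 3) -
      c 4 * (\<Sum>m\<leftarrow>xs. m ^ 4) - c 5 * (\<Sum>m\<leftarrow>xs. m ^ 5)" for xs
      by (induction xs) (simp_all add: algebra_simps)
    from this[of ms] show ?thesis unfolding ms(4) by (simp only: ms(1))
  qed
  finally have "det (shifted_laplacian R) \<le> exp (\<Sum>i = 0..<n. ln (deg i)) * exp (c 0 * n -
    c 1 * return_sum 1 - c 2 * return_sum 2 - c 3 * return_sum 3 - c 4 * return_sum 4 - c 5 * return_sum 5)"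
    unfolding fac by (rule mult_left_mono) simp
  then show ?thesis by (simp add: exp_add[symmetric] algebra_simps)
qed

end

section \<open>Closed walks\<close>

context indexed_graph
begin

abbreviation I :: "nat set" where "I \<equiv> {0..<n}"

abbreviation A :: "nat \<Rightarrow> nat \<Rightarrow> real" where "A i j \<equiv> of_bool (adj i j)"

definition inv_deg :: "nat \<Rightarrow> real" where "inv_deg i = 1 / deg i"

lemma step_eq: "step i j = A i j * inv_deg i"
  by (simp add: step_def inv_deg_def)

lemma sum_A: "i < n \<Longrightarrow> (\<Sum>j\<in>I. A i j) = deg i"
proof -
  assume i: "i < n"
  have "(\<Sum>j\<in>I. A i j) = (\<Sum>j\<in>nbr i. 1)"
    using nbr_subset[of i] by (intro sum.mono_neutral_cong_right) (auto simp: nbr_def)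
  then show ?thesis by (simp add: deg_def)
qed

lemma A_commute: "A i j = A j i"
  using adj_sym by auto

lemma sum_A': "i < n \<Longrightarrow> (\<Sum>j\<in>I. A j i) = deg i"
proof -
  assume "i < n"
  have "(\<Sum>j\<in>I. A j i) = (\<Sum>j\<in>I. A i j)" by (intro sum.cong refl A_commute)
  then show ?thesis using sum_A[OF \<open>i < n\<close>] by simp
qed

lemma walk_nonneg: "walk k i j \<ge> 0"
  by (induction k arbitrary: j) (auto intro!: sum_nonneg simp: step_nonneg)

lemma return_sum_nonneg: "return_sum k \<ge> 0"
  unfolding return_sum_def by (intro sum_nonneg walk_nonneg)

lemma walk_1: "i < n \<Longrightarrow> walk (Suc 0) i j = step i j"
proof -
  assume "i < n"
  have "walk (Suc 0) i j = (\<Sum>l\<in>I. if i = l then step l j else 0)"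
    unfolding walk.simps by (intro sum.cong) auto
  then show ?thesis using \<open>i < n\<close> by simp
qed

lemma return_sum_1: "return_sum 1 = 0"
  using adj_irrefl by (simp add: return_sum_def walk_1 step_def del: walk.simps)

lemma return_sum_2: "return_sum 2 = (\<Sum>a\<in>I. \<Sum>b\<in>I. step a b * step b a)"
  unfolding return_sum_def numeral_2_eq_2 walk.simps(2)[of "Suc 0"]
  by (intro sum.cong refl) (simp add: walk_1 del: walk.simps)

lemma return_sum_4:
  "return_sum 4 = (\<Sum>a\<in>I. \<Sum>b\<in>I. \<Sum>c\<in>I. \<Sum>d\<in>I. step a b * step b c * step c d * step d a)"
proof -
  have "walk 4 a a = (\<Sum>b\<in>I. \<Sum>c\<in>I. \<Sum>d\<in>I. step a b * step b c * step c d * step d a)" if a: "a < n" for a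
  proof -
    have "walk 4 a a = (\<Sum>d\<in>I. (\<Sum>c\<in>I. (\<Sum>b\<in>I. step a b * step b c) * step c d) * step d a)"
    proof -
      have four: "4 = Suc (Suc (Suc (Suc 0)))" by simp
      show ?thesis
        unfolding four walk.simps(2)[of "Suc (Suc (Suc 0))"] walk.simps(2)[of "Suc (Suc 0)"]
          walk.simps(2)[of "Suc 0"] walk_1[OF a] by (rule refl)
    qed
    also have "\<dots> = (\<Sum>d\<in>I. \<Sum>c\<in>I. \<Sum>b\<in>I. step a b * step b c * step c d * step d a)"
      by (simp add: sum_distrib_right)
    also have "\<dots> = (\<Sum>d\<in>I. \<Sum>b\<in>I. \<Sum>c\<in>I. step a b * step b c * step c d * step d a)"
      by (intro sum.cong refl sum.swap)
    also have "\<dots> = (\<Sum>b\<in>I. \<Sum>d\<in>I. \<Sum>c\<in>I. step a b * step b c * step c d * step d a)"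
      by (rule sum.swap)
    also have "\<dots> = (\<Sum>b\<in>I. \<Sum>c\<in>I. \<Sum>d\<in>I. step a b * step b c * step c d * step d a)"
      by (intro sum.cong refl sum.swap)
    finally show ?thesis .
  qed
  then show ?thesis unfolding return_sum_def by (intro sum.cong refl) auto
qed

text \<open>Summed over tuples, unlike the shorter walks, because cyclic rotation will be used as a
  permutation of the index set.\<close>

lemma return_sum_5:
  "return_sum 5 = (\<Sum>(a, b, c, d, e)\<in>I \<times> I \<times> I \<times> I \<times> I. step a b * step b c * step c d * step d e * step e a)"
proof -
  have "walk 5 a a = (\<Sum>b\<in>I. \<Sum>c\<in>I. \<Sum>d\<in>I. \<Sum>e\<in>I. step a b * step b c * step c d * step d e * step e a)"
    if a: "a < n" for a
  proof -
    let ?f = "\<lambda>b c d e. step a b * step b c * step c d * step d e * step e a"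
    have "walk 5 a a = (\<Sum>e\<in>I. (\<Sum>d\<in>I. (\<Sum>c\<in>I. (\<Sum>b\<in>I. step a b * step b c) * step c d) * step d e) * step e a)"
    proof -
      have five: "5 = Suc (Suc (Suc (Suc (Suc 0))))" by simp
      show ?thesis
        unfolding five walk.simps(2)[of "Suc (Suc (Suc (Suc 0)))"] walk.simps(2)[of "Suc (Suc (Suc 0))"]
          walk.simps(2)[of "Suc (Suc 0)"] walk.simps(2)[of "Suc 0"] walk_1[OF a] by (rule refl)
    qed
    also have "\<dots> = (\<Sum>e\<in>I. \<Sum>d\<in>I. \<Sum>c\<in>I. \<Sum>b\<in>I. ?f b c d e)"
      by (simp add: sum_distrib_right)
    also have "\<dots> = (\<Sum>e\<in>I. \<Sum>d\<in>I. \<Sum>b\<in>I. \<Sum>c\<in>I. ?f b c d e)"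
      by (intro sum.cong refl sum.swap)
    also have "\<dots> = (\<Sum>e\<in>I. \<Sum>b\<in>I. \<Sum>d\<in>I. \<Sum>c\<in>I. ?f b c d e)"
      by (intro sum.cong refl sum.swap)
    also have "\<dots> = (\<Sum>b\<in>I. \<Sum>e\<in>I. \<Sum>c\<in>I. \<Sum>d\<in>I. ?f b c d e)"
      by (subst sum.swap) (intro sum.cong refl sum.swap)
    also have "\<dots> = (\<Sum>b\<in>I. \<Sum>c\<in>I. \<Sum>e\<in>I. \<Sum>d\<in>I. ?f b c d e)"
      by (intro sum.cong refl sum.swap)
    also have "\<dots> = (\<Sum>b\<in>I. \<Sum>c\<in>I. \<Sum>d\<in>I. \<Sum>e\<in>I. ?f b c d e)"
      by (intro sum.cong refl sum.swap)
    finally show ?thesis .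
  qed
  then have "return_sum 5 = (\<Sum>a\<in>I. \<Sum>b\<in>I. \<Sum>c\<in>I. \<Sum>d\<in>I. \<Sum>e\<in>I. step a b * step b c * step c d * step d e * step e a)"
    unfolding return_sum_def by (intro sum.cong refl) auto
  then show ?thesis by (simp add: sum.cartesian_product)
qed

text \<open>The product of the two inverse degrees along an edge is at least
  \<open>?g a + ?g b\<close>, by a square that vanishes when their mean is \<open>\<alpha>\<close>.
  This decouples the ends of the edge. Later \<open>\<alpha>\<close> is the reciprocal of the
  largest possible mean degree.\<close>

lemma return_sum_2_ge:
  fixes \<alpha> :: real
  shows "return_sum 2 \<ge> (\<Sum>i\<in>I. 4 * \<alpha> - 2 * \<alpha>\<^sup>2 * deg i - 1 / deg i)"
proof -
  let ?g = "\<lambda>i. 2 * \<alpha> * inv_deg i - \<alpha>\<^sup>2 - (inv_deg i)\<^sup>2 / 2"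
  have pt: "A a b * ?g a + A a b * ?g b \<le> step a b * step b a" for a b
  proof (cases "adj a b")
    case True
    have "0 \<le> (inv_deg a + inv_deg b - 2 * \<alpha>)\<^sup>2" by simp
    then show ?thesis using True adj_sym[OF True]
      by (simp add: step_eq power2_eq_square algebra_simps)
  qed (simp add: step_eq)
  have "(\<Sum>i\<in>I. 4 * \<alpha> - 2 * \<alpha>\<^sup>2 * deg i - 1 / deg i) = (\<Sum>i\<in>I. 2 * (deg i * ?g i))"
  proof (intro sum.cong refl)
    fix i assume "i \<in> I"
    then have "real (deg i) \<noteq> 0" using deg_pos[of i] by auto
    then show "4 * \<alpha> - 2 * \<alpha>\<^sup>2 * deg i - 1 / deg i = 2 * (deg i * ?g i)"
      by (simp add: inv_deg_def field_simps power2_eq_square)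
  qed
  also have "\<dots> = (\<Sum>a\<in>I. deg a * ?g a) + (\<Sum>b\<in>I. deg b * ?g b)"
    by (simp add: sum.distrib[symmetric])
  also have "\<dots> = (\<Sum>a\<in>I. \<Sum>b\<in>I. A a b * ?g a) + (\<Sum>b\<in>I. \<Sum>a\<in>I. A a b * ?g b)"
    unfolding sum_distrib_right[symmetric] by (simp add: sum_A sum_A' del: sum_of_bool_eq sum_of_bool_mult_eq)
  also have "(\<Sum>b\<in>I. \<Sum>a\<in>I. A a b * ?g b) = (\<Sum>a\<in>I. \<Sum>b\<in>I. A a b * ?g b)" by (rule sum.swap)
  also have "(\<Sum>a\<in>I. \<Sum>b\<in>I. A a b * ?g a) + (\<Sum>a\<in>I. \<Sum>b\<in>I. A a b * ?g b) =
      (\<Sum>a\<in>I. \<Sum>b\<in>I. A a b * ?g a + A a b * ?g b)" by (simp only: sum.distrib)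
  also have "\<dots> \<le> return_sum 2" unfolding return_sum_2 by (intro sum_mono pt)
  finally show ?thesis .
qed

text \<open>Closed walks \<open>a, b, c, d\<close> with \<open>c = a\<close> or \<open>d = b\<close>
  are counted by inclusion and exclusion. Each square of a return probability \<open>\<tau>\<close>
  is replaced by its tangent at \<open>s\<close>, which is exact for a regular graph of degree
  \<open>1 / s\<close>. The walks that satisfy both conditions are bounded by the inequality of
  means.\<close>

lemma return_sum_4_ge:
  fixes s :: real
  shows "return_sum 4 \<ge> 4 * s * return_sum 2 - 2 * s\<^sup>2 * n - (\<Sum>i\<in>I. 1 / real (deg i) ^ 3)"
proof -
  let ?w = "\<lambda>a b c d. step a b * step b c * step c d * step d a"
  define \<tau> where "\<tau> a = (\<Sum>b\<in>I. step a b * step b a)" for a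
  have "(\<Sum>a\<in>I. \<Sum>b\<in>I. \<Sum>c\<in>I. \<Sum>d\<in>I. of_bool (c = a) * ?w a b c d + of_bool (d = b) * ?w a b c d -
      of_bool (c = a) * (of_bool (d = b) * ?w a b c d)) \<le> return_sum 4"
    unfolding return_sum_4 by (intro sum_mono) (auto simp: step_nonneg)
  also have "(\<Sum>a\<in>I. \<Sum>b\<in>I. \<Sum>c\<in>I. \<Sum>d\<in>I. of_bool (c = a) * ?w a b c d + of_bool (d = b) * ?w a b c d -
      of_bool (c = a) * (of_bool (d = b) * ?w a b c d)) =
      (\<Sum>a\<in>I. \<Sum>b\<in>I. \<Sum>c\<in>I. \<Sum>d\<in>I. of_bool (c = a) * ?w a b c d) +
      (\<Sum>a\<in>I. \<Sum>b\<in>I. \<Sum>c\<in>I. \<Sum>d\<in>I. of_bool (d = b) * ?w a b c d) -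
      (\<Sum>a\<in>I. \<Sum>b\<in>I. \<Sum>c\<in>I. \<Sum>d\<in>I. of_bool (c = a) * (of_bool (d = b) * ?w a b c d))"
    by (simp only: sum.distrib sum_subtractf)
  also have "(\<Sum>a\<in>I. \<Sum>b\<in>I. \<Sum>c\<in>I. \<Sum>d\<in>I. of_bool (c = a) * ?w a b c d) = (\<Sum>a\<in>I. (\<tau> a)\<^sup>2)"
  proof (intro sum.cong refl)
    fix a assume a: "a \<in> I"
    have "(\<Sum>b\<in>I. \<Sum>c\<in>I. \<Sum>d\<in>I. of_bool (c = a) * ?w a b c d) = (\<Sum>b\<in>I. \<Sum>c\<in>I. if c = a then (\<Sum>d\<in>I. ?w a b a d) else 0)"
      by (intro sum.cong refl) auto
    also have "\<dots> = (\<Sum>b\<in>I. \<Sum>d\<in>I. ?w a b a d)" using a by (simp add: sum.delta)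
    also have "\<dots> = (\<tau> a)\<^sup>2" unfolding \<tau>_def power2_eq_square sum_product by (simp add: mult_ac)
    finally show "(\<Sum>b\<in>I. \<Sum>c\<in>I. \<Sum>d\<in>I. of_bool (c = a) * ?w a b c d) = (\<tau> a)\<^sup>2" .
  qed
  also have "(\<Sum>a\<in>I. \<Sum>b\<in>I. \<Sum>c\<in>I. \<Sum>d\<in>I. of_bool (d = b) * ?w a b c d) = (\<Sum>b\<in>I. (\<tau> b)\<^sup>2)"
  proof -
    have "(\<Sum>a\<in>I. \<Sum>b\<in>I. \<Sum>c\<in>I. \<Sum>d\<in>I. of_bool (d = b) * ?w a b c d) = (\<Sum>a\<in>I. \<Sum>b\<in>I. \<Sum>c\<in>I. ?w a b c b)"
    proof (intro sum.cong refl)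
      fix a b c assume b: "b \<in> I"
      have "(\<Sum>d\<in>I. of_bool (d = b) * ?w a b c d) = (\<Sum>d\<in>I. if d = b then ?w a b c b else 0)"
        by (intro sum.cong refl) auto
      then show "(\<Sum>d\<in>I. of_bool (d = b) * ?w a b c d) = ?w a b c b" using b by simp
    qed
    also have "\<dots> = (\<Sum>b\<in>I. \<Sum>a\<in>I. \<Sum>c\<in>I. ?w a b c b)" by (rule sum.swap)
    also have "\<dots> = (\<Sum>b\<in>I. (\<tau> b)\<^sup>2)" unfolding \<tau>_def power2_eq_square sum_product by (simp add: mult_ac)
    finally show ?thesis .
  qed
  also have "(\<Sum>a\<in>I. \<Sum>b\<in>I. \<Sum>c\<in>I. \<Sum>d\<in>I. of_bool (c = a) * (of_bool (d = b) * ?w a b c d)) =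
      (\<Sum>a\<in>I. \<Sum>b\<in>I. ?w a b a b)"
  proof (intro sum.cong refl)
    fix a b assume ab: "a \<in> I" "b \<in> I"
    have "(\<Sum>c\<in>I. \<Sum>d\<in>I. of_bool (c = a) * (of_bool (d = b) * ?w a b c d)) =
        (\<Sum>c\<in>I. if c = a then (\<Sum>d\<in>I. if d = b then ?w a b a b else 0) else 0)"
      by (intro sum.cong refl) (auto intro!: sum.cong)
    then show "(\<Sum>c\<in>I. \<Sum>d\<in>I. of_bool (c = a) * (of_bool (d = b) * ?w a b c d)) = ?w a b a b"
      using ab by simp
  qed
  finally have 1: "2 * (\<Sum>a\<in>I. (\<tau> a)\<^sup>2) - (\<Sum>a\<in>I. \<Sum>b\<in>I. ?w a b a b) \<le> return_sum 4" by simp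
  have "(\<Sum>a\<in>I. \<Sum>b\<in>I. ?w a b a b) \<le> (\<Sum>a\<in>I. \<Sum>b\<in>I. A a b * (inv_deg a ^ 4 / 2) + A a b * (inv_deg b ^ 4 / 2))"
  proof (intro sum_mono)
    fix a b
    have "0 \<le> ((inv_deg a)\<^sup>2 - (inv_deg b)\<^sup>2)\<^sup>2" by simp
    then have "2 * ((inv_deg a)\<^sup>2 * (inv_deg b)\<^sup>2) \<le> inv_deg a ^ 4 + inv_deg b ^ 4"
      by (simp add: power2_diff power_mult[symmetric] mult_ac)
    then show "?w a b a b \<le> A a b * (inv_deg a ^ 4 / 2) + A a b * (inv_deg b ^ 4 / 2)"
      using A_commute[of a b] by (cases "adj a b") (auto simp: step_eq power2_eq_square mult_ac)
  qed
  also have "\<dots> = (\<Sum>a\<in>I. \<Sum>b\<in>I. A a b * (inv_deg a ^ 4 / 2)) + (\<Sum>b\<in>I. \<Sum>a\<in>I. A a b * (inv_deg b ^ 4 / 2))"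
    unfolding sum.distrib by (subst (2) sum.swap) simp
  also have "\<dots> = (\<Sum>a\<in>I. deg a * (inv_deg a ^ 4 / 2)) + (\<Sum>b\<in>I. deg b * (inv_deg b ^ 4 / 2))"
    unfolding sum_distrib_right[symmetric] by (simp add: sum_A sum_A' del: sum_of_bool_eq sum_of_bool_mult_eq)
  also have "\<dots> = (\<Sum>i\<in>I. 1 / real (deg i) ^ 3)"
    unfolding sum.distrib[symmetric]
  proof (intro sum.cong refl)
    fix i assume "i \<in> I"
    then have "real (deg i) \<noteq> 0" using deg_pos[of i] by auto
    then show "deg i * (inv_deg i ^ 4 / 2) + deg i * (inv_deg i ^ 4 / 2) = 1 / real (deg i) ^ 3"
      by (simp add: inv_deg_def power_divide numeral_eq_Suc)
  qed
  finally have 2: "(\<Sum>a\<in>I. \<Sum>b\<in>I. ?w a b a b) \<le> (\<Sum>i\<in>I. 1 / real (deg i) ^ 3)" .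
  have "(\<Sum>a\<in>I. 2 * s * \<tau> a - s\<^sup>2) \<le> (\<Sum>a\<in>I. (\<tau> a)\<^sup>2)"
  proof (intro sum_mono)
    fix a have "0 \<le> (\<tau> a - s)\<^sup>2" by simp
    then show "2 * s * \<tau> a - s\<^sup>2 \<le> (\<tau> a)\<^sup>2" by (simp add: power2_diff algebra_simps)
  qed
  moreover have "(\<Sum>a\<in>I. 2 * s * \<tau> a - s\<^sup>2) = 2 * s * return_sum 2 - s\<^sup>2 * n"
    unfolding return_sum_2 \<tau>_def by (simp add: sum_subtractf sum_distrib_left)
  ultimately show ?thesis using 1 2 by simp
qed

end

section \<open>Five-step walks around triangles\<close>

lemma prod4_ge_one_minus_sum:
  fixes a b c d :: real
  assumes "0 \<le> a" "a \<le> 1" "0 \<le> b" "b \<le> 1" "0 \<le> c" "c \<le> 1" "0 \<le> d" "d \<le> 1"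
  shows "1 - a - b - c - d \<le> (1 - a) * (1 - b) * (1 - c) * (1 - d)"
proof -
  have two: "1 - u - v \<le> (1 - u) * (1 - v)" if "0 \<le> u" "0 \<le> v" for u v :: real
    using mult_nonneg_nonneg[OF that] by (simp add: algebra_simps)
  have ab: "1 - a - b \<le> (1 - a) * (1 - b)" using assms by (intro two)
  have c: "(1 - a) * (1 - b) - c \<le> (1 - a) * (1 - b) * (1 - c)"
  proof -
    have "(1 - a) * (1 - b) * c \<le> 1 * c" using assms by (intro mult_right_mono mult_le_one) auto
    then show ?thesis by (simp add: algebra_simps)
  qed
  have d: "(1 - a) * (1 - b) * (1 - c) - d \<le> (1 - a) * (1 - b) * (1 - c) * (1 - d)"
  proof -
    have "(1 - a) * (1 - b) * (1 - c) * d \<le> 1 * d" using assms by (intro mult_right_mono mult_le_one) auto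
    then show ?thesis by (simp add: algebra_simps)
  qed
  show ?thesis using ab c d by linarith
qed

lemma five_exclusive_of_bool_le_1:
  assumes "P1 \<Longrightarrow> \<not> P2 \<and> \<not> P3 \<and> \<not> P4 \<and> \<not> P5" "P2 \<Longrightarrow> \<not> P3 \<and> \<not> P4 \<and> \<not> P5"
    "P3 \<Longrightarrow> \<not> P4 \<and> \<not> P5" "P4 \<Longrightarrow> \<not> P5"
  shows "of_bool P1 + of_bool P2 + of_bool P3 + of_bool P4 + of_bool P5 \<le> (1 :: real)"
  using assms by (cases P1; cases P2; cases P3; cases P4; cases P5) simp_all

lemma card_orderings_of_three:
  assumes "card t = 3"
  shows "card {(u, v, w). {u, v, w} = t} = 6"
proof -
  obtain a b c where abc: "t = {a, b, c}" "a \<noteq> b" "a \<noteq> c" "b \<noteq> c"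
    using assms by (auto simp: card_3_iff)
  have "{(u, v, w). {u, v, w} = t} = {(a,b,c), (a,c,b), (b,a,c), (b,c,a), (c,a,b), (c,b,a)}" (is "?L = ?R")
  proof
    show "?L \<subseteq> ?R"
    proof
      fix z assume "z \<in> ?L"
      then obtain u v w where z: "z = (u, v, w)" and eq: "{u, v, w} = t" by auto
      then have "u \<in> {a, b, c}" "v \<in> {a, b, c}" "w \<in> {a, b, c}" using abc by auto
      moreover have "card {u, v, w} = 3" using eq assms by simp
      then have "u \<noteq> v" "u \<noteq> w" "v \<noteq> w" by (auto simp: card_insert_if split: if_splits)
      ultimately show "z \<in> ?R" unfolding z by auto
    qed
    show "?R \<subseteq> ?L" using abc by auto
  qed
  then show ?thesis using abc by simp
qed

context indexed_graph
begin

text \<open>\<open>1 - excess i\<close> is \<open>min 1 (6 / deg i)\<close>, the relative loss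
  against inverse degree 1/6, the value in the triangular lattice. Multiplied by the degree it
  becomes piecewise linear, so that losses can be summed over vertices.\<close>

definition excess :: "nat \<Rightarrow> real" where "excess i = max 0 (1 - 6 / deg i)"

lemma excess_bounds: "0 \<le> excess i" "excess i \<le> 1"
  by (auto simp: excess_def)

lemma deg_excess: "i < n \<Longrightarrow> deg i * excess i = max 0 (real (deg i) - 6)"
  using deg_pos[of i] by (auto simp: excess_def max_def field_simps)

lemma inv_deg_ge: "i < n \<Longrightarrow> (1 - excess i) / 6 \<le> inv_deg i"
  using deg_pos[of i] by (auto simp: excess_def inv_deg_def max_def field_simps)

text \<open>\<open>(d - 1) / d^2\<close> decreases from \<open>d = 2\<close> on and is 5/36 at
  \<open>d = 6\<close>. For larger \<open>d\<close> it still dominates 5/36 times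
  \<open>6 / d\<close>.\<close>

lemma inv_deg_mult_ge:
  assumes "deg i \<ge> 2"
  shows "(5 / 36) * (1 - excess i) \<le> (inv_deg i)\<^sup>2 * (real (deg i) - 1)"
proof -
  have d: "real (deg i) \<ge> 2" using assms by simp
  have eq: "(inv_deg i)\<^sup>2 * (real (deg i) - 1) = (real (deg i) - 1) / (real (deg i))\<^sup>2"
    by (simp add: inv_deg_def power_divide)
  show ?thesis
  proof (cases "deg i \<ge> 6")
    case True
    then have d6: "real (deg i) \<ge> 6" by simp
    then have "1 - excess i = 6 / deg i" by (simp add: excess_def field_simps)
    moreover have "(5 / 36) * (6 / real (deg i)) \<le> (real (deg i) - 1) / (real (deg i))\<^sup>2"
      using d6 by (simp add: field_simps power2_eq_square)
    ultimately show ?thesis unfolding eq by simp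
  next
    case False
    then have d6: "real (deg i) \<le> 5" by simp
    have "5 / 36 \<le> (real (deg i) - 1) / (real (deg i))\<^sup>2"
    proof -
      have "0 \<le> (real (deg i) - 2) * (5 - real (deg i))" using d d6 by simp
      then have "5 * (real (deg i))\<^sup>2 \<le> 36 * (real (deg i) - 1)"
        using d d6 by (simp add: power2_eq_square algebra_simps)
      then show ?thesis using d by (simp add: field_simps)
    qed
    then show ?thesis unfolding eq using excess_bounds[of i] by simp
  qed
qed

text \<open>If all degrees are 6, a triangle has six orderings \<open>u, v, w\<close>, each with
  five detours \<open>y\<close> and five starting points, and each walk has weight 1/7776: together
  \<open>6 * 25 / 7776\<close>. Smaller degrees do not lower the estimate. Larger ones cost at most
  the summed \<open>excess\<close> of the four vertices \<open>u\<close>, \<open>v\<close>,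
  \<open>w\<close>, \<open>y\<close>. As an edge lies in at most two triangles, each of the four
  contributes at most twice the sum of \<open>max 0 (deg i - 6)\<close>, whence the factor
  8.\<close>

lemma return_sum_5_ge:
  assumes fin: "finite TT" and tri: "\<And>t. t \<in> TT \<Longrightarrow> card t = 3"
    and tadj: "\<And>t u v. t \<in> TT \<Longrightarrow> u \<in> t \<Longrightarrow> v \<in> t \<Longrightarrow> u \<noteq> v \<Longrightarrow> adj u v"
    and two: "\<And>u v. adj u v \<Longrightarrow> card {t \<in> TT. {u, v} \<subseteq> t} \<le> 2"
  shows "return_sum 5 \<ge> 25 / 7776 * (6 * card TT - 8 * (\<Sum>i\<in>I. max 0 (real (deg i) - 6)))"
proof -
  define t :: "nat \<Rightarrow> nat \<Rightarrow> nat \<Rightarrow> real" where "t u v w = of_bool ({u, v, w} \<in> TT)" for u v w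
  have t_swap: "t u v w = t v u w" "t u v w = t u w v" for u v w by (simp_all add: t_def insert_commute)
  have distinct: "u \<noteq> v" "u \<noteq> w" "v \<noteq> w" if "{u, v, w} \<in> TT" for u v w
    using tri[OF that] by (auto simp: card_insert_if split: if_splits)
  have adjs: "adj u v" "adj u w" "adj v w" if "{u, v, w} \<in> TT" for u v w
    using tadj[OF that] distinct[OF that] by auto
  have inI: "u \<in> I \<and> v \<in> I \<and> w \<in> I" if "{u, v, w} \<in> TT" for u v w
    using adj_bound adj_sym adjs[OF that] by (metis atLeastLessThan_iff zero_le)

  \<comment> \<open>Different third vertices on the same edge give different triangles.\<close>
  have pair: "(\<Sum>v\<in>I. t u v w) \<le> 2 * A u w" for u w
  proof (cases "adj u w")
    case True
    have "(\<Sum>v\<in>I. t u v w) = card {v \<in> I. {u, v, w} \<in> TT}"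
      by (simp add: t_def Int_def)
    also have "card {v \<in> I. {u, v, w} \<in> TT} \<le> card {s \<in> TT. {u, w} \<subseteq> s}"
    proof (rule card_inj_on_le[of "\<lambda>v. {u, v, w}"])
      show "inj_on (\<lambda>v. {u, v, w}) {v \<in> I. {u, v, w} \<in> TT}"
      proof (rule inj_onI)
        fix x y assume "x \<in> {v \<in> I. {u, v, w} \<in> TT}" "{u, x, w} = {u, y, w}"
        then have "x \<noteq> u" "x \<noteq> w" "x \<in> {u, y, w}" using distinct[of u x w] by auto
        then show "x = y" by simp
      qed
    qed (use fin in auto)
    also have "\<dots> \<le> 2" by (rule two[OF True])
    finally show ?thesis using True by simp
  next
    case False
    then have "t u v w = 0" for v using adjs by (auto simp: t_def)
    then show ?thesis by simp
  qed

  have count: "(\<Sum>u\<in>I. \<Sum>v\<in>I. \<Sum>w\<in>I. t u v w) = 6 * card TT"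
  proof -
    have "(\<Sum>u\<in>I. \<Sum>v\<in>I. \<Sum>w\<in>I. t u v w) = (\<Sum>(u, v, w)\<in>I \<times> I \<times> I. t u v w)"
      by (simp add: sum.cartesian_product)
    also have "\<dots> = real (card ((I \<times> I \<times> I) \<inter> {(u, v, w). {u, v, w} \<in> TT}))"
      by (simp add: t_def case_prod_unfold)
    also have "(I \<times> I \<times> I) \<inter> {(u, v, w). {u, v, w} \<in> TT} = (\<Union>s\<in>TT. {(u, v, w). {u, v, w} = s})"
      using inI by blast
    also have "card \<dots> = (\<Sum>s\<in>TT. card {(u, v, w). {u, v, w} = s})"
    proof (rule card_UN_disjoint[OF fin])
      show "\<forall>s\<in>TT. finite {(u, v, w). {u, v, w} = s}"
        using card_orderings_of_three[OF tri] by (metis card.infinite zero_neq_numeral)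
    qed auto
    also have "\<dots> = (\<Sum>s\<in>TT. 6)" using card_orderings_of_three[OF tri] by (intro sum.cong refl)
    finally show ?thesis by simp
  qed

  \<comment> \<open>\<open>D u\<close> is the number of detours \<open>y\<close> at \<open>u\<close>
    that avoid \<open>w\<close>, and \<open>H u w / D u\<close> is the mean excess of their end
    points.\<close>
  define D where "D u = real (deg u) - 1" for u
  define H where "H u w = (\<Sum>y\<in>I. of_bool (y \<noteq> w) * (A u y * excess y))" for u w
  have sumD: "(\<Sum>y\<in>I. of_bool (y \<noteq> w) * A u y) = D u" if "adj u w" for u w
  proof -
    have uw: "u < n" "w < n" using that adj_bound adj_sym by blast+
    have "(\<Sum>y\<in>I. of_bool (y \<noteq> w) * A u y) = (\<Sum>y\<in>I. A u y - (if y = w then 1 else 0))"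
      using that by (intro sum.cong refl) auto
    also have "\<dots> = D u" unfolding sum_subtractf D_def using sum_A[OF uw(1)] uw by simp
    finally show ?thesis .
  qed

  define W where "W u v w = (\<Sum>y\<in>I. of_bool (y \<noteq> w) * (step u y * step y u * step u v * step v w * step w u))" for u v w
  have W_ge: "5 / 7776 * (1 - excess u - excess v - excess w - H u w / D u) \<le> W u v w"
    if T: "{u, v, w} \<in> TT" for u v w
  proof -
    have uvw: "u < n" "v < n" "w < n" using inI[OF T] by auto
    have "card {v, w} \<le> deg u" unfolding deg_def
      using adjs[OF T] by (intro card_mono finite_nbr) (auto simp: nbr_def)
    then have d: "deg u \<ge> 2" using distinct[OF T] by simp
    then have D: "D u \<ge> 1" by (simp add: D_def)
    have H0: "0 \<le> H u w" unfolding H_def by (intro sum_nonneg) (auto simp: excess_bounds)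
    have HD: "H u w \<le> D u"
    proof -
      have "H u w \<le> (\<Sum>y\<in>I. of_bool (y \<noteq> w) * A u y)"
        unfolding H_def using excess_bounds by (intro sum_mono) auto
      then show ?thesis using sumD adjs[OF T] by simp
    qed
    have W_eq: "W u v w = (inv_deg u)\<^sup>2 * inv_deg v * inv_deg w * (\<Sum>y\<in>I. of_bool (y \<noteq> w) * (A u y * inv_deg y))"
    proof -
      have "step u v = inv_deg u" "step v w = inv_deg v" "step w u = inv_deg w"
        using adjs[OF T] adj_sym by (auto simp: step_eq)
      moreover have "step u y * step y u = inv_deg u * (A u y * inv_deg y)" for y
        using adj_sym by (auto simp: step_eq)
      ultimately show ?thesis unfolding W_def sum_distrib_left
        by (intro sum.cong refl) (simp add: power2_eq_square mult_ac)
    qed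
    have sum_ge: "(D u - H u w) / 6 \<le> (\<Sum>y\<in>I. of_bool (y \<noteq> w) * (A u y * inv_deg y))"
    proof -
      have "(D u - H u w) / 6 = (\<Sum>y\<in>I. of_bool (y \<noteq> w) * (A u y * ((1 - excess y) / 6)))"
        unfolding sumD[OF adjs(2)[OF T], symmetric] H_def sum_subtractf[symmetric] sum_divide_distrib
        by (intro sum.cong refl) (simp add: algebra_simps diff_divide_distrib)
      also have "\<dots> \<le> (\<Sum>y\<in>I. of_bool (y \<noteq> w) * (A u y * inv_deg y))"
        using inv_deg_ge by (intro sum_mono) auto
      finally show ?thesis .
    qed
    have "(inv_deg u)\<^sup>2 * inv_deg v * inv_deg w * ((D u - H u w) / 6) \<le> W u v w"
      unfolding W_eq by (intro mult_left_mono sum_ge) (simp add: inv_deg_def)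
    moreover have "(inv_deg u)\<^sup>2 * inv_deg v * inv_deg w * ((D u - H u w) / 6) =
        ((inv_deg u)\<^sup>2 * D u) * inv_deg v * inv_deg w * ((1 - H u w / D u) / 6)"
      using D by (simp add: field_simps)
    moreover have "((5 / 36) * (1 - excess u)) * ((1 - excess v) / 6) * ((1 - excess w) / 6) * ((1 - H u w / D u) / 6)
        \<le> ((inv_deg u)\<^sup>2 * D u) * inv_deg v * inv_deg w * ((1 - H u w / D u) / 6)"
    proof (rule mult_right_mono, rule mult_mono, rule mult_mono)
      show "5 / 36 * (1 - excess u) \<le> (inv_deg u)\<^sup>2 * D u" using inv_deg_mult_ge[OF d] by (simp add: D_def)
      show "(1 - excess v) / 6 \<le> inv_deg v" "(1 - excess w) / 6 \<le> inv_deg w" using inv_deg_ge uvw by auto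
    qed (use excess_bounds D HD in \<open>auto simp: inv_deg_def D_def\<close>)
    moreover have "5 / 7776 * (1 - excess u - excess v - excess w - H u w / D u) \<le>
        ((5 / 36) * (1 - excess u)) * ((1 - excess v) / 6) * ((1 - excess w) / 6) * ((1 - H u w / D u) / 6)"
    proof -
      have "1 - excess u - excess v - excess w - H u w / D u \<le>
          (1 - excess u) * (1 - excess v) * (1 - excess w) * (1 - H u w / D u)"
        using D H0 HD by (intro prod4_ge_one_minus_sum excess_bounds) auto
      moreover have "5 / 36 * a * (b / 6) * (c / 6) * (d / 6) = 5 / 7776 * (a * b * c * d)" for a b c d :: real
        by simp
      ultimately show ?thesis by (metis mult_left_mono divide_nonneg_nonneg zero_le_numeral)
    qed
    ultimately show ?thesis by linarith
  qed

  define \<Sigma> where "\<Sigma> = (\<Sum>i\<in>I. real (deg i) * excess i)"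
  have s1: "(\<Sum>u\<in>I. \<Sum>v\<in>I. \<Sum>w\<in>I. t u v w * excess u) \<le> 2 * \<Sigma>"
  proof -
    have "(\<Sum>u\<in>I. \<Sum>v\<in>I. \<Sum>w\<in>I. t u v w * excess u) = (\<Sum>u\<in>I. \<Sum>w\<in>I. (\<Sum>v\<in>I. t u v w) * excess u)"
      unfolding sum_distrib_right by (intro sum.cong refl sum.swap)
    also have "\<dots> \<le> (\<Sum>u\<in>I. \<Sum>w\<in>I. (2 * A u w) * excess u)"
      using pair excess_bounds by (intro sum_mono mult_right_mono) auto
    also have "\<dots> = (\<Sum>u\<in>I. 2 * (\<Sum>w\<in>I. A u w) * excess u)"
      by (simp only: sum_distrib_left sum_distrib_right)
    also have "\<dots> = (\<Sum>i\<in>I. 2 * (deg i * excess i))"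
      by (intro sum.cong refl) (subst sum_A, auto)
    also have "\<dots> = 2 * \<Sigma>" by (simp add: \<Sigma>_def sum_distrib_left)
    finally show ?thesis .
  qed
  have s2: "(\<Sum>u\<in>I. \<Sum>v\<in>I. \<Sum>w\<in>I. t u v w * excess v) \<le> 2 * \<Sigma>"
  proof -
    have "(\<Sum>u\<in>I. \<Sum>v\<in>I. \<Sum>w\<in>I. t u v w * excess v) = (\<Sum>v\<in>I. \<Sum>u\<in>I. \<Sum>w\<in>I. t v u w * excess v)"
      by (subst sum.swap) (simp only: t_swap(1))
    then show ?thesis using s1 by simp
  qed
  have s3: "(\<Sum>u\<in>I. \<Sum>v\<in>I. \<Sum>w\<in>I. t u v w * excess w) \<le> 2 * \<Sigma>"
  proof -
    have "(\<Sum>u\<in>I. \<Sum>v\<in>I. \<Sum>w\<in>I. t u v w * excess w) = (\<Sum>u\<in>I. \<Sum>w\<in>I. \<Sum>v\<in>I. t u v w * excess w)"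
      by (intro sum.cong refl sum.swap)
    also have "\<dots> = (\<Sum>u\<in>I. \<Sum>w\<in>I. \<Sum>v\<in>I. t u w v * excess w)"
      by (intro sum.cong refl arg_cong2[where f = "(*)"] t_swap(2))
    finally show ?thesis using s2 by simp
  qed
  have s4: "(\<Sum>u\<in>I. \<Sum>v\<in>I. \<Sum>w\<in>I. t u v w * (H u w / D u)) \<le> 2 * \<Sigma>"
  proof -
    have "(\<Sum>v\<in>I. \<Sum>w\<in>I. t u v w * (H u w / D u)) \<le> (\<Sum>y\<in>I. 2 * (A u y * excess y))" if u: "u \<in> I" for u
    proof -
      have D0: "D u \<ge> 0" using deg_pos[of u] u by (auto simp: D_def)
      have "(\<Sum>v\<in>I. \<Sum>w\<in>I. t u v w * (H u w / D u)) = (\<Sum>w\<in>I. (\<Sum>v\<in>I. t u v w) * (H u w / D u))"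
        unfolding sum_distrib_right by (rule sum.swap)
      also have "\<dots> \<le> (\<Sum>w\<in>I. (2 * A u w) * (H u w / D u))"
        using D0 excess_bounds by (intro sum_mono mult_right_mono pair) (auto simp: H_def intro!: sum_nonneg divide_nonneg_nonneg)
      also have "\<dots> = (\<Sum>w\<in>I. \<Sum>y\<in>I. (2 * (A u y * excess y) / D u) * (of_bool (w \<noteq> y) * A u w))"
        unfolding H_def sum_divide_distrib sum_distrib_left
        by (intro sum.cong refl) auto
      also have "\<dots> = (\<Sum>y\<in>I. (2 * (A u y * excess y) / D u) * (\<Sum>w\<in>I. of_bool (w \<noteq> y) * A u w))"
        unfolding sum_distrib_left by (rule sum.swap)
      \<comment> \<open>For a fixed neighbour \<open>y\<close> of \<open>u\<close> there are
        \<open>D u\<close> choices of \<open>w\<close>, and this cancels the denominator.\<close>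
      also have "\<dots> \<le> (\<Sum>y\<in>I. 2 * (A u y * excess y))"
      proof (intro sum_mono)
        fix y
        show "(2 * (A u y * excess y) / D u) * (\<Sum>w\<in>I. of_bool (w \<noteq> y) * A u w) \<le> 2 * (A u y * excess y)"
        proof (cases "adj u y")
          case True
          then show ?thesis unfolding sumD[OF True] using excess_bounds[of y] by simp
        qed simp
      qed
      finally show ?thesis .
    qed
    then have "(\<Sum>u\<in>I. \<Sum>v\<in>I. \<Sum>w\<in>I. t u v w * (H u w / D u)) \<le> (\<Sum>u\<in>I. \<Sum>y\<in>I. 2 * (A u y * excess y))"
      by (rule sum_mono)
    also have "\<dots> = (\<Sum>y\<in>I. \<Sum>u\<in>I. 2 * (A u y * excess y))" by (rule sum.swap)
    also have "\<dots> = (\<Sum>y\<in>I. 2 * ((\<Sum>u\<in>I. A u y) * excess y))"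
      by (simp only: sum_distrib_left sum_distrib_right)
    also have "\<dots> = (\<Sum>i\<in>I. 2 * (deg i * excess i))"
      by (intro sum.cong refl) (subst sum_A', auto)
    also have "\<dots> = 2 * \<Sigma>" by (simp add: \<Sigma>_def sum_distrib_left)
    finally show ?thesis .
  qed

  have lower: "5 / 7776 * (6 * card TT - 8 * \<Sigma>) \<le> (\<Sum>u\<in>I. \<Sum>v\<in>I. \<Sum>w\<in>I. t u v w * W u v w)"
  proof -
    have "5 / 7776 * (6 * card TT - 8 * \<Sigma>) \<le> 5 / 7776 *
       ((\<Sum>u\<in>I. \<Sum>v\<in>I. \<Sum>w\<in>I. t u v w) - (\<Sum>u\<in>I. \<Sum>v\<in>I. \<Sum>w\<in>I. t u v w * excess u) -
        (\<Sum>u\<in>I. \<Sum>v\<in>I. \<Sum>w\<in>I. t u v w * excess v) - (\<Sum>u\<in>I. \<Sum>v\<in>I. \<Sum>w\<in>I. t u v w * excess w) -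
        (\<Sum>u\<in>I. \<Sum>v\<in>I. \<Sum>w\<in>I. t u v w * (H u w / D u)))"
    proof -
      have "5 / 7776 * (k - 8 * x) \<le> 5 / 7776 * (k - a - b - c - d)"
        if "a \<le> 2 * x" "b \<le> 2 * x" "c \<le> 2 * x" "d \<le> 2 * x" for a b c d k x :: real
        using that by simp
      from this[OF s1 s2 s3 s4] show ?thesis unfolding count .
    qed
    also have "\<dots> = (\<Sum>u\<in>I. \<Sum>v\<in>I. \<Sum>w\<in>I. t u v w * (5 / 7776 * (1 - excess u - excess v - excess w - H u w / D u)))"
      unfolding sum_subtractf[symmetric] sum_distrib_left
      by (intro sum.cong refl) (simp add: algebra_simps)
    also have "\<dots> \<le> (\<Sum>u\<in>I. \<Sum>v\<in>I. \<Sum>w\<in>I. t u v w * W u v w)"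
      using W_ge by (intro sum_mono) (auto simp: t_def)
    finally show ?thesis .
  qed

  \<comment> \<open>\<open>F\<close> selects the walks \<open>u, y, u, v, w\<close> around a triangle. Excluding \<open>y = w\<close> makes the five
    rotations disjoint, since the detour \<open>u, w\<close> at \<open>u\<close> is the detour \<open>w, u\<close> at \<open>w\<close>.\<close>
  define B where "B = I \<times> I \<times> I \<times> I \<times> I"
  define w5 where "w5 = (\<lambda>(a, b, c, d, e). step a b * step b c * step c d * step d e * step e a)"
  define F where "F = (\<lambda>(a, b, c, d, e). of_bool (a = c \<and> b \<noteq> e \<and> {c, d, e} \<in> TT) * w5 (a, b, c, d, e))"
  define rot where "rot = (\<lambda>(a :: nat, b :: nat, c :: nat, d :: nat, e :: nat). (b, c, d, e, a))"
  have w5_nonneg: "w5 z \<ge> 0" for z by (auto simp: w5_def step_nonneg split: prod.split)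
  have rot_sum: "(\<Sum>z\<in>B. G (rot z)) = (\<Sum>z\<in>B. G z)" for G :: "nat \<times> nat \<times> nat \<times> nat \<times> nat \<Rightarrow> real"
    by (rule sum.reindex_bij_witness[of _ "\<lambda>(a, b, c, d, e). (e, a, b, c, d)" rot])
       (auto simp: B_def rot_def)
  have rots: "F z + F (rot z) + F (rot (rot z)) + F (rot (rot (rot z))) + F (rot (rot (rot (rot z)))) \<le> w5 z" for z
  proof -
    obtain a b c d e where z: "z = (a, b, c, d, e)" by (cases z)
    have inv: "w5 (b, c, d, e, a) = w5 z" "w5 (c, d, e, a, b) = w5 z" "w5 (d, e, a, b, c) = w5 z" "w5 (e, a, b, c, d) = w5 z"
      by (simp_all add: w5_def z mult_ac)
    let ?P1 = "a = c \<and> b \<noteq> e \<and> {c, d, e} \<in> TT" and ?P2 = "b = d \<and> c \<noteq> a \<and> {d, e, a} \<in> TT"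
      and ?P3 = "c = e \<and> d \<noteq> b \<and> {e, a, b} \<in> TT" and ?P4 = "d = a \<and> e \<noteq> c \<and> {a, b, c} \<in> TT"
      and ?P5 = "e = b \<and> a \<noteq> d \<and> {b, c, d} \<in> TT"
    have excl: "?P1 \<Longrightarrow> \<not> ?P2 \<and> \<not> ?P3 \<and> \<not> ?P4 \<and> \<not> ?P5" "?P2 \<Longrightarrow> \<not> ?P3 \<and> \<not> ?P4 \<and> \<not> ?P5"
      "?P3 \<Longrightarrow> \<not> ?P4 \<and> \<not> ?P5" "?P4 \<Longrightarrow> \<not> ?P5"
      using distinct[of c d e] distinct[of d e a] distinct[of e a b] distinct[of a b c] by metis+
    have "of_bool (a = c \<and> b \<noteq> e \<and> {c, d, e} \<in> TT) + of_bool (b = d \<and> c \<noteq> a \<and> {d, e, a} \<in> TT) +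
        of_bool (c = e \<and> d \<noteq> b \<and> {e, a, b} \<in> TT) + of_bool (d = a \<and> e \<noteq> c \<and> {a, b, c} \<in> TT) +
        of_bool (e = b \<and> a \<noteq> d \<and> {b, c, d} \<in> TT) \<le> (1 :: real)" (is "?S \<le> 1")
      by (rule five_exclusive_of_bool_le_1[OF excl])
    then have "?S * w5 z \<le> 1 * w5 z" by (intro mult_right_mono w5_nonneg)
    then show ?thesis unfolding F_def rot_def z using inv by (simp add: z algebra_simps)
  qed
  have "5 * (\<Sum>z\<in>B. F z) = (\<Sum>z\<in>B. F z + F (rot z) + F (rot (rot z)) + F (rot (rot (rot z))) + F (rot (rot (rot (rot z)))))"
    unfolding sum.distrib using rot_sum[of F] rot_sum[of "\<lambda>z. F (rot z)"] rot_sum[of "\<lambda>z. F (rot (rot z))"]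
      rot_sum[of "\<lambda>z. F (rot (rot (rot z)))"] by simp
  also have "\<dots> \<le> (\<Sum>z\<in>B. w5 z)" by (intro sum_mono rots)
  also have "\<dots> = return_sum 5" unfolding return_sum_5 B_def w5_def ..
  finally have five: "5 * (\<Sum>z\<in>B. F z) \<le> return_sum 5" .
  have "(\<Sum>z\<in>B. F z) = (\<Sum>u\<in>I. \<Sum>v\<in>I. \<Sum>w\<in>I. t u v w * W u v w)"
  proof -
    have "(\<Sum>z\<in>B. F z) = (\<Sum>a\<in>I. \<Sum>b\<in>I. \<Sum>c\<in>I. \<Sum>d\<in>I. \<Sum>e\<in>I. F (a, b, c, d, e))"
      by (simp add: B_def sum.cartesian_product case_prod_unfold)
    also have "\<dots> = (\<Sum>a\<in>I. \<Sum>b\<in>I. \<Sum>c\<in>I. if c = a then (\<Sum>d\<in>I. \<Sum>e\<in>I. F (a, b, a, d, e)) else 0)"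
      by (intro sum.cong refl) (auto simp: F_def)
    also have "\<dots> = (\<Sum>a\<in>I. \<Sum>b\<in>I. \<Sum>d\<in>I. \<Sum>e\<in>I. F (a, b, a, d, e))" by simp
    also have "\<dots> = (\<Sum>a\<in>I. \<Sum>d\<in>I. \<Sum>b\<in>I. \<Sum>e\<in>I. F (a, b, a, d, e))"
      by (intro sum.cong refl sum.swap)
    also have "\<dots> = (\<Sum>a\<in>I. \<Sum>d\<in>I. \<Sum>e\<in>I. \<Sum>b\<in>I. F (a, b, a, d, e))"
      by (intro sum.cong refl sum.swap)
    also have "\<dots> = (\<Sum>u\<in>I. \<Sum>v\<in>I. \<Sum>w\<in>I. t u v w * W u v w)"
      unfolding W_def sum_distrib_left
      by (intro sum.cong refl) (auto simp: F_def w5_def t_def)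
    finally show ?thesis .
  qed
  then have "25 / 7776 * (6 * card TT - 8 * \<Sigma>) \<le> return_sum 5" using five lower by linarith
  moreover have "\<Sigma> = (\<Sum>i\<in>I. max 0 (real (deg i) - 6))"
    unfolding \<Sigma>_def by (intro sum.cong refl deg_excess) auto
  ultimately show ?thesis by simp
qed

end

section \<open>Numerical estimates\<close>

text \<open>Four terms of the series of \<open>ln x = 2 * artanh y\<close>, with a geometric bound
  for the tail. It converges fast near 1, so most constants below are first factored into such
  quotients and powers of 2.\<close>

lemma ln_bounds_atanh:
  fixes x :: real
  assumes "x > 1"
  defines "y \<equiv> (x - 1) / (x + 1)"
  shows "2 * y + 2 * y ^ 3 / 3 + 2 * y ^ 5 / 5 + 2 * y ^ 7 / 7 \<le> ln x"
    and "ln x \<le> 2 * y + 2 * y ^ 3 / 3 + 2 * y ^ 5 / 5 + 2 * y ^ 7 / 7 + 2 * y ^ 9 / (9 * (1 - y ^ 2))"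
proof -
  have "(\<Sum>k<4. 2 * y ^ (2 * k + 1) / real (2 * k + 1)) = 2 * y + 2 * y ^ 3 / 3 + 2 * y ^ 5 / 5 + 2 * y ^ 7 / 7"
    by (simp add: lessThan_nat_numeral lessThan_Suc eval_nat_numeral)
  moreover have "ln x \<in> {(\<Sum>k<4. 2 * y ^ (2 * k + 1) / real (2 * k + 1)) ..
      (\<Sum>k<4. 2 * y ^ (2 * k + 1) / real (2 * k + 1)) + 2 * (y ^ (2 * 4 + 1) / (1 - y ^ 2) / real (2 * 4 + 1))}"
    using ln_approx_bounds[of x 4] assms(1) unfolding y_def by simp
  ultimately show "2 * y + 2 * y ^ 3 / 3 + 2 * y ^ 5 / 5 + 2 * y ^ 7 / 7 \<le> ln x"
    "ln x \<le> 2 * y + 2 * y ^ 3 / 3 + 2 * y ^ 5 / 5 + 2 * y ^ 7 / 7 + 2 * y ^ 9 / (9 * (1 - y ^ 2))"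
    by (auto simp: mult.commute)
qed

lemma ln2_bounds: "0.69313 \<le> ln (2::real)" "ln (2::real) \<le> 0.69316"
  using ln_bounds_atanh[of 2] by (simp_all add: field_simps power_divide)

lemma ln3_bounds: "ln (3::real) \<le> 1.09864"
proof -
  have "ln (3 / 2 :: real) \<le> 0.40547" using ln_bounds_atanh(2)[of "3 / 2"] by (simp add: field_simps power_divide)
  then show ?thesis using ln2_bounds by (simp add: ln_div)
qed

lemma ln5_bounds: "1.6094 \<le> ln (5::real)" "ln (5::real) \<le> 1.60947"
proof -
  have "0.22314 \<le> ln (5 / 4 :: real)" "ln (5 / 4 :: real) \<le> 0.22315"
    using ln_bounds_atanh[of "5 / 4"] by (simp_all add: field_simps power_divide)
  moreover have "ln (4::real) = 2 * ln 2" using ln_realpow[of 2 2] by simp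
  ultimately show "1.6094 \<le> ln (5::real)" "ln (5::real) \<le> 1.60947"
    using ln2_bounds by (simp_all add: ln_div)
qed

lemma ln7_bounds: "ln (7::real) \<le> 1.94595"
proof -
  have "0.13353 \<le> ln (8 / 7 :: real)"
    using ln_bounds_atanh(1)[of "8 / 7"] by (simp add: field_simps power_divide)
  moreover have "ln (8::real) = 3 * ln 2" using ln_realpow[of 2 3] by simp
  ultimately show ?thesis using ln2_bounds by (simp add: ln_div)
qed

lemma ln_target_planar: "1.6648 \<le> ln (5.28515::real)"
proof -
  have "0.2786 \<le> ln (1.3212875 :: real)"
    using ln_bounds_atanh(1)[of "1.3212875"] by (simp add: field_simps power_divide)
  moreover have "ln (5.28515::real) = 2 * ln 2 + ln 1.3212875"
    using ln_realpow[of 2 2] ln_mult[of "4::real" "1.3212875"] by simp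
  ultimately show ?thesis using ln2_bounds by simp
qed

lemma ln_target_girth4: "1.2284 \<le> ln (3.41619::real)"
proof -
  have "0.5353 \<le> ln (1.708095 :: real)"
    using ln_bounds_atanh(1)[of "1.708095"] by (simp add: field_simps power_divide)
  moreover have "ln (3.41619::real) = ln 2 + ln 1.708095"
    using ln_mult[of "2::real" "1.708095"] by simp
  ultimately show ?thesis using ln2_bounds by simp
qed

lemma ln_target_girth5: "0.999 \<le> ln (2.71567::real)"
proof -
  have "0.30588 \<le> ln (1.357835 :: real)"
    using ln_bounds_atanh(1)[of "1.357835"] by (simp add: field_simps power_divide)
  moreover have "ln (2.71567::real) = ln 2 + ln 1.357835"
    using ln_mult[of "2::real" "1.357835"] by simp
  ultimately show ?thesis using ln2_bounds by simp
qed

section \<open>Polynomials above the logarithm\<close>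

lemma mult_five_divide: "q * (k * a * b * c * d * e / m) = k * (q * (a * b * c * d * e)) / (m::real)"
  by (simp add: mult_ac)

lemma value_at_sign_change_le:
  fixes f f' :: "real \<Rightarrow> real"
  assumes der: "\<And>y. y < 1 \<Longrightarrow> (f has_real_derivative f' y) (at y)" and "x < 1" "r < 1"
    and sgn: "\<And>y. min x r \<le> y \<Longrightarrow> y \<le> max x r \<Longrightarrow> (y - r) * f' y \<ge> 0"
  shows "f r \<le> f x"
proof (cases x r rule: linorder_cases)
  case less
  then obtain z where z: "x < z" "z < r" "f r - f x = (r - x) * f' z"
    using MVT2[of x r f f'] der assms by (meson le_less_trans)
  then have "f' z \<le> 0" using sgn[of z] less by (simp add: zero_le_mult_iff)
  then have "(r - x) * f' z \<le> 0" using less by (intro mult_nonneg_nonpos) auto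
  then show ?thesis using z by linarith
next
  case greater
  then obtain z where z: "r < z" "z < x" "f x - f r = (x - r) * f' z"
    using MVT2[of r x f f'] der assms by (meson le_less_trans)
  then have "f' z \<ge> 0" using sgn[of z] greater by (simp add: zero_le_mult_iff)
  then have "(x - r) * f' z \<ge> 0" using greater by (intro mult_nonneg_nonneg) auto
  then show ?thesis using z by linarith
qed simp

text \<open>
  Both polynomials below are built so that the derivative of the difference with \<open>ln (1 - x)\<close>,
  multiplied by \<open>1 - x\<close>, splits into rational linear factors; its zeros approximate the nodes of
  the optimal three-point quadrature for the spectral measure of the extremal lattice.
\<close>

lemma ln_one_minus_le_triangular:
  fixes x :: real
  assumes "x < 1"
  shows "ln (1 - x) \<le> 0.0021 - 5182/5083 * x - 200/391 * x ^ 2 - 64000/45747 * x ^ 5"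
proof -
  define f where "f = (\<lambda>x::real. 0.0021 - 5182/5083 * x - 200/391 * x ^ 2 - 64000/45747 * x ^ 5 - ln (1 - x))"
  define f' where "f' = (\<lambda>y::real. 320000/45747 * (y + 0.3) * (y + 0.15) * (y - 0.15) * (y - 0.55) * (y - 0.75) / (1 - y))"
  have der: "(f has_real_derivative f' y) (at y)" if "y < 1" for y
  proof -
    have "320000/45747 * (y + 0.3) * (y + 0.15) * (y - 0.15) * (y - 0.55) * (y - 0.75) =
        1 - (1 - y) * (5182/5083 + 400/391 * y + 320000/45747 * y ^ 4)"
      by (simp add: field_simps eval_nat_numeral)
    moreover have "(1 - (1 - y) * k) / (1 - y) = 1 / (1 - y) - k" for k
      using that by (simp add: diff_divide_distrib)
    ultimately have "f' y = - (5182/5083) - 400/391 * y - 320000/45747 * y ^ 4 + 1 / (1 - y)"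
      by (simp only: f'_def)
    moreover have "(f has_real_derivative - (5182/5083) - 400/391 * y - 320000/45747 * y ^ 4 + 1 / (1 - y)) (at y)"
    proof -
      have "((\<lambda>x. ln (1 - x)) has_real_derivative - (1 / (1 - y))) (at y)"
        using that by (auto intro!: derivative_eq_intros)
      moreover have "((\<lambda>x. 0.0021 - 5182/5083 * x - 200/391 * x ^ 2 - 64000/45747 * x ^ 5) has_real_derivative - (5182/5083) - 400/391 * y - 320000/45747 * y ^ 4) (at y)"
        by (auto intro!: derivative_eq_intros)
      ultimately show ?thesis unfolding f_def using DERIV_diff by fastforce
    qed
    ultimately show ?thesis by simp
  qed
  \<comment> \<open>Of the zeros of \<open>f'\<close>, -0.3, 0.15 and 0.75 are the local minima of
    \<open>f\<close>. The constant 0.0021 is dictated by 0.15, where \<open>f\<close> stays below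
    0.0001.\<close>
  have f1: "f (-0.3) \<ge> 0"
  proof -
    have "ln (1.3 :: real) \<le> 0.26237" using ln_bounds_atanh(2)[of "1.3"] by (simp add: field_simps power_divide)
    then show ?thesis by (simp add: f_def power_divide)
  qed
  have f2: "f 0.15 \<ge> 0"
  proof -
    have "0.16251 \<le> ln (20 / 17 :: real)" using ln_bounds_atanh(1)[of "20 / 17"] by (simp add: field_simps power_divide)
    moreover have "ln (1 - 0.15 :: real) = - ln (20 / 17)" using ln_inverse[of "20 / 17 :: real"] by simp
    ultimately show ?thesis by (simp add: f_def power_divide)
  qed
  have f3: "f 0.75 \<ge> 0"
  proof -
    have "ln (1 - 0.75 :: real) = - (2 * ln 2)" using ln_inverse[of "4 :: real"] ln_realpow[of 2 2] by simp
    then show ?thesis using ln2_bounds by (simp add: f_def power_divide)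
  qed
  have mono: "f r \<le> f x" if "r < 1" "\<And>y. min x r \<le> y \<Longrightarrow> y \<le> max x r \<Longrightarrow>
      0 \<le> (y - r) * ((y + 0.3) * (y + 0.15) * (y - 0.15) * (y - 0.55) * (y - 0.75))" for r
  proof (rule value_at_sign_change_le[OF der assms that(1)])
    fix y assume y: "min x r \<le> y" "y \<le> max x r"
    have "(y - r) * f' y = 320000/45747 * ((y - r) * ((y + 0.3) * (y + 0.15) * (y - 0.15) * (y - 0.55) * (y - 0.75))) / (1 - y)"
      unfolding f'_def by (rule mult_five_divide)
    then show "0 \<le> (y - r) * f' y" using that(2)[OF y] that(1) y assms by simp
  qed
  have "f x \<ge> 0"
  proof -
    \<comment> \<open>The cuts are the local maxima of \<open>f\<close>; on each piece
      \<open>f\<close> is smallest at the local minimum inside it.\<close>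
    consider "x \<le> -0.15" | "-0.15 \<le> x" "x \<le> 0.55" | "0.55 \<le> x" by linarith
    then show ?thesis
    proof cases
      case 1
      have "f (-0.3) \<le> f x"
      proof (rule mono)
        fix y :: real assume "y \<le> max x (-0.3)"
        then have "y \<le> -0.15" using 1 by auto
        then have "0 \<le> (y + 0.3)\<^sup>2 * (((y + 0.15) * (y - 0.15)) * ((y - 0.55) * (y - 0.75)))"
          by (intro mult_nonneg_nonneg mult_nonpos_nonpos zero_le_power2) auto
        then show "0 \<le> (y - - 0.3) * ((y + 0.3) * (y + 0.15) * (y - 0.15) * (y - 0.55) * (y - 0.75))"
          by (simp add: power2_eq_square mult_ac)
      qed simp
      then show ?thesis using f1 by linarith
    next
      case 2
      have "f 0.15 \<le> f x"
      proof (rule mono)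
        fix y :: real assume "min x 0.15 \<le> y" "y \<le> max x 0.15"
        then have "-0.15 \<le> y" "y \<le> 0.55" using 2 by auto
        then have "0 \<le> (y - 0.15)\<^sup>2 * (((y + 0.15) * (y + 0.3)) * ((y - 0.55) * (y - 0.75)))"
          by (intro mult_nonneg_nonneg mult_nonpos_nonpos[of "y - 0.55"] zero_le_power2) auto
        then show "0 \<le> (y - 0.15) * ((y + 0.3) * (y + 0.15) * (y - 0.15) * (y - 0.55) * (y - 0.75))"
          by (simp add: power2_eq_square mult_ac)
      qed simp
      then show ?thesis using f2 by linarith
    next
      case 3
      have "f 0.75 \<le> f x"
      proof (rule mono)
        fix y :: real assume "min x 0.75 \<le> y" "y \<le> max x 0.75"
        then have "0.55 \<le> y" using 3 by auto
        then have "0 \<le> (y - 0.75)\<^sup>2 * (((y + 0.15) * (y + 0.3)) * ((y - 0.15) * (y - 0.55)))"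
          by (intro mult_nonneg_nonneg zero_le_power2) auto
        then show "0 \<le> (y - 0.75) * ((y + 0.3) * (y + 0.15) * (y - 0.15) * (y - 0.55) * (y - 0.75))"
          by (simp add: power2_eq_square mult_ac)
      qed simp
      then show ?thesis using f3 by linarith
    qed
  qed
  then show ?thesis by (simp add: f_def)
qed

lemma ln_one_minus_le_quadrangular:
  fixes x :: real
  assumes "x < 1"
  shows "ln (1 - x) \<le> - x - 215/528 * x ^ 2 - 775/3564 * x ^ 3 - 500/891 * x ^ 4 - 500/891 * x ^ 5"
proof -
  define f where "f = (\<lambda>x::real. - x - 215/528 * x ^ 2 - 775/3564 * x ^ 3 - 500/891 * x ^ 4 - 500/891 * x ^ 5 - ln (1 - x))"
  define f' where "f' = (\<lambda>y::real. 2500/891 * (y + 0.6) * (y + 0.35) * y * (y - 0.45) * (y - 0.7) / (1 - y))"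
  have der: "(f has_real_derivative f' y) (at y)" if "y < 1" for y
  proof -
    have "2500/891 * (y + 0.6) * (y + 0.35) * y * (y - 0.45) * (y - 0.7) =
        1 - (1 - y) * (1 + 215/264 * y + 775/1188 * y ^ 2 + 2000/891 * y ^ 3 + 2500/891 * y ^ 4)"
      by (simp add: field_simps eval_nat_numeral)
    moreover have "(1 - (1 - y) * k) / (1 - y) = 1 / (1 - y) - k" for k
      using that by (simp add: diff_divide_distrib)
    ultimately have "f' y = - 1 - 215/264 * y - 775/1188 * y ^ 2 - 2000/891 * y ^ 3 - 2500/891 * y ^ 4 + 1 / (1 - y)"
      by (simp only: f'_def)
    moreover have "(f has_real_derivative - 1 - 215/264 * y - 775/1188 * y ^ 2 - 2000/891 * y ^ 3 - 2500/891 * y ^ 4 + 1 / (1 - y)) (at y)"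
    proof -
      have "((\<lambda>x. ln (1 - x)) has_real_derivative - (1 / (1 - y))) (at y)"
        using that by (auto intro!: derivative_eq_intros)
      moreover have "((\<lambda>x. - x - 215/528 * x ^ 2 - 775/3564 * x ^ 3 - 500/891 * x ^ 4 - 500/891 * x ^ 5) has_real_derivative - 1 - 215/264 * y - 775/1188 * y ^ 2 - 2000/891 * y ^ 3 - 2500/891 * y ^ 4) (at y)"
        by (auto intro!: derivative_eq_intros)
      ultimately show ?thesis unfolding f_def using DERIV_diff by fastforce
    qed
    ultimately show ?thesis by simp
  qed
  have f1: "f (-0.6) \<ge> 0"
  proof -
    have "ln (1.6 :: real) = 3 * ln 2 - ln 5" using ln_realpow[of 2 3] ln_div[of "8::real" 5] by simp
    then have "ln (1.6 :: real) \<le> 0.4701" using ln2_bounds ln5_bounds by simp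
    then show ?thesis by (simp add: f_def power_divide)
  qed
  \<comment> \<open>Here 0 is itself a local minimum, with value 0, so the polynomial has no
    constant term and its linear coefficient is -1. The other local minima are -0.6 and 0.7.\<close>
  have f2: "f 0 \<ge> 0" by (simp add: f_def)
  have f3: "f 0.7 \<ge> 0"
  proof -
    have "ln (0.3 :: real) = ln 3 - (ln 2 + ln 5)" using ln_div[of "3::real" 10] ln_mult[of "2::real" 5] by simp
    then show ?thesis using ln2_bounds ln5_bounds ln3_bounds by (simp add: f_def power_divide)
  qed
  have mono: "f r \<le> f x" if "r < 1" "\<And>y. min x r \<le> y \<Longrightarrow> y \<le> max x r \<Longrightarrow>
      0 \<le> (y - r) * ((y + 0.6) * (y + 0.35) * y * (y - 0.45) * (y - 0.7))" for r
  proof (rule value_at_sign_change_le[OF der assms that(1)])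
    fix y assume y: "min x r \<le> y" "y \<le> max x r"
    have "(y - r) * f' y = 2500/891 * ((y - r) * ((y + 0.6) * (y + 0.35) * y * (y - 0.45) * (y - 0.7))) / (1 - y)"
      unfolding f'_def by (rule mult_five_divide)
    then show "0 \<le> (y - r) * f' y" using that(2)[OF y] that(1) y assms by simp
  qed
  have "f x \<ge> 0"
  proof -
    \<comment> \<open>Again the cuts are the local maxima of \<open>f\<close>.\<close>
    consider "x \<le> -0.35" | "-0.35 \<le> x" "x \<le> 0.45" | "0.45 \<le> x" by linarith
    then show ?thesis
    proof cases
      case 1
      have "f (-0.6) \<le> f x"
      proof (rule mono)
        fix y :: real assume "y \<le> max x (-0.6)"
        then have "y \<le> -0.35" using 1 by auto
        then have "0 \<le> (y + 0.6)\<^sup>2 * (((y + 0.35) * y) * ((y - 0.45) * (y - 0.7)))"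
          by (intro mult_nonneg_nonneg mult_nonpos_nonpos zero_le_power2) auto
        then show "0 \<le> (y - - 0.6) * ((y + 0.6) * (y + 0.35) * y * (y - 0.45) * (y - 0.7))"
          by (simp add: power2_eq_square mult_ac)
      qed simp
      then show ?thesis using f1 by linarith
    next
      case 2
      have "f 0 \<le> f x"
      proof (rule mono)
        fix y :: real assume "min x 0 \<le> y" "y \<le> max x 0"
        then have "-0.35 \<le> y" "y \<le> 0.45" using 2 by auto
        then have "0 \<le> y\<^sup>2 * (((y + 0.35) * (y + 0.6)) * ((y - 0.45) * (y - 0.7)))"
          by (intro mult_nonneg_nonneg mult_nonpos_nonpos[of "y - 0.45"] zero_le_power2) auto
        then show "0 \<le> (y - 0) * ((y + 0.6) * (y + 0.35) * y * (y - 0.45) * (y - 0.7))"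
          by (simp add: power2_eq_square mult_ac)
      qed simp
      then show ?thesis using f2 by linarith
    next
      case 3
      have "f 0.7 \<le> f x"
      proof (rule mono)
        fix y :: real assume "min x 0.7 \<le> y" "y \<le> max x 0.7"
        then have "0.45 \<le> y" using 3 by auto
        then have "0 \<le> (y - 0.7)\<^sup>2 * (((y + 0.35) * (y + 0.6)) * (y * (y - 0.45)))"
          by (intro mult_nonneg_nonneg zero_le_power2) auto
        then show "0 \<le> (y - 0.7) * ((y + 0.6) * (y + 0.35) * y * (y - 0.45) * (y - 0.7))"
          by (simp add: power2_eq_square mult_ac)
      qed simp
      then show ?thesis using f3 by linarith
    qed
  qed
  then show ?thesis by (simp add: f_def)
qed

section \<open>Estimates at a single vertex\<close>

lemma ln_le_tangent: "0 < x \<Longrightarrow> 0 < c \<Longrightarrow> ln x \<le> ln c + (x - c) / (c::real)"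
  using ln_le_minus_one[of "x / c"] by (simp add: ln_div diff_divide_distrib)

lemma ln6_bounds: "ln (6::real) \<le> 1.7918"
  using ln2_bounds ln3_bounds ln_mult[of "2::real" 3] by simp

text \<open>0.173 is the multiplier for mean degree at most 6; with this slope the two largest
  values, at degrees 5 and 7, nearly agree. 0.511 and 1.398 are the quadratic and quintic
  coefficients rounded down. \<open>6 * (real d - 4)\<close> is the share of one vertex in six times
  the number of facial triangles.\<close>

lemma vertex_bound_planar:
  fixes d :: nat
  assumes "d \<ge> 1"
  shows "ln d + 0.0022 - 0.511 * (2/3 - d/18 - 1/d) - 1.398 * (25/7776) * (6 * (real d - 4) - 8 * max 0 (real d - 6))
    - 0.173 * (real d - 6) \<le> 1.6648"
proof (cases "d \<ge> 8")
  case True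
  then have x: "real d \<ge> 8" by simp
  have l8: "ln (8::real) = 3 * ln 2" using ln_realpow[of 2 3] by simp
  \<comment> \<open>With the tangent at 8 the linear terms have negative total slope, so the value
    at 8 decides. The tangent at 7 would be too steep.\<close>
  have "ln (real d) \<le> 3 * ln 2 + (real d - 8) / 8" using ln_le_tangent[of "real d" 8] x l8 by simp
  moreover have "1 / real d \<le> 1 / 8" using x by (intro divide_left_mono) auto
  moreover have "max 0 (real d - 6) = real d - 6" using x by simp
  moreover have "l + 0.0022 - 0.511 * (2/3 - x/18 - u) - 1.398 * (25/7776) * (6 * (x - 4) - 8 * (x - 6))
      - 0.173 * (x - 6) \<le> 1.6648"
    if "l \<le> 3 * L + (x - 8) / 8" "u \<le> 1/8" "x \<ge> 8" "L \<le> 0.69316" for l u x L :: real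
    using that by (simp add: field_simps)
  ultimately show ?thesis using x ln2_bounds(2) by presburger
next
  case False
  have l4: "ln (4::real) = 2 * ln 2" using ln_realpow[of 2 2] by simp
  have "d = 1 \<or> d = 2 \<or> d = 3 \<or> d = 4 \<or> d = 5 \<or> d = 6 \<or> d = 7" using assms False by linarith
  then show ?thesis
    using ln2_bounds ln3_bounds ln5_bounds ln6_bounds ln7_bounds l4 by (elim disjE) simp_all
qed

text \<open>The case \<open>a = 1/4\<close> of the estimate with walks of length four:
  \<open>0.968 = 0.4071 + 0.5609\<close> and \<open>1/8 = 2 * (1/4)^2\<close>. The multiplier 0.316,
  for mean degree at most 4, makes the two largest values, at degrees 3 and 4, nearly equal.\<close>

lemma vertex_bound_girth4:
  fixes d :: nat
  assumes "d \<ge> 3"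
  shows "ln d + 0.0001 - 0.968 * (1 - d/8 - 1/d) + 0.5609 * (1/8 + 1 / real d ^ 3) - 0.316 * (real d - 4) \<le> 1.2284"
proof (cases "d \<ge> 5")
  case True
  then have x: "real d \<ge> 5" by simp
  \<comment> \<open>The tangent at 5 would have slope 1/5, and together with the slope 0.121 of the
    second term this exceeds 0.316. The tangent at 6 makes the total slope negative.\<close>
  have "ln (real d) \<le> ln 6 + (real d - 6) / 6" using ln_le_tangent[of "real d" 6] x by simp
  moreover have "1 / real d \<le> 1 / 5" using x by (intro divide_left_mono) auto
  moreover have "1 / real d ^ 3 \<le> 1 / 125"
    using power_mono[of 5 "real d" 3] x by (intro divide_left_mono) auto
  moreover have "l + 0.0001 - 0.968 * (1 - x/8 - u) + 0.5609 * (1/8 + w) - 0.316 * (x - 4) \<le> 1.2284"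
    if "l \<le> L + (x - 6) / 6" "u \<le> 1/5" "w \<le> 1/125" "x \<ge> 5" "L \<le> 1.7918" for l u w x L :: real
    using that by (simp add: field_simps)
  ultimately show ?thesis using x ln6_bounds by presburger
next
  case False
  have l4: "ln (4::real) = 2 * ln 2" using ln_realpow[of 2 2] by simp
  have "d = 3 \<or> d = 4" using assms False by linarith
  then show ?thesis using ln2_bounds ln3_bounds l4 by (elim disjE) simp_all
qed

text \<open>The case \<open>a = 0.3\<close>, the reciprocal of 10/3:
  \<open>1.08018 = 0.4071 + 1.2 * 0.5609\<close> and \<open>0.18 = 2 * 0.3^2\<close>. The multiplier
  0.38 again balances degrees 3 and 4, and again the tangent at 5 would be too steep.\<close>

lemma vertex_bound_girth5:
  fixes d :: nat
  assumes "d \<ge> 3"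
  shows "ln d + 0.0001 - 1.08018 * (1.2 - 0.18 * d - 1/d) + 0.5609 * (0.18 + 1 / real d ^ 3) - 0.38 * (real d - 10/3) \<le> 0.999"
proof (cases "d \<ge> 5")
  case True
  then have x: "real d \<ge> 5" by simp
  have "ln (real d) \<le> ln 6 + (real d - 6) / 6" using ln_le_tangent[of "real d" 6] x by simp
  moreover have "1 / real d \<le> 1 / 5" using x by (intro divide_left_mono) auto
  moreover have "1 / real d ^ 3 \<le> 1 / 125"
    using power_mono[of 5 "real d" 3] x by (intro divide_left_mono) auto
  moreover have "l + 0.0001 - 1.08018 * (1.2 - 0.18 * x - u) + 0.5609 * (0.18 + w) - 0.38 * (x - 10/3) \<le> 0.999"
    if "l \<le> L + (x - 6) / 6" "u \<le> 1/5" "w \<le> 1/125" "x \<ge> 5" "L \<le> 1.7918" for l u w x L :: real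
    using that by (simp add: field_simps)
  ultimately show ?thesis using x ln6_bounds by presburger
next
  case False
  have l4: "ln (4::real) = 2 * ln 2" using ln_realpow[of 2 2] by simp
  have "d = 3 \<or> d = 4" using assms False by linarith
  then show ?thesis using ln2_bounds ln3_bounds l4 by (elim disjE) simp_all
qed

section \<open>Determinant bounds\<close>

lemma exp_le_power:
  fixes b L :: real
  assumes "0 < b" "L \<le> ln b"
  shows "exp (L * real n) \<le> b ^ n"
proof -
  have "exp (L * real n) \<le> exp (ln b * real n)" using assms by (simp add: mult_right_mono)
  also have "\<dots> = b ^ n" using assms(1) exp_of_nat_mult[of n "ln b"] by (simp add: mult.commute)
  finally show ?thesis .
qed

text \<open>Taking out the factor 1.0001 moves the eigenvalue 1 into the range where the polynomial
  bounds for \<open>ln (1 - x)\<close> are valid.\<close>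

lemma ln_shift: "\<bar>x\<bar> \<le> 1 \<Longrightarrow> ln (1.0001 - x) \<le> 0.0001 + ln (1 - x / (1.0001::real))"
proof -
  assume x: "\<bar>x\<bar> \<le> 1"
  have "ln (1.0001 - x) = ln (1.0001 * (1 - x / (1.0001::real)))" by (simp add: algebra_simps)
  also have "\<dots> = ln (1.0001::real) + ln (1 - x / 1.0001)"
  proof -
    have "1 - x / (1.0001::real) > 0" using x by (simp add: field_simps)
    then show ?thesis by (intro ln_mult_pos) auto
  qed
  also have "ln (1.0001::real) \<le> 0.0001" using ln_add_one_self_le_self[of "0.0001::real"] by simp
  finally show ?thesis by simp
qed

context indexed_graph
begin

lemma sum_linear_deg:
  fixes b k m :: real
  shows "(\<Sum>i\<in>I. b + k * (real (deg i) - m)) = b * n + k * (real (\<Sum>i\<in>I. deg i) - m * n)"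
  by (simp add: sum.distrib sum_distrib_left[symmetric] sum_subtractf mult.commute)

lemma det_shifted_laplacian_le_planar:
  assumes fin: "finite TT" and tri: "\<And>t. t \<in> TT \<Longrightarrow> card t = 3"
    and tadj: "\<And>t u v. t \<in> TT \<Longrightarrow> u \<in> t \<Longrightarrow> v \<in> t \<Longrightarrow> u \<noteq> v \<Longrightarrow> adj u v"
    and two: "\<And>u v. adj u v \<Longrightarrow> card {t \<in> TT. {u, v} \<subseteq> t} \<le> 2"
    and many: "(\<Sum>i\<in>I. deg i) \<le> card TT + 4 * n" and edges: "(\<Sum>i\<in>I. deg i) \<le> 6 * n"
  shows "det (shifted_laplacian 1.0001) \<le> 5.28515 ^ n"
proof -
  \<comment> \<open>0.0022 is 0.0021 plus the 0.0001 of \<open>ln_shift\<close>; the powers of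
    1.0001 come from substituting \<open>x / 1.0001\<close>.\<close>
  define c :: "nat \<Rightarrow> real" where
    "c k = [0.0022, 5182/5083/1.0001, 200/391/1.0001^2, 0, 0, 64000/45747/1.0001^5] ! k" for k
  have c: "c 0 = 0.0022" "c 1 = 5182/5083/1.0001" "c 2 = 200/391/1.0001^2" "c 3 = 0" "c 4 = 0"
      "c 5 = 64000/45747/1.0001^5"
    unfolding c_def by (simp_all add: numeral_eq_Suc)
  have "det (shifted_laplacian 1.0001) \<le> exp ((\<Sum>i\<in>I. ln (deg i)) + c 0 * n -
    c 1 * return_sum 1 - c 2 * return_sum 2 - c 3 * return_sum 3 - c 4 * return_sum 4 - c 5 * return_sum 5)"
  proof (rule det_shifted_laplacian_le)
    fix x :: real assume x: "\<bar>x\<bar> \<le> 1"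
    have "ln (1.0001 - x) \<le> 0.0001 + (0.0021 - 5182/5083 * (x / 1.0001) - 200/391 * (x / 1.0001) ^ 2 - 64000/45747 * (x / 1.0001) ^ 5)"
      using ln_shift[OF x] ln_one_minus_le_triangular[of "x / 1.0001"] x by fastforce
    also have "\<dots> = c 0 - c 1 * x - c 2 * x ^ 2 - c 3 * x ^ 3 - c 4 * x ^ 4 - c 5 * x ^ 5"
      unfolding c by (simp add: power_divide)
    finally show "ln (1.0001 - x) \<le> c 0 - c 1 * x - c 2 * x ^ 2 - c 3 * x ^ 3 - c 4 * x ^ 4 - c 5 * x ^ 5" .
  qed simp
  also have "\<dots> \<le> exp (1.6648 * real n)"
  proof -
    \<comment> \<open>Rounding down is safe, since these coefficients multiply nonnegative traces
      that are subtracted.\<close>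
    have c2: "c 2 \<ge> 0.511" and c5: "c 5 \<ge> 1.398" unfolding c by (simp_all add: power_divide)
    have r2: "(\<Sum>i\<in>I. 2/3 - deg i / 18 - 1 / deg i) \<le> return_sum 2"
      using return_sum_2_ge[of "1/6"] by (simp add: power2_eq_square)
    have r5: "25 / 7776 * ((\<Sum>i\<in>I. 6 * (real (deg i) - 4)) - 8 * (\<Sum>i\<in>I. max 0 (real (deg i) - 6))) \<le> return_sum 5"
    proof -
      have "real (\<Sum>i\<in>I. deg i) \<le> real (card TT + 4 * n)" using many by (rule of_nat_mono)
      then have "(\<Sum>i\<in>I. 6 * (real (deg i) - 4)) \<le> 6 * card TT"
        by (simp add: sum_distrib_left[symmetric] sum_subtractf)
      moreover have "25 / 7776 * (6 * card TT - 8 * (\<Sum>i\<in>I. max 0 (real (deg i) - 6))) \<le> return_sum 5"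
      proof (rule return_sum_5_ge)
        show "finite TT" by (rule fin)
        show "card t = 3" if "t \<in> TT" for t using that by (rule tri)
        show "adj u v" if "t \<in> TT" "u \<in> t" "v \<in> t" "u \<noteq> v" for t u v using that by (rule tadj)
        show "card {t \<in> TT. {u, v} \<subseteq> t} \<le> 2" if "adj u v" for u v using that by (rule two)
      qed
      moreover have "25 / 7776 * (x - 8 * z) \<le> 25 / 7776 * (y - 8 * z)" if "x \<le> y" for x y z :: real
        using that by simp
      ultimately show ?thesis by (meson order_trans)
    qed
    have combine: "g - x1 - x2 - x3 - x4 - x5 \<le> g - 0.511 * s - 1.398 * w"
      if "0.511 * r2 \<le> x2" "1.398 * r5 \<le> x5" "x1 = 0" "x3 = 0" "x4 = 0" "s \<le> r2" "w \<le> r5"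
      for g x1 x2 x3 x4 x5 s w r2 r5 :: real using that by (simp add: field_simps)
    have z: "c 1 * return_sum 1 = 0" "c 3 * return_sum 3 = 0" "c 4 * return_sum 4 = 0"
      using return_sum_1 c by simp_all
    have "(\<Sum>i\<in>I. ln (deg i)) + c 0 * n - c 1 * return_sum 1 - c 2 * return_sum 2 - c 3 * return_sum 3 -
        c 4 * return_sum 4 - c 5 * return_sum 5 \<le>
        (\<Sum>i\<in>I. ln (deg i)) + c 0 * n - 0.511 * (\<Sum>i\<in>I. 2/3 - deg i / 18 - 1 / deg i) -
        1.398 * (25 / 7776 * ((\<Sum>i\<in>I. 6 * (real (deg i) - 4)) - 8 * (\<Sum>i\<in>I. max 0 (real (deg i) - 6))))"
      by (rule combine[OF mult_right_mono[OF c2 return_sum_nonneg] mult_right_mono[OF c5 return_sum_nonneg] z r2 r5])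
    also have "\<dots> = (\<Sum>i\<in>I. ln (deg i) + 0.0022 - 0.511 * (2/3 - deg i / 18 - 1 / deg i) -
        1.398 * (25 / 7776) * (6 * (real (deg i) - 4) - 8 * max 0 (real (deg i) - 6)))"
      by (simp only: c(1) sum.distrib sum_subtractf sum_distrib_left[symmetric]) (simp add: field_simps)
    also have "\<dots> \<le> (\<Sum>i\<in>I. 1.6648 + 0.173 * (real (deg i) - 6))"
    proof (rule sum_mono)
      fix i assume "i \<in> I"
      then show "ln (deg i) + 0.0022 - 0.511 * (2/3 - deg i / 18 - 1 / deg i) -
        1.398 * (25 / 7776) * (6 * (real (deg i) - 4) - 8 * max 0 (real (deg i) - 6)) \<le> 1.6648 + 0.173 * (real (deg i) - 6)"
        using vertex_bound_planar[OF deg_pos[of i]] by (simp only: diff_le_eq atLeastLessThan_iff)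
    qed
    also have "\<dots> = 1.6648 * n + 0.173 * (real (\<Sum>i\<in>I. deg i) - 6 * real n)"
      by (rule sum_linear_deg)
    also have "\<dots> \<le> 1.6648 * n"
    proof -
      have "real (\<Sum>i\<in>I. deg i) \<le> real (6 * n)" using edges by (rule of_nat_mono)
      then show ?thesis by simp
    qed
    finally show ?thesis by simp
  qed
  also have "\<dots> \<le> 5.28515 ^ n" by (rule exp_le_power[OF _ ln_target_planar]) simp
  finally show ?thesis .
qed

text \<open>The fourth trace is traded for the second: \<open>return_sum_4_ge\<close> raises the
  coefficient 0.4071 of \<open>return_sum 2\<close> to \<open>0.4071 + 4 * a * 0.5609\<close>. The
  third and fifth traces are dropped as nonnegative. The same \<open>a\<close> serves both trace
  bounds, because in a regular graph inverse degrees and two-step return probabilities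
  coincide.\<close>

lemma det_shifted_laplacian_le_quadrangular:
  fixes a :: real
  assumes a: "a \<ge> 0"
  shows "det (shifted_laplacian 1.0001) \<le> exp (\<Sum>i\<in>I. ln (deg i) + 0.0001 -
    (0.4071 + 4 * a * 0.5609) * (4 * a - 2 * a\<^sup>2 * deg i - 1 / deg i) + 0.5609 * (2 * a\<^sup>2 + 1 / real (deg i) ^ 3))"
proof -
  define c :: "nat \<Rightarrow> real" where
    "c k = [0.0001, 1/1.0001, 215/528/1.0001^2, 775/3564/1.0001^3, 500/891/1.0001^4, 500/891/1.0001^5] ! k" for k
  have c: "c 0 = 0.0001" "c 1 = 1/1.0001" "c 2 = 215/528/1.0001^2" "c 3 = 775/3564/1.0001^3"
      "c 4 = 500/891/1.0001^4" "c 5 = 500/891/1.0001^5"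
    unfolding c_def by (simp_all add: numeral_eq_Suc)
  have "det (shifted_laplacian 1.0001) \<le> exp ((\<Sum>i\<in>I. ln (deg i)) + c 0 * n -
    c 1 * return_sum 1 - c 2 * return_sum 2 - c 3 * return_sum 3 - c 4 * return_sum 4 - c 5 * return_sum 5)"
  proof (rule det_shifted_laplacian_le)
    fix x :: real assume x: "\<bar>x\<bar> \<le> 1"
    have "ln (1.0001 - x) \<le> 0.0001 + (- (x / 1.0001) - 215/528 * (x / 1.0001) ^ 2 - 775/3564 * (x / 1.0001) ^ 3 -
        500/891 * (x / 1.0001) ^ 4 - 500/891 * (x / 1.0001) ^ 5)"
      using ln_shift[OF x] ln_one_minus_le_quadrangular[of "x / 1.0001"] x by fastforce
    also have "\<dots> = c 0 - c 1 * x - c 2 * x ^ 2 - c 3 * x ^ 3 - c 4 * x ^ 4 - c 5 * x ^ 5"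
      unfolding c by (simp add: power_divide)
    finally show "ln (1.0001 - x) \<le> c 0 - c 1 * x - c 2 * x ^ 2 - c 3 * x ^ 3 - c 4 * x ^ 4 - c 5 * x ^ 5" .
  qed simp
  also have "\<dots> \<le> exp (\<Sum>i\<in>I. ln (deg i) + 0.0001 -
    (0.4071 + 4 * a * 0.5609) * (4 * a - 2 * a\<^sup>2 * deg i - 1 / deg i) + 0.5609 * (2 * a\<^sup>2 + 1 / real (deg i) ^ 3))"
  proof -
    have cs: "c 2 \<ge> 0.4071" "c 4 \<ge> 0.5609" "c 3 \<ge> 0" "c 5 \<ge> 0" unfolding c by (simp_all add: power_divide)
    define S where "S = (\<Sum>i\<in>I. 4 * a - 2 * a\<^sup>2 * deg i - 1 / deg i)"
    define U where "U = (\<Sum>i\<in>I. 1 / real (deg i) ^ 3)"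
    have h2: "0.4071 * return_sum 2 \<le> c 2 * return_sum 2" by (rule mult_right_mono[OF cs(1) return_sum_nonneg])
    have h4: "0.5609 * return_sum 4 \<le> c 4 * return_sum 4" by (rule mult_right_mono[OF cs(2) return_sum_nonneg])
    have h35: "0 \<le> c 3 * return_sum 3" "0 \<le> c 5 * return_sum 5"
      using cs return_sum_nonneg by simp_all
    have hw: "0.5609 * (4 * a * return_sum 2) - 0.5609 * (2 * a\<^sup>2 * n + U) \<le> 0.5609 * return_sum 4"
    proof -
      have "0.5609 * x - 0.5609 * (y + z) \<le> 0.5609 * r" if "x - y - z \<le> r" for x y z r :: real
        using that by (simp add: field_simps)
      then show ?thesis using return_sum_4_ge[of a, folded U_def] .
    qed
    have hk: "(0.4071 + 4 * a * 0.5609) * S \<le> 0.4071 * return_sum 2 + 0.5609 * (4 * a * return_sum 2)"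
    proof -
      have "(0.4071 + 4 * a * 0.5609) * S \<le> (0.4071 + 4 * a * 0.5609) * return_sum 2"
        using return_sum_2_ge[of a] a by (intro mult_left_mono) (auto simp: S_def)
      then show ?thesis by (simp add: algebra_simps)
    qed
    have combine: "g - x1 - x2 - x3 - x4 - x5 \<le> g - k + w"
      if "t2 \<le> x2" "t4 \<le> x4" "0 \<le> x3" "0 \<le> x5" "y - w \<le> t4" "k \<le> t2 + y" "x1 = 0"
      for g x1 x2 x3 x4 x5 k w t2 t4 y :: real using that by linarith
    have h1: "c 1 * return_sum 1 = 0" using return_sum_1 by simp
    have "(\<Sum>i\<in>I. ln (deg i)) + c 0 * n - c 1 * return_sum 1 - c 2 * return_sum 2 - c 3 * return_sum 3 -
        c 4 * return_sum 4 - c 5 * return_sum 5 \<le>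
        (\<Sum>i\<in>I. ln (deg i)) + c 0 * n - (0.4071 + 4 * a * 0.5609) * S + 0.5609 * (2 * a\<^sup>2 * n + U)"
      by (rule combine[OF h2 h4 h35 hw hk h1])
    also have "\<dots> = (\<Sum>i\<in>I. ln (deg i) + 0.0001 - (0.4071 + 4 * a * 0.5609) * (4 * a - 2 * a\<^sup>2 * deg i - 1 / deg i) +
        0.5609 * (2 * a\<^sup>2 + 1 / real (deg i) ^ 3))"
      by (simp only: c(1) S_def U_def sum.distrib sum_subtractf sum_distrib_left[symmetric]) (simp add: field_simps)
    finally show ?thesis by simp
  qed
  finally show ?thesis .
qed

lemma det_shifted_laplacian_le_girth4:
  assumes deg3: "\<And>i. i < n \<Longrightarrow> deg i \<ge> 3" and edges: "(\<Sum>i\<in>I. deg i) \<le> 4 * n"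
  shows "det (shifted_laplacian 1.0001) \<le> 3.41619 ^ n"
proof -
  have "(\<Sum>i\<in>I. ln (deg i) + 0.0001 - (0.4071 + 4 * (1/4) * 0.5609) * (4 * (1/4) - 2 * (1/4)\<^sup>2 * deg i - 1 / deg i) +
      0.5609 * (2 * (1/4)\<^sup>2 + 1 / real (deg i) ^ 3)) \<le> (\<Sum>i\<in>I. 1.2284 + 0.316 * (real (deg i) - 4))"
  proof (rule sum_mono)
    fix i assume "i \<in> I"
    then have "ln (deg i) + 0.0001 - 0.968 * (1 - deg i / 8 - 1 / deg i) + 0.5609 * (1/8 + 1 / real (deg i) ^ 3) -
        0.316 * (real (deg i) - 4) \<le> 1.2284" using deg3[of i] by (intro vertex_bound_girth4) auto
    then show "ln (deg i) + 0.0001 - (0.4071 + 4 * (1/4) * 0.5609) * (4 * (1/4) - 2 * (1/4)\<^sup>2 * deg i - 1 / deg i) +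
      0.5609 * (2 * (1/4)\<^sup>2 + 1 / real (deg i) ^ 3) \<le> 1.2284 + 0.316 * (real (deg i) - 4)"
    proof -
      have "(0.4071 + 4 * (1/4) * 0.5609) * (4 * (1/4) - 2 * (1/4)\<^sup>2 * x - u) = 0.968 * (1 - x / 8 - u)"
        "2 * (1/4)\<^sup>2 = (1/8 :: real)" for x u :: real by (simp_all add: power2_eq_square field_simps)
      then show ?thesis using \<open>_ \<le> 1.2284\<close> by (simp only: diff_le_eq)
    qed
  qed
  also have "\<dots> = 1.2284 * n + 0.316 * (real (\<Sum>i\<in>I. deg i) - 4 * real n)"
    by (rule sum_linear_deg)
  also have "\<dots> \<le> 1.2284 * n"
  proof -
    have "real (\<Sum>i\<in>I. deg i) \<le> real (4 * n)" using edges by (rule of_nat_mono)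
    then show ?thesis by simp
  qed
  finally have "det (shifted_laplacian 1.0001) \<le> exp (1.2284 * real n)"
    using det_shifted_laplacian_le_quadrangular[of "1/4"] by (meson exp_le_cancel_iff order_trans zero_le_divide_1_iff zero_le_numeral)
  also have "\<dots> \<le> 3.41619 ^ n" by (rule exp_le_power[OF _ ln_target_girth4]) simp
  finally show ?thesis .
qed

lemma det_shifted_laplacian_le_girth5:
  assumes deg3: "\<And>i. i < n \<Longrightarrow> deg i \<ge> 3" and edges: "3 * (\<Sum>i\<in>I. deg i) \<le> 10 * n"
  shows "det (shifted_laplacian 1.0001) \<le> 2.71567 ^ n"
proof -
  have "(\<Sum>i\<in>I. ln (deg i) + 0.0001 - (0.4071 + 4 * 0.3 * 0.5609) * (4 * 0.3 - 2 * 0.3\<^sup>2 * deg i - 1 / deg i) +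
      0.5609 * (2 * 0.3\<^sup>2 + 1 / real (deg i) ^ 3)) \<le> (\<Sum>i\<in>I. 0.999 + 0.38 * (real (deg i) - 10/3))"
  proof (rule sum_mono)
    fix i assume "i \<in> I"
    then have "ln (deg i) + 0.0001 - 1.08018 * (1.2 - 0.18 * deg i - 1 / deg i) + 0.5609 * (0.18 + 1 / real (deg i) ^ 3) -
        0.38 * (real (deg i) - 10/3) \<le> 0.999" using deg3[of i] by (intro vertex_bound_girth5) auto
    then show "ln (deg i) + 0.0001 - (0.4071 + 4 * 0.3 * 0.5609) * (4 * 0.3 - 2 * 0.3\<^sup>2 * deg i - 1 / deg i) +
      0.5609 * (2 * 0.3\<^sup>2 + 1 / real (deg i) ^ 3) \<le> 0.999 + 0.38 * (real (deg i) - 10/3)"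
    proof -
      have "(0.4071 + 4 * 0.3 * 0.5609) * (4 * 0.3 - 2 * 0.3\<^sup>2 * x - u) = 1.08018 * (1.2 - 0.18 * x - u)"
        "2 * 0.3\<^sup>2 = (0.18 :: real)" for x u :: real by (simp_all add: power2_eq_square field_simps)
      then show ?thesis using \<open>_ \<le> 0.999\<close> by (simp only: diff_le_eq)
    qed
  qed
  also have "\<dots> = 0.999 * n + 0.38 * (real (\<Sum>i\<in>I. deg i) - 10/3 * real n)"
    by (rule sum_linear_deg)
  also have "\<dots> \<le> 0.999 * n"
  proof -
    have "real (3 * (\<Sum>i\<in>I. deg i)) \<le> real (10 * n)" using edges by (rule of_nat_mono)
    then show ?thesis by simp
  qed
  finally have "exp (\<Sum>i\<in>I. ln (deg i) + 0.0001 - (0.4071 + 4 * 0.3 * 0.5609) * (4 * 0.3 - 2 * 0.3\<^sup>2 * deg i - 1 / deg i) +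
      0.5609 * (2 * 0.3\<^sup>2 + 1 / real (deg i) ^ 3)) \<le> exp (0.999 * real n)" by simp
  then have "det (shifted_laplacian 1.0001) \<le> exp (0.999 * real n)"
    by (rule order_trans[OF det_shifted_laplacian_le_quadrangular, rotated]) simp
  also have "\<dots> \<le> 2.71567 ^ n" by (rule exp_le_power[OF _ ln_target_girth5]) simp
  finally show ?thesis .
qed

end

section \<open>Conclusion\<close>

text \<open>Matrices are indexed by numbers, so the vertices are enumerated. For
  \<open>n \<ge> 2\<close> connectedness gives every vertex a neighbour, as the random walk
  requires.\<close>

locale enumerated_graph =
  fixes V :: "'a set" and E :: "'a set set" and b :: "nat \<Rightarrow> 'a" and n :: nat
  assumes simple: "simple_graph V E" and connected: "graph_connected V E"
    and bij: "bij_betw b {0..<n} V" and n2: "n \<ge> 2"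
begin

lemma edge_subset: "e \<in> E \<Longrightarrow> e \<subseteq> V" and card_edge: "e \<in> E \<Longrightarrow> card e = 2" and finite_V: "finite V"
  using simple by (auto simp: simple_graph_def)

lemma finite_E: "finite E"
proof (rule finite_subset)
  show "E \<subseteq> Pow V" using edge_subset by blast
qed (simp add: finite_V)

lemma b_in: "i < n \<Longrightarrow> b i \<in> V" and b_eq_iff: "i < n \<Longrightarrow> j < n \<Longrightarrow> b i = b j \<longleftrightarrow> i = j"
  using bij by (auto simp: bij_betw_def inj_on_def)

lemma b_surj: "v \<in> V \<Longrightarrow> \<exists>i<n. b i = v"
  using bij by (force simp: bij_betw_def)

definition "adj i j \<longleftrightarrow> i < n \<and> j < n \<and> {b i, b j} \<in> E"

sublocale indexed_graph n adj
proof
  fix i j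
  show "adj i j \<Longrightarrow> adj j i" by (auto simp: adj_def insert_commute)
  show "\<not> adj i i" using card_edge by (fastforce simp: adj_def)
  show "adj i j \<Longrightarrow> i < n" by (simp add: adj_def)
  assume i: "i < n"
  obtain k where k: "k < n" "k \<noteq> i" using n2 by (cases "i = 0") (auto intro: that[of 0] that[of 1])
  then have ne: "b i \<noteq> b k" using b_eq_iff i by blast
  have "(b i, b k) \<in> (adjacency E)\<^sup>*" using connected b_in i k by (auto simp: graph_connected_def)
  then obtain z where z: "(b i, z) \<in> adjacency E" using ne by (meson converse_rtranclE)
  then have e: "{b i, z} \<in> E" by (simp add: adjacency_def)
  then have "z \<in> V" using edge_subset by blast
  then obtain j where "j < n" "b j = z" using b_surj by blast
  then show "\<exists>j. adj i j" using e i by (auto simp: adj_def)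
qed

lemma sum_deg: "(\<Sum>i\<in>{0..<n}. deg i) = 2 * card E"
proof -
  let ?S = "\<lambda>e. {(i, j). i < n \<and> j < n \<and> {b i, b j} = e}"
  have two: "card (?S e) = 2" if e: "e \<in> E" for e
  proof -
    obtain x y where xy: "e = {x, y}" "x \<noteq> y" "x \<in> V" "y \<in> V"
      using card_edge[OF e] edge_subset[OF e] by (auto simp: card_2_iff)
    obtain i j where ij: "i < n" "b i = x" "j < n" "b j = y" using b_surj xy by metis
    have "?S e = {(i, j), (j, i)}"
    proof
      show "?S e \<subseteq> {(i, j), (j, i)}"
      proof
        fix z assume "z \<in> ?S e"
        then obtain k l where z: "z = (k, l)" and kl: "k < n" "l < n" "{b k, b l} = {b i, b j}" using ij xy by auto
        then have "b k = b i \<and> b l = b j \<or> b k = b j \<and> b l = b i" by (simp add: doubleton_eq_iff)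
        then show "z \<in> {(i, j), (j, i)}" using z kl ij b_eq_iff by auto
      qed
      show "{(i, j), (j, i)} \<subseteq> ?S e" using ij xy by auto
    qed
    moreover have "i \<noteq> j" using ij xy by auto
    ultimately show ?thesis by simp
  qed
  have "(\<Sum>i\<in>{0..<n}. deg i) = card (SIGMA i:{0..<n}. nbr i)"
    by (simp add: deg_def card_SigmaI)
  also have "(SIGMA i:{0..<n}. nbr i) = (\<Union>e\<in>E. ?S e)"
    by (auto simp: nbr_def adj_def)
  also have "card \<dots> = (\<Sum>e\<in>E. card (?S e))"
  proof (rule card_UN_disjoint[OF finite_E])
    show "\<forall>e\<in>E. finite (?S e)"
    proof
      fix e assume "e \<in> E"
      then show "finite (?S e)" using two[of e] card_ge_0_finite[of "?S e"] by simp
    qed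
    show "\<forall>e\<in>E. \<forall>e'\<in>E. e \<noteq> e' \<longrightarrow> ?S e \<inter> ?S e' = {}" by auto
  qed
  also have "\<dots> = (\<Sum>e\<in>E. 2)" using two by (intro sum.cong refl)
  finally show ?thesis by simp
qed

text \<open>Oriented towards \<open>b 0\<close>, a spanning tree becomes a function whose only fixed
  point is 0. The tree is recovered as the set of edges \<open>{b i, b (g i)}\<close> with
  \<open>i\<close> other than 0, so different trees give different functions.\<close>

lemma num_spanning_trees_le: "0.0001 * real (num_spanning_trees V E) \<le> det (shifted_laplacian 1.0001)"
proof -
  let ?I = "{0..<n}"
  define Q where "Q S g \<longleftrightarrow> g \<in> PiE ?I (\<lambda>i. insert i (nbr i)) \<and> (\<forall>i<n. g i = i \<longleftrightarrow> i = 0) \<and>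
    (\<exists>h :: nat \<Rightarrow> nat. \<forall>i<n. g i \<noteq> i \<longrightarrow> h (g i) < h i) \<and> S = (\<lambda>i. {b i, b (g i)}) ` (?I - {0})" for S g
  have "\<exists>g. Q S g" if S: "S \<in> spanning_trees V E" for S
  proof -
    have tree: "graph_tree V S" and sub: "S \<subseteq> E" using S by (auto simp: spanning_trees_def)
    have r: "b 0 \<in> V" using b_in n2 by simp
    obtain f and h :: "'a \<Rightarrow> nat" where f: "f (b 0) = b 0" "\<And>v. v \<in> V - {b 0} \<Longrightarrow> {v, f v} \<in> S \<and> h (f v) < h v"
      "S = (\<lambda>v. {v, f v}) ` (V - {b 0})"
    proof -
      have "e \<subseteq> V \<and> card e = 2" if "e \<in> S" for e using that sub edge_subset card_edge by blast
      from tree_parent_function[OF tree this r] show ?thesis using that by auto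
    qed
    have fV: "f v \<in> V" if "v \<in> V" for v
    proof (cases "v = b 0")
      case False
      then have "{v, f v} \<in> E" using f(2)[of v] that sub by auto
      then show ?thesis using edge_subset by blast
    qed (use f(1) r in simp)
    have "\<forall>i. \<exists>j. i < n \<longrightarrow> j < n \<and> b j = f (b i)" using b_surj fV b_in by blast
    then obtain g0 where g0: "\<And>i. i < n \<Longrightarrow> g0 i < n \<and> b (g0 i) = f (b i)" by metis
    define g where "g i = (if i < n then g0 i else undefined)" for i
    have g: "g i < n" "b (g i) = f (b i)" if "i < n" for i using g0[OF that] that by (auto simp: g_def)
    have nz: "b i \<in> V - {b 0}" if "i < n" "i \<noteq> 0" for i using b_in that b_eq_iff[of i 0] n2 by auto
    have root: "g i = i \<longleftrightarrow> i = 0" if i: "i < n" for i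
    proof
      assume "g i = i"
      then have "f (b i) = b i" using g[OF i] by simp
      then show "i = 0" using f(2)[OF nz[OF i]] by force
    next
      assume "i = 0"
      then have "b (g i) = b i" using g[OF i] f(1) by simp
      then show "g i = i" using b_eq_iff g[OF i] i by blast
    qed
    have "g \<in> PiE ?I (\<lambda>i. insert i (nbr i))"
    proof (rule PiE_I)
      fix i assume "i \<in> ?I"
      then have i: "i < n" by simp
      show "g i \<in> insert i (nbr i)"
      proof (cases "i = 0")
        case False
        have "{b i, b (g i)} \<in> E" using f(2)[OF nz[OF i False]] g[OF i] sub by auto
        then show ?thesis using i g[OF i] by (simp add: nbr_def adj_def)
      qed (use root[OF i] in auto)
    qed (simp add: g_def)
    moreover have "h (b (g i)) < h (b i)" if "i < n" "g i \<noteq> i" for i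
      using f(2)[OF nz[of i]] g[OF that(1)] root[OF that(1)] that by auto
    then have "\<exists>h :: nat \<Rightarrow> nat. \<forall>i<n. g i \<noteq> i \<longrightarrow> h (g i) < h i"
      by (intro exI[of _ "h \<circ> b"]) auto
    moreover have "S = (\<lambda>i. {b i, b (g i)}) ` (?I - {0})"
    proof -
      have "V - {b 0} = b ` (?I - {0})" using bij n2
        by (simp add: bij_betw_def inj_on_image_set_diff[of b ?I])
      then show ?thesis using f(3) g by (auto simp: image_image)
    qed
    ultimately have "Q S g" unfolding Q_def using root by blast
    then show ?thesis by blast
  qed
  then obtain G where G: "\<And>S. S \<in> spanning_trees V E \<Longrightarrow> Q S (G S)" by metis
  let ?T = "G ` spanning_trees V E"
  have "inj_on G (spanning_trees V E)"
  proof (rule inj_onI)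
    fix S S' assume "S \<in> spanning_trees V E" "S' \<in> spanning_trees V E" "G S = G S'"
    then show "S = S'" using G[of S] G[of S'] unfolding Q_def by simp
  qed
  then have "card ?T = num_spanning_trees V E" by (simp add: card_image num_spanning_trees_def)
  moreover have "0.0001 * card ?T \<le> det (shifted_laplacian (1 + 0.0001))"
  proof (rule det_shifted_laplacian_ge)
    show "(0::real) \<le> 0.0001" "0 < n" using n2 by simp_all
    show "?T \<subseteq> PiE ?I (\<lambda>i. insert i (nbr i))"
    proof
      fix f assume "f \<in> ?T"
      then obtain S where "f = G S" "Q S (G S)" using G by blast
      then show "f \<in> PiE ?I (\<lambda>i. insert i (nbr i))" by (simp only: Q_def)
    qed
    show "f i = i \<longleftrightarrow> i = 0" if "f \<in> ?T" "i < n" for f i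
    proof -
      obtain S where "f = G S" "Q S (G S)" using \<open>f \<in> ?T\<close> G by blast
      then show ?thesis using that(2) by (simp only: Q_def)
    qed
    show "\<exists>h :: nat \<Rightarrow> nat. \<forall>i<n. f i \<noteq> i \<longrightarrow> h (f i) < h i" if "f \<in> ?T" for f
    proof -
      obtain S where "f = G S" "Q S (G S)" using \<open>f \<in> ?T\<close> G by blast
      then show ?thesis by (simp only: Q_def)
    qed
  qed
  ultimately show ?thesis by simp
qed

text \<open>Deleting at most two neighbours would cut the vertex off from the rest, and a further
  vertex remains because there are more than three.\<close>

lemma min_degree:
  assumes conn: "k_connected 3 V E" and i: "i < n"
  shows "deg i \<ge> 3"
proof (rule ccontr)
  assume "\<not> deg i \<ge> 3"
  define S where "S = b ` nbr i"
  have "card S \<le> deg i" unfolding S_def deg_def by (intro card_image_le) simp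
  with \<open>\<not> deg i \<ge> 3\<close> have S: "card S < 3" by simp
  have SV: "S \<subseteq> V" using nbr_subset[of i] b_in by (auto simp: S_def)
  have vS: "b i \<notin> S"
    using nbr_subset[of i] b_eq_iff[OF i] adj_irrefl by (force simp: S_def nbr_def)
  have con: "graph_connected (V - S) (delete_vertices_edges S E)" and "3 < card V"
    using conn SV S by (auto simp: k_connected_def)
  have "\<not> V \<subseteq> insert (b i) S"
  proof
    assume "V \<subseteq> insert (b i) S"
    then have "card V \<le> card (insert (b i) S)" using SV finite_V by (intro card_mono) (auto intro: finite_subset)
    also have "\<dots> \<le> Suc (card S)" by (rule card_insert_le_m1) auto
    finally show False using \<open>3 < card V\<close> S by simp
  qed
  then obtain u where u: "u \<in> V - S" "u \<noteq> b i" by blast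
  then have "(b i, u) \<in> (adjacency (delete_vertices_edges S E))\<^sup>*"
    using con vS b_in[OF i] by (auto simp: graph_connected_def)
  then obtain z where z: "(b i, z) \<in> adjacency (delete_vertices_edges S E)" using u by (metis converse_rtranclE)
  then have e: "{b i, z} \<in> E" "z \<notin> S" by (auto simp: adjacency_def delete_vertices_edges_def)
  then have "z \<in> V" using edge_subset by blast
  then obtain j where "j < n" "b j = z" using b_surj by blast
  then have "z \<in> S" using e i by (auto simp: S_def nbr_def adj_def)
  then show False using e by blast
qed

lemma det_shifted_laplacian_le_facial_triangles:
  assumes fin: "finite TT" and tri: "\<And>t. t \<in> TT \<Longrightarrow> card t = 3 \<and> (\<forall>e. e \<subseteq> t \<and> card e = 2 \<longrightarrow> e \<in> E)"
    and two: "\<And>e. e \<in> E \<Longrightarrow> card {t \<in> TT. e \<subseteq> t} \<le> 2"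
    and many: "2 * card E \<le> card TT + 4 * n" and edges: "card E \<le> 3 * n"
  shows "det (shifted_laplacian 1.0001) \<le> 5.28515 ^ n"
proof -
  define pre where "pre t = {i. i < n \<and> b i \<in> t}" for t
  have pair: "{u, v} \<in> E" if "t \<in> TT" "u \<in> t" "v \<in> t" "u \<noteq> v" for t u v
    using tri[OF that(1)] that by auto
  have tV: "t \<subseteq> V" if t: "t \<in> TT" for t
  proof
    fix x assume x: "x \<in> t"
    have "t \<noteq> {x}" using tri[OF t] by auto
    then obtain y where "y \<in> t" "x \<noteq> y" using x by blast
    then show "x \<in> V" using pair[OF t x] edge_subset by blast
  qed
  have im: "b ` pre t = t" if "t \<in> TT" for t
    using tV[OF that] b_surj by (force simp: pre_def)
  have inj_b: "inj_on b (pre t)" for t using b_eq_iff by (auto simp: inj_on_def pre_def)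
  have inj: "inj_on pre TT" using im by (metis inj_onI)
  show ?thesis
  proof (rule det_shifted_laplacian_le_planar[of "pre ` TT"])
    show "finite (pre ` TT)" using fin by simp
    show "card s = 3" if s: "s \<in> pre ` TT" for s
    proof -
      obtain t where t: "t \<in> TT" "s = pre t" using s by blast
      have "card (b ` pre t) = card (pre t)" by (rule card_image[OF inj_b])
      then show ?thesis using t im tri by simp
    qed
    show "adj u v" if "s \<in> pre ` TT" "u \<in> s" "v \<in> s" "u \<noteq> v" for s u v
    proof -
      obtain t where t: "t \<in> TT" "s = pre t" using \<open>s \<in> pre ` TT\<close> by blast
      have uv: "u < n" "v < n" "b u \<in> t" "b v \<in> t" using t that by (auto simp: pre_def)
      then have "b u \<noteq> b v" using b_eq_iff that by blast
      then show ?thesis using pair[OF t(1) uv(3,4)] uv by (simp add: adj_def)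
    qed
    show "card {s \<in> pre ` TT. {u, v} \<subseteq> s} \<le> 2" if uv: "adj u v" for u v
    proof -
      have "{s \<in> pre ` TT. {u, v} \<subseteq> s} \<subseteq> pre ` {t \<in> TT. {b u, b v} \<subseteq> t}" by (auto simp: pre_def)
      then have "card {s \<in> pre ` TT. {u, v} \<subseteq> s} \<le> card (pre ` {t \<in> TT. {b u, b v} \<subseteq> t})"
        using fin by (intro card_mono) auto
      also have "\<dots> \<le> card {t \<in> TT. {b u, b v} \<subseteq> t}" using fin by (intro card_image_le) auto
      also have "\<dots> \<le> 2" using uv by (intro two) (simp add: adj_def)
      finally show ?thesis .
    qed
    show "(\<Sum>i\<in>{0..<n}. deg i) \<le> card (pre ` TT) + 4 * n"
      using many unfolding sum_deg card_image[OF inj] .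
    show "(\<Sum>i\<in>{0..<n}. deg i) \<le> 6 * n" using edges unfolding sum_deg by simp
  qed
qed

end

section \<open>The three bounds for planar graphs\<close>

lemma num_spanning_trees_disconnected:
  assumes "\<not> graph_connected V E"
  shows "num_spanning_trees V E = 0"
proof -
  have "graph_connected V E" if "T \<subseteq> E" "graph_connected V T" for T
  proof -
    have "(adjacency T)\<^sup>* \<subseteq> (adjacency E)\<^sup>*" using that(1) by (intro rtrancl_mono) (auto simp: adjacency_def)
    then show ?thesis using that(2) by (auto simp: graph_connected_def)
  qed
  then have "spanning_trees V E = {}" using assms by (auto simp: spanning_trees_def graph_tree_def)
  then show ?thesis by (simp add: num_spanning_trees_def)
qed

lemma no_triangle_cycle_length:
  assumes "\<not> has_triangle E" "graph_cycle E vs"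
  shows "4 \<le> length vs"
proof -
  have "3 \<le> length vs" using assms(2) by (simp add: graph_cycle_def)
  moreover have "length vs \<noteq> 3" using assms unfolding has_triangle_def by blast
  ultimately show ?thesis by simp
qed

lemma no_quadrilateral_cycle_length:
  assumes "\<not> has_triangle E" "\<not> has_quadrilateral E" "graph_cycle E vs"
  shows "5 \<le> length vs"
proof -
  have "4 \<le> length vs" using no_triangle_cycle_length assms by blast
  moreover have "length vs \<noteq> 4" using assms unfolding has_quadrilateral_def by blast
  ultimately show ?thesis by simp
qed

lemma planar_spanning_trees:
  fixes V :: "'a set"
  assumes planar: "planar_graph V E" and con: "graph_connected V E" and n: "card V = n" "n \<ge> 2"
  shows "real (num_spanning_trees V E) \<le> 10000 * 5.28515 ^ n"
    and "k_connected 3 V E \<Longrightarrow> \<not> has_triangle E \<Longrightarrow> real (num_spanning_trees V E) \<le> 10000 * 3.41619 ^ n"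
    and "k_connected 3 V E \<Longrightarrow> \<not> has_triangle E \<Longrightarrow> \<not> has_quadrilateral E \<Longrightarrow>
      real (num_spanning_trees V E) \<le> 10000 * 2.71567 ^ n"
proof -
  obtain p \<gamma> where "plane_graph V E p \<gamma>"
    using planar by (auto simp: planar_graph_def plane_graph_def)
  then interpret P: plane_graph V E p \<gamma> .
  obtain b where b: "bij_betw b {0..<n} V"
    using ex_bij_betw_nat_finite[OF P.finite_V] n by auto
  interpret G: enumerated_graph V E b n
    using P.simple con b n by unfold_locales
  have bound: "real (num_spanning_trees V E) \<le> 10000 * x" if "det (G.shifted_laplacian 1.0001) \<le> x" for x
    using G.num_spanning_trees_le that by simp
  have edges3: "card E \<le> 3 * n"
    using P.girth_edge_bound[OF con, of 3] n by (auto simp: graph_cycle_def)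
  show "real (num_spanning_trees V E) \<le> 10000 * 5.28515 ^ n"
  proof (rule bound)
    obtain TT where TT: "finite TT" "\<forall>t\<in>TT. card t = 3 \<and> (\<forall>e. e \<subseteq> t \<and> card e = 2 \<longrightarrow> e \<in> E)"
      "\<forall>e\<in>E. card {t \<in> TT. e \<subseteq> t} \<le> 2" "2 * card E \<le> card TT + 4 * card V"
      using P.ex_facial_triangles[OF con] by auto
    then show "det (G.shifted_laplacian 1.0001) \<le> 5.28515 ^ n"
      using edges3 n by (intro G.det_shifted_laplacian_le_facial_triangles[of TT]) auto
  qed
  have three: "3 * n \<le> 2 * card E" if "k_connected 3 V E"
  proof -
    have "(\<Sum>i\<in>{0..<n}. 3) \<le> (\<Sum>i\<in>{0..<n}. G.deg i)" using G.min_degree[OF that] by (intro sum_mono) auto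
    then show ?thesis unfolding G.sum_deg by simp
  qed
  show "real (num_spanning_trees V E) \<le> 10000 * 3.41619 ^ n" if k: "k_connected 3 V E" and t: "\<not> has_triangle E"
  proof (rule bound, rule G.det_shifted_laplacian_le_girth4)
    have "card E < card V \<or> 4 * (card E + 2) \<le> 2 * card E + 4 * card V"
      using no_triangle_cycle_length[OF t] by (intro P.girth_edge_bound[OF con])
    then show "(\<Sum>i\<in>{0..<n}. G.deg i) \<le> 4 * n" unfolding G.sum_deg using three[OF k] n by auto
  qed (rule G.min_degree[OF k])
  show "real (num_spanning_trees V E) \<le> 10000 * 2.71567 ^ n"
    if k: "k_connected 3 V E" and t: "\<not> has_triangle E" "\<not> has_quadrilateral E"
  proof (rule bound, rule G.det_shifted_laplacian_le_girth5)
    have "card E < card V \<or> 5 * (card E + 2) \<le> 2 * card E + 5 * card V"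
      using no_quadrilateral_cycle_length[OF t] by (intro P.girth_edge_bound[OF con])
    then show "3 * (\<Sum>i\<in>{0..<n}. G.deg i) \<le> 10 * n" unfolding G.sum_deg using three[OF k] n by auto
  qed (rule G.min_degree[OF k])
qed

lemma num_spanning_trees_single:
  assumes "simple_graph V E" "card V = 1"
  shows "num_spanning_trees V E \<le> 1"
proof -
  have "e \<notin> E" for e
  proof
    assume "e \<in> E"
    then have "e \<subseteq> V" "finite V" "card e = 2" using assms by (auto simp: simple_graph_def)
    then show False using card_mono[of V e] assms(2) by simp
  qed
  then have "spanning_trees V E \<subseteq> {{}}" by (auto simp: spanning_trees_def)
  then show ?thesis unfolding num_spanning_trees_def using card_mono[of "{{}}" "spanning_trees V E"] by simp
qed

theorem theorem1:
  shows "\<exists>c::real. c > 0 \<and>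
    (\<forall>n\<ge>1. \<forall>(V :: 'a set) E. planar_graph V E \<and> card V = n \<longrightarrow>
       real (num_spanning_trees V E) \<le> c * 5.28515 ^ n \<and>
       (k_connected 3 V E \<and> \<not> has_triangle E \<longrightarrow>
          real (num_spanning_trees V E) \<le> c * 3.41619 ^ n) \<and>
       (k_connected 3 V E \<and> \<not> has_triangle E \<and> \<not> has_quadrilateral E \<longrightarrow>
          real (num_spanning_trees V E) \<le> c * 2.71567 ^ n))"
proof (intro exI[of _ 10000] conjI allI impI)
  fix n and V :: "'a set" and E
  assume n: "1 \<le> n" and VE: "planar_graph V E \<and> card V = n"
  show "real (num_spanning_trees V E) \<le> 10000 * 5.28515 ^ n"
    and "k_connected 3 V E \<and> \<not> has_triangle E \<Longrightarrow> real (num_spanning_trees V E) \<le> 10000 * 3.41619 ^ n"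
    and "k_connected 3 V E \<and> \<not> has_triangle E \<and> \<not> has_quadrilateral E \<Longrightarrow>
      real (num_spanning_trees V E) \<le> 10000 * 2.71567 ^ n"
  proof -
    \<comment> \<open>Disconnected graphs have no spanning tree. A single vertex is treated apart
      because it has no neighbour to walk to. The constant 10000 is the reciprocal of the shift
      0.0001.\<close>
    consider "\<not> graph_connected V E" | "n = 1" | "graph_connected V E" "n \<ge> 2" using n by linarith
    then have "real (num_spanning_trees V E) \<le> 10000 * 5.28515 ^ n \<and>
      (k_connected 3 V E \<and> \<not> has_triangle E \<longrightarrow> real (num_spanning_trees V E) \<le> 10000 * 3.41619 ^ n) \<and>
      (k_connected 3 V E \<and> \<not> has_triangle E \<and> \<not> has_quadrilateral E \<longrightarrow>
        real (num_spanning_trees V E) \<le> 10000 * 2.71567 ^ n)"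
    proof cases
      case 1
      then show ?thesis by (simp add: num_spanning_trees_disconnected)
    next
      case 2
      then have "num_spanning_trees V E \<le> 1"
        using VE by (intro num_spanning_trees_single) (auto simp: planar_graph_def)
      then have "real (num_spanning_trees V E) \<le> 1" by simp
      then show ?thesis using 2 by simp
    next
      case 3
      then show ?thesis using VE planar_spanning_trees[of V E n] by blast
    qed
    then show "real (num_spanning_trees V E) \<le> 10000 * 5.28515 ^ n"
      and "k_connected 3 V E \<and> \<not> has_triangle E \<Longrightarrow> real (num_spanning_trees V E) \<le> 10000 * 3.41619 ^ n"
      and "k_connected 3 V E \<and> \<not> has_triangle E \<and> \<not> has_quadrilateral E \<Longrightarrow>
        real (num_spanning_trees V E) \<le> 10000 * 2.71567 ^ n" by blast+
  qed
qed simp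

end
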